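(* Let $\alpha,\delta\in\mathbb R$, let $(X_t)_{t\ge0}$ be an additive $(\alpha,\delta)$-dilatively stable process and let $(L(t))_{t\in\mathbb R}$ be the two-sided Lévy process generated by the law of $Y_1=\int_1^eu^{-\alpha+\delta/2}\,dX_u$. Then $$(X_t)_{t\ge0}\stackrel{\rm d}{=}\Big(\int_{-\infty}^{\log t}e^{u(\alpha-\delta/2)}\,dL\big(\tfrac{e^{\delta u}-1}{e^{\delta}-1}\big)\Big)_{t\ge0},$$ where $\stackrel{\rm d}{=}$ denotes equality of all finite-dimensional distributions.
   Context: All processes are real-valued. Additive process $(X_t)_{t\ge0}$: (i) for any $0\le t_0<t_1<\dots<t_n$ the random variables $X_{t_0},X_{t_1}-X_{t_0},\dots,X_{t_n}-X_{t_{n-1}}$ are independent; (ii) it is stochastically continuous; (iii) almost surely its paths are right-continuous with left limits (càdlàg); (iv) $X_0=0$ almost surely. A process is infinitely divisible if all its finite-dimensional distributions are. For an infinitely divisible process $X$, $\Psi^X_{t_1,\dots,t_k}:\mathbb R^k\to\mathbb C$ denotes the log-characteristic function (Lévy exponent) of $(X_{t_1},\dots,X_{t_k})$, i.e. the unique continuous function with $\Psi^X_{t_1,\dots,t_k}(0,\dots,0)=0$ and $\mathbb E[\exp(i\sum_j\theta_jX_{t_j})]=\exp(\Psi^X_{t_1,\dots,t_k}(\theta_1,\dots,\theta_k))$. An infinitely divisible process $(X_t)_{t\ge0}$ is $(\alpha,\delta)$-dilatively stable if $\Psi^X_{Tt_1,\dots,Tt_k}(\theta_1,\dots,\theta_k)=T^{\delta}\,\Psi^X_{t_1,\dots,t_k}(T^{\alpha-\delta/2}\theta_1,\dots,T^{\alpha-\delta/2}\theta_k)$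 for all $T>0$, $k\in\mathbb N$, $t_1,\dots,t_k\ge0$, $\theta_1,\dots,\theta_k\in\mathbb R$. Two-sided Lévy process generated by the law of an infinitely divisible random variable $\xi$: $L(t)=L^{(1)}(t)$ for $t\ge0$ and $L(t)=-L^{(2)}((-t)-)$ for $t<0$ (left limit at $-t$), where $L^{(1)},L^{(2)}$ are independent copies of the (càdlàg) Lévy process whose value at time $1$ has the law of $\xi$. For $\delta=0$ the time change $\frac{e^{\delta t}-1}{e^\delta-1}$ is understood as its limit $t$. Integration $dL(\tfrac{e^{\delta u}-1}{e^\delta-1})$ means integration with respect to the process $u\mapsto L(\tfrac{e^{\delta u}-1}{e^\delta-1})$. Random integral: for a process $Y$ with càdlàg paths, a continuously differentiable function $A$ and $a<b$, $\int_a^bA(t)\,dY_t:=A(b)Y_b-A(a)Y_a-\int_a^bA'(t)Y_t\,dt$ (pathwise Riemann integral). $\int_{-\infty}^{b}A(t)\,dY_t$ denotes the almost sure limit of $\int_a^bA(t)\,dY_t$ as $a\downarrow-\infty$; for $t=0$ the integral $\int_{-\infty}^{\log 0}$ is read as $0$. *)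

theory Defs
  imports "HOL-Probability.Probability"
begin

text \<open>
  A vector of \<open>\<real>\<^sup>k\<close> is a function \<open>nat \<Rightarrow> real\<close> that is extensional on \<open>{..<k}\<close>.  With the
  product topology on \<open>nat \<Rightarrow> real\<close> and the sigma-algebra \<open>Pi\<^sub>M {..<k} (\<lambda>_. borel)\<close> this is the
  usual Euclidean space.  A process is a function \<open>real \<Rightarrow> 'a \<Rightarrow> real\<close> of time and sample point;
  for processes indexed by \<open>{0..}\<close> the values at negative times play no role.
\<close>

abbreviation Rvec :: "nat \<Rightarrow> (nat \<Rightarrow> real) set" where
  "Rvec k \<equiv> (\<Pi>\<^sub>E j\<in>{..<k}. UNIV)"

abbreviation borel_Rvec :: "nat \<Rightarrow> (nat \<Rightarrow> real) measure" where
  "borel_Rvec k \<equiv> (\<Pi>\<^sub>M j\<in>{..<k}. borel)"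

definition real_process :: "'a measure \<Rightarrow> (real \<Rightarrow> 'a \<Rightarrow> real) \<Rightarrow> bool" where
  "real_process M X \<longleftrightarrow> prob_space M \<and> (\<forall>t\<ge>0. X t \<in> borel_measurable M)"

definition fdd :: "'a measure \<Rightarrow> (real \<Rightarrow> 'a \<Rightarrow> real) \<Rightarrow> nat \<Rightarrow> (nat \<Rightarrow> real) \<Rightarrow> (nat \<Rightarrow> real) measure" where
  "fdd M X k t = distr M (borel_Rvec k) (\<lambda>\<omega>. \<lambda>j\<in>{..<k}. X (t j) \<omega>)"

definition eq_fdd :: "'a measure \<Rightarrow> (real \<Rightarrow> 'a \<Rightarrow> real) \<Rightarrow> 'b measure \<Rightarrow> (real \<Rightarrow> 'b \<Rightarrow> real) \<Rightarrow> bool" where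
  "eq_fdd M X N Y \<longleftrightarrow> (\<forall>k t. (\<forall>j<k. 0 \<le> t j) \<longrightarrow> fdd M X k t = fdd N Y k t)"

definition cadlag_on :: "real set \<Rightarrow> (real \<Rightarrow> real) \<Rightarrow> bool" where
  "cadlag_on S f \<longleftrightarrow>
     (\<forall>t\<in>S. (f \<longlongrightarrow> f t) (at t within S \<inter> {t<..}) \<and> (\<exists>l. (f \<longlongrightarrow> l) (at t within S \<inter> {..<t})))"

definition additive_process :: "'a measure \<Rightarrow> (real \<Rightarrow> 'a \<Rightarrow> real) \<Rightarrow> bool" where
  "additive_process M X \<longleftrightarrow>
     real_process M X \<and>
     (\<forall>n t. 0 \<le> t 0 \<and> (\<forall>i<n. t i < t (Suc i)) \<longrightarrow>
        prob_space.indep_vars M (\<lambda>_. borel)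
          (\<lambda>i \<omega>. if i = 0 then X (t 0) \<omega> else X (t i) \<omega> - X (t (i - 1)) \<omega>) {..n::nat}) \<and>
     (\<forall>s\<ge>0. \<forall>\<epsilon>>0.
        ((\<lambda>t. measure M {\<omega>\<in>space M. \<bar>X t \<omega> - X s \<omega>\<bar> > \<epsilon>}) \<longlongrightarrow> 0) (at s within {0..})) \<and>
     (AE \<omega> in M. cadlag_on {0..} (\<lambda>t. X t \<omega>)) \<and>
     (AE \<omega> in M. X 0 \<omega> = 0)"

text \<open>A law is infinitely divisible if, for every \<open>n \<ge> 1\<close>, it is the law of a sum of \<open>n\<close>
  independent identically distributed terms; the product measure carries the independent copies.\<close>

definition infdiv :: "real measure \<Rightarrow> bool" where
  "infdiv \<mu> \<longleftrightarrow>
     (\<forall>n\<ge>1. \<exists>\<nu>. prob_space \<nu> \<and> sets \<nu> = sets borel \<and>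
        \<mu> = distr (\<Pi>\<^sub>M i\<in>{..<n::nat}. \<nu>) borel (\<lambda>x. \<Sum>i<n. x i))"

definition infdiv_vec :: "nat \<Rightarrow> (nat \<Rightarrow> real) measure \<Rightarrow> bool" where
  "infdiv_vec k \<mu> \<longleftrightarrow>
     (\<forall>n\<ge>1. \<exists>\<nu>. prob_space \<nu> \<and> sets \<nu> = sets (borel_Rvec k) \<and>
        \<mu> = distr (\<Pi>\<^sub>M i\<in>{..<n::nat}. \<nu>) (borel_Rvec k) (\<lambda>x. \<lambda>j\<in>{..<k}. \<Sum>i<n. x i j))"

definition infdiv_process :: "'a measure \<Rightarrow> (real \<Rightarrow> 'a \<Rightarrow> real) \<Rightarrow> bool" where
  "infdiv_process M X \<longleftrightarrow>
     real_process M X \<and> (\<forall>k t. (\<forall>j<k. 0 \<le> t j) \<longrightarrow> infdiv_vec k (fdd M X k t))"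

text \<open>Extensionality only fixes the value outside \<open>\<real>\<^sup>k\<close>, so that \<open>THE\<close> picks a unique function.\<close>

definition levy_exponent ::
  "'a measure \<Rightarrow> (real \<Rightarrow> 'a \<Rightarrow> real) \<Rightarrow> nat \<Rightarrow> (nat \<Rightarrow> real) \<Rightarrow> (nat \<Rightarrow> real) \<Rightarrow> complex" where
  "levy_exponent M X k t =
     (THE \<Psi>. \<Psi> \<in> extensional (Rvec k) \<and> continuous_on (Rvec k) \<Psi> \<and> \<Psi> (\<lambda>j\<in>{..<k}. 0) = 0 \<and>
        (\<forall>\<theta>\<in>Rvec k. (CLINT \<omega>|M. iexp (\<Sum>j<k. \<theta> j * X (t j) \<omega>)) = exp (\<Psi> \<theta>)))"

definition dilatively_stable ::
  "'a measure \<Rightarrow> (real \<Rightarrow> 'a \<Rightarrow> real) \<Rightarrow> real \<Rightarrow> real \<Rightarrow> bool" where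
  "dilatively_stable M X \<alpha> \<delta> \<longleftrightarrow>
     infdiv_process M X \<and>
     (\<forall>T>0. \<forall>k t. (\<forall>j<k. 0 \<le> t j) \<longrightarrow> (\<forall>\<theta>\<in>Rvec k.
        levy_exponent M X k (\<lambda>j. T * t j) \<theta> =
        of_real (T powr \<delta>) * levy_exponent M X k t (\<lambda>j\<in>{..<k}. T powr (\<alpha> - \<delta> / 2) * \<theta> j)))"

definition levy_process :: "'a measure \<Rightarrow> (real \<Rightarrow> 'a \<Rightarrow> real) \<Rightarrow> bool" where
  "levy_process M X \<longleftrightarrow>
     additive_process M X \<and>
     (\<forall>s t. 0 \<le> s \<and> s \<le> t \<longrightarrow> distr M borel (\<lambda>\<omega>. X t \<omega> - X s \<omega>) = distr M borel (X (t - s)))"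

definition two_sided :: "(real \<Rightarrow> 'a \<Rightarrow> real) \<Rightarrow> (real \<Rightarrow> 'a \<Rightarrow> real) \<Rightarrow> real \<Rightarrow> 'a \<Rightarrow> real" where
  "two_sided L1 L2 t \<omega> = (if 0 \<le> t then L1 t \<omega> else - Lim (at_left (- t)) (\<lambda>s. L2 s \<omega>))"

definition two_sided_levy_process :: "'a measure \<Rightarrow> (real \<Rightarrow> 'a \<Rightarrow> real) \<Rightarrow> real measure \<Rightarrow> bool" where
  "two_sided_levy_process N L \<mu> \<longleftrightarrow>
     infdiv \<mu> \<and>
     (\<exists>L1 L2. levy_process N L1 \<and> levy_process N L2 \<and>
        distr N borel (L1 1) = \<mu> \<and> distr N borel (L2 1) = \<mu> \<and>
        prob_space.indep_var N
          (\<Pi>\<^sub>M t\<in>{0..}. borel) (\<lambda>\<omega>. \<lambda>t\<in>{0..}. L1 t \<omega>)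
          (\<Pi>\<^sub>M t\<in>{0..}. borel) (\<lambda>\<omega>. \<lambda>t\<in>{0..}. L2 t \<omega>) \<and>
        L = two_sided L1 L2)"

definition time_change :: "real \<Rightarrow> real \<Rightarrow> real" where
  "time_change \<delta> t = (if \<delta> = 0 then t else (exp (\<delta> * t) - 1) / (exp \<delta> - 1))"

text \<open>Cadlag functions are Riemann integrable on compact intervals, so on such paths the
  (Henstock-Kurzweil) \<open>integral\<close> of the library is the Riemann integral.\<close>

definition random_integral :: "(real \<Rightarrow> real) \<Rightarrow> (real \<Rightarrow> real) \<Rightarrow> real \<Rightarrow> real \<Rightarrow> real" where
  "random_integral A y a b = A b * y b - A a * y a - integral {a..b} (\<lambda>t. deriv A t * y t)"

definition random_integral_at_bot :: "(real \<Rightarrow> real) \<Rightarrow> (real \<Rightarrow> real) \<Rightarrow> real \<Rightarrow> real" where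
  "random_integral_at_bot A y b = Lim at_bot (\<lambda>a. random_integral A y a b)"

text \<open>Paths are cadlag only almost surely, so pathwise integrals, left limits and almost sure limits
  are random variables up to a null set.  Their laws are therefore taken with respect to the
  \<open>completion\<close> of the underlying probability measure.\<close>

definition law :: "'a measure \<Rightarrow> ('a \<Rightarrow> real) \<Rightarrow> real measure" where
  "law M Y = distr (completion M) borel Y"

end

theory Submission
  imports Defs
begin

text \<open>
  Put \<open>\<beta> = \<alpha> - \<delta>/2\<close>, \<open>W u = X (exp u)\<close> and let \<open>\<tau>\<close> be the time change.  Dilative stability says that
  the L\'evy exponent of \<open>W (u + h) - W u\<close> at \<open>\<theta>\<close> is \<open>exp (\<delta> u)\<close> times that of \<open>W h - W 0\<close> at
  \<open>exp (\<beta> u) \<theta>\<close>, and \<open>exp (\<delta> u) \<tau> h = \<tau> (u + h) - \<tau> u\<close>.  Let \<open>\<Psi>\<^sub>n\<close> be the exponent of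
  \<open>W (1/n) - W 0\<close> divided by \<open>\<tau> (1/n)\<close>.  The Riemann sum of step \<open>1/n\<close> for \<open>Y\<^sub>1\<close> has exponent exactly
  \<open>\<Psi>\<^sub>n\<close>, so \<open>\<Psi>\<^sub>n\<close> converges locally uniformly to the exponent \<open>\<psi>\<close> of \<open>\<mu>\<close>.  A linear combination of
  increments of \<open>W\<close> over the grid has exponent \<open>\<Sum>i. (\<tau> u\<^sub>i\<^sub>+\<^sub>1 - \<tau> u\<^sub>i) \<Psi>\<^sub>n (exp (\<beta> u\<^sub>i) c\<^sub>i)\<close>, while the
  Riemann sum of the corresponding integrals against \<open>L \<circ> \<tau>\<close> has the same exponent with \<open>\<psi>\<close> in
  place of \<open>\<Psi>\<^sub>n\<close>.  In the limit the increments of \<open>W\<close> and the integrals agree in law, by uniqueness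
  of multivariate characteristic functions.  Convergence at \<open>-\<infinity>\<close> is a property of the law of
  countably many integrals, so it is inherited from \<open>W u \<longrightarrow> X\<^sub>0 = 0\<close>.
\<close>

section \<open>Almost sure limits and characteristic functions\<close>

text \<open>Dilative stability compares only cells of equal width in \<open>u\<close>, which is why
  everything happens on one common grid. The Riemann sum for \<open>Y\<close> has exponent exactly
  \<open>\<Psi>\<^sub>n\<close> because the weight \<open>exp (- \<beta> u)\<close>, taken at the
  left end of a cell, cancels the scaling \<open>exp (\<beta> u)\<close> of the argument, and the
  factors in front telescope to \<open>\<tau> 1 - \<tau> 0 = 1\<close>. Logarithms are the main
  obstacle: they need characteristic functions without zeros, and the law of \<open>Y\<close> is not
  known beforehand to be infinitely divisible. The bridge is the inequality
  \<open>|\<phi> t|^5 \<le> |\<phi> (2 t)|\<close>: infinite divisibility of the increments implies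
  it, it survives pointwise limits, and with continuity at 0 it excludes zeros. The other obstacle
  is measurability: paths are regular only almost surely, so limits live on the completion, while
  all exact computations concern finitely many grid values on the original space. Exponents must
  converge locally uniformly because the number of cells grows, while their total \<tau>-length
  stays fixed.\<close>

lemma borel_measurable_completion_AE_LIMSEQ:
  fixes g :: "nat \<Rightarrow> 'a \<Rightarrow> real"
  assumes g [measurable]: "\<And>n. g n \<in> borel_measurable M"
    and lim: "AE \<omega> in M. (\<lambda>n. g n \<omega>) \<longlonglongrightarrow> f \<omega>"
  shows "f \<in> borel_measurable (completion M)"
proof -
  \<comment> \<open>\<open>lim\<close> is measurable everywhere, also where the sequence diverges,
    so \<open>h\<close> is a measurable version of \<open>f\<close>; the two preimages then differ
    only inside a null set.\<close>
  define h where "h \<omega> = lim (\<lambda>n. g n \<omega>)" for \<omega>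
  have h [measurable]: "h \<in> borel_measurable M"
    unfolding h_def by measurable
  have "AE \<omega> in M. f \<omega> = h \<omega>"
    using lim by eventually_elim (simp add: h_def limI)
  then obtain N where N: "N \<in> null_sets M" and sub: "{\<omega>\<in>space M. f \<omega> \<noteq> h \<omega>} \<subseteq> N"
    by (auto elim!: AE_E simp: null_sets_def)
  show ?thesis
  proof (rule measurableI)
    fix A :: "real set" assume A: "A \<in> sets borel"
    have "f -` A \<inter> space (completion M) = (h -` A \<inter> space M - N) \<union> (N \<inter> (f -` A \<inter> space M))"
      using sub by auto
    moreover have "h -` A \<inter> space M - N \<in> sets M"
      using N A by (auto intro!: measurable_sets[OF h])
    ultimately show "f -` A \<inter> space (completion M) \<in> sets (completion M)"
      using N by (auto intro: sets_completionI)
  qed auto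
qed

text \<open>The integrands differ by at most \<open>min 2 (\<bar>R\<bar> * \<bar>g n \<omega> - f
  \<omega>\<bar>)\<close>, a bound free of \<theta>; its mean \<open>d n\<close> tends to 0 by
  dominated convergence, hence the uniformity. The limit integral is over the completion because
  \<open>f\<close> need not be measurable on \<open>M\<close>.\<close>

lemma uniform_limit_char:
  fixes g :: "nat \<Rightarrow> 'a \<Rightarrow> real"
  assumes M: "prob_space M"
    and g [measurable]: "\<And>n. g n \<in> borel_measurable M"
    and lim: "AE \<omega> in M. (\<lambda>n. g n \<omega>) \<longlonglongrightarrow> f \<omega>"
  shows "uniform_limit {-R..R} (\<lambda>n \<theta>. CLINT \<omega>|M. iexp (\<theta> * g n \<omega>))
           (\<lambda>\<theta>. CLINT \<omega>|completion M. iexp (\<theta> * f \<omega>)) sequentially"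
proof -
  interpret prob_space M by fact
  interpret C: prob_space "completion M" by (rule prob_space_completion)
  have f [measurable]: "f \<in> borel_measurable (completion M)"
    using g lim by (rule borel_measurable_completion_AE_LIMSEQ)
  have g' [measurable]: "g n \<in> borel_measurable (completion M)" for n
    using g by (rule measurable_completion)
  define d where "d n = (LINT \<omega>|completion M. min 2 (\<bar>R\<bar> * \<bar>g n \<omega> - f \<omega>\<bar>))" for n
  have "d \<longlonglongrightarrow> (LINT \<omega>|completion M. 0)"
    unfolding d_def
  proof (rule integral_dominated_convergence[where w="\<lambda>_. 2"])
    show "AE \<omega> in completion M. (\<lambda>n. min 2 (\<bar>R\<bar> * \<bar>g n \<omega> - f \<omega>\<bar>)) \<longlonglongrightarrow> 0"
      using AE_completion[OF lim]
    proof eventually_elim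
      case (elim \<omega>)
      then have "(\<lambda>n. min 2 (\<bar>R\<bar> * \<bar>g n \<omega> - f \<omega>\<bar>)) \<longlonglongrightarrow> min 2 (\<bar>R\<bar> * \<bar>f \<omega> - f \<omega>\<bar>)"
        by (intro tendsto_intros)
      then show ?case by simp
    qed
  qed auto
  then have d: "d \<longlonglongrightarrow> 0" by simp
  have le: "dist (CLINT \<omega>|M. iexp (\<theta> * g n \<omega>)) (CLINT \<omega>|completion M. iexp (\<theta> * f \<omega>)) \<le> d n"
    if \<theta>: "\<theta> \<in> {-R..R}" for n \<theta>
  proof -
    have "(CLINT \<omega>|M. iexp (\<theta> * g n \<omega>)) - (CLINT \<omega>|completion M. iexp (\<theta> * f \<omega>))
       = (CLINT \<omega>|completion M. iexp (\<theta> * g n \<omega>) - iexp (\<theta> * f \<omega>))"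
      by (simp add: integral_completion C.integrable_iexp Bochner_Integration.integral_diff)
    also have "cmod \<dots> \<le> (LINT \<omega>|completion M. cmod (iexp (\<theta> * g n \<omega>) - iexp (\<theta> * f \<omega>)))"
      by (rule integral_norm_bound)
    also have "\<dots> \<le> d n"
      unfolding d_def
    proof (rule integral_mono)
      fix \<omega>
      let ?u = "\<theta> * g n \<omega>" and ?v = "\<theta> * f \<omega>"
      have "iexp ?u - iexp ?v = iexp ?v * (iexp (?u - ?v) - 1)"
        by (simp add: algebra_simps exp_diff)
      then have "cmod (iexp ?u - iexp ?v) = cmod (iexp (?u - ?v) - 1)"
        by (simp add: norm_mult)
      moreover have "cmod (iexp (?u - ?v) - 1) \<le> \<bar>?u - ?v\<bar>"
        using iexp_approx1[of "?u - ?v" 0] by simp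
      moreover have "cmod (iexp (?u - ?v) - 1) \<le> 2"
        using norm_triangle_ineq4[of "iexp (?u - ?v)" 1] by simp
      moreover have "\<bar>?u - ?v\<bar> \<le> \<bar>R\<bar> * \<bar>g n \<omega> - f \<omega>\<bar>"
      proof -
        have "\<bar>\<theta>\<bar> \<le> \<bar>R\<bar>" using \<theta> by auto
        then show ?thesis by (simp add: abs_mult mult_right_mono flip: right_diff_distrib)
      qed
      ultimately show "cmod (iexp ?u - iexp ?v) \<le> min 2 (\<bar>R\<bar> * \<bar>g n \<omega> - f \<omega>\<bar>)"
        by simp
    next
      show "integrable (completion M) (\<lambda>\<omega>. min 2 (\<bar>R\<bar> * \<bar>g n \<omega> - f \<omega>\<bar>))"
        by (rule C.integrable_const_bound[where B=2]) auto
    qed (auto intro!: integrable_norm Bochner_Integration.integrable_diff C.integrable_iexp)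
    finally show ?thesis by (simp add: dist_norm)
  qed
  show ?thesis
  proof (rule uniform_limitI)
    fix e :: real assume "e > 0"
    with d have "eventually (\<lambda>n. d n < e) sequentially"
      by (simp add: order_tendstoD)
    then show "\<forall>\<^sub>F n in sequentially. \<forall>\<theta>\<in>{-R..R}.
        dist (CLINT \<omega>|M. iexp (\<theta> * g n \<omega>)) (CLINT \<omega>|completion M. iexp (\<theta> * f \<omega>)) < e"
    proof eventually_elim
      case (elim n)
      show ?case by (intro ballI le_less_trans[OF le elim])
    qed
  qed
qed

lemma tendsto_iexp_integral:
  fixes g :: "nat \<Rightarrow> 'a \<Rightarrow> real"
  assumes "prob_space M" "\<And>n. g n \<in> borel_measurable M"
    and "AE \<omega> in M. (\<lambda>n. g n \<omega>) \<longlonglongrightarrow> f \<omega>"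
  shows "(\<lambda>n. CLINT \<omega>|M. iexp (g n \<omega>)) \<longlonglongrightarrow> (CLINT \<omega>|completion M. iexp (f \<omega>))"
  using tendsto_uniform_limitI[OF uniform_limit_char[OF assms, of 1], of 1] by simp

section \<open>Uniqueness of multivariate characteristic functions\<close>

lemma integral_distr_density:
  fixes h :: "real \<Rightarrow> 'b::{banach, second_countable_topology}"
  assumes [measurable]: "U \<in> borel_measurable M" "f \<in> borel_measurable M" "h \<in> borel_measurable borel"
    and "\<And>x. 0 \<le> f x"
  shows "(LINT y|distr (density M (\<lambda>x. ennreal (f x))) borel U. h y) = (LINT x|M. f x *\<^sub>R h (U x))"
  using assms by (subst integral_distr, simp, simp) (subst integral_density, auto)

text \<open>A signed weight gives no probability law, but \<open>2 + v\<close> lies between 1 and 3,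
  so after division by its mean \<open>m\<close> it is a density. One-dimensional Levy uniqueness
  identifies the two weighted laws, and the contribution of the constant 2, known from
  \<open>eq1\<close>, is subtracted.\<close>

lemma integral_indicator_eqI_iexp:
  fixes U :: "'a \<Rightarrow> real" and V :: "'b \<Rightarrow> real" and v :: "'a \<Rightarrow> real" and w :: "'b \<Rightarrow> real"
  assumes M: "prob_space M" and N: "prob_space N"
    and [measurable]: "U \<in> borel_measurable M" "V \<in> borel_measurable N"
      "v \<in> borel_measurable M" "w \<in> borel_measurable N"
    and v: "\<And>x. \<bar>v x\<bar> \<le> 1" and w: "\<And>x. \<bar>w x\<bar> \<le> 1"
    and eq1: "\<And>\<theta>. (CLINT x|M. iexp (\<theta> * U x)) = (CLINT x|N. iexp (\<theta> * V x))"
    and eq2: "\<And>\<theta>. (CLINT x|M. v x * iexp (\<theta> * U x)) = (CLINT x|N. w x * iexp (\<theta> * V x))"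
    and B [measurable]: "B \<in> sets borel"
  shows "(LINT x|M. v x * indicator B (U x)) = (LINT x|N. w x * indicator B (V x))"
proof -
  interpret M: prob_space M by fact
  interpret N: prob_space N by fact
  have bnd: "0 \<le> 2 + v x" "\<bar>2 + v x\<bar> \<le> 3" "0 \<le> 2 + w y" "\<bar>2 + w y\<bar> \<le> 3" for x y
    using v[of x] w[of y] by auto
  have iM: "integrable M (\<lambda>x. v x)" "integrable N (\<lambda>x. w x)"
    using v w by (auto intro!: M.integrable_const_bound[where B=1] N.integrable_const_bound[where B=1])
  have iE: "integrable M (\<lambda>x. v x * iexp (\<theta> * U x))" "integrable N (\<lambda>x. w x * iexp (\<theta> * V x))" for \<theta>
    using v w by (auto intro!: M.integrable_const_bound[where B=1] N.integrable_const_bound[where B=1]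
        simp: norm_mult)
  define m where "m = 2 + (LINT x|M. v x)"
  \<comment> \<open>At \<theta> = 0 the hypothesis \<open>eq2\<close> compares the means of
    \<open>v\<close> and \<open>w\<close>, so both densities have the same normalising
    constant.\<close>
  have "complex_of_real (LINT x|M. v x) = of_real (LINT x|N. w x)"
    using eq2[of 0] by simp
  then have m': "m = 2 + (LINT x|N. w x)" by (simp add: m_def)
  have "(LINT x|M. -1) \<le> (LINT x|M. v x)"
    using iM v by (intro integral_mono) (auto simp: abs_le_iff minus_le_iff)
  then have m: "m > 0" by (simp add: m_def M.prob_space)
  have nn: "0 \<le> (2 + v x) / m" "0 \<le> (2 + w y) / m" for x y
    using bnd m by simp_all
  define P where "P = distr (density M (\<lambda>x. ennreal ((2 + v x) / m))) borel U"
  define Q where "Q = distr (density N (\<lambda>x. ennreal ((2 + w x) / m))) borel V"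
  have "emeasure (density M (\<lambda>x. ennreal ((2 + v x) / m))) (space M) = 1"
    using bnd m iM M.prob_space
    by (subst emeasure_density) (auto simp: nn_integral_eq_integral m_def cong: nn_integral_cong)
  then have P: "real_distribution P"
    unfolding P_def by (intro prob_space.real_distribution_distr prob_spaceI) auto
  have "emeasure (density N (\<lambda>x. ennreal ((2 + w x) / m))) (space N) = 1"
    using bnd m iM N.prob_space
    by (subst emeasure_density) (auto simp: nn_integral_eq_integral m' cong: nn_integral_cong)
  then have Q: "real_distribution Q"
    unfolding Q_def by (intro prob_space.real_distribution_distr prob_spaceI) auto
  have "char P \<theta> = char Q \<theta>" for \<theta>
  proof -
    have "char P \<theta> = (CLINT x|M. (2 * iexp (\<theta> * U x) + v x * iexp (\<theta> * U x)) / m)"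
      unfolding P_def char_def
      by (subst integral_distr_density[OF _ _ _ nn(1)]) (auto simp: scaleR_conv_of_real algebra_simps add_divide_distrib)
    also have "\<dots> = (2 * (CLINT x|M. iexp (\<theta> * U x)) + (CLINT x|M. v x * iexp (\<theta> * U x))) / m"
      using iE M.integrable_iexp[of "\<lambda>x. complex_of_real (\<theta> * U x)"] by simp
    also have "\<dots> = (CLINT x|N. (2 * iexp (\<theta> * V x) + w x * iexp (\<theta> * V x)) / m)"
      using iE N.integrable_iexp[of "\<lambda>x. complex_of_real (\<theta> * V x)"] eq1 eq2 by simp
    also have "\<dots> = char Q \<theta>"
      unfolding Q_def char_def
      by (subst integral_distr_density[OF _ _ _ nn(2)]) (auto simp: scaleR_conv_of_real algebra_simps add_divide_distrib)
    finally show ?thesis .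
  qed
  then have PQ: "P = Q"
    using P Q by (intro Levy_uniqueness) auto
  have "distr M borel U = distr N borel V"
    using eq1 by (intro Levy_uniqueness M.real_distribution_distr N.real_distribution_distr)
      (auto simp: char_def integral_distr)
  then have UV: "(LINT x|M. indicator B (U x)) = (LINT x|N. indicator B (V x) :: real)"
    using integral_distr[of U M borel "indicator B :: real \<Rightarrow> real"]
      integral_distr[of V N borel "indicator B :: real \<Rightarrow> real"] by simp
  have iB: "integrable M (\<lambda>x. v x * indicator B (U x))" "integrable N (\<lambda>x. w x * indicator B (V x))"
    "integrable M (\<lambda>x. indicator B (U x) :: real)" "integrable N (\<lambda>x. indicator B (V x) :: real)"
    using v w by (auto intro!: M.integrable_const_bound[where B=1] N.integrable_const_bound[where B=1]
        simp: indicator_def)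
  have "(LINT x|P. indicator B x :: real)
      = (LINT x|M. (2 * indicator B (U x) + v x * indicator B (U x)) / m)"
    unfolding P_def
    by (subst integral_distr_density[OF _ _ _ nn(1)]) (auto simp: algebra_simps add_divide_distrib)
  moreover have "(LINT x|Q. indicator B x :: real)
      = (LINT x|N. (2 * indicator B (V x) + w x * indicator B (V x)) / m)"
    unfolding Q_def
    by (subst integral_distr_density[OF _ _ _ nn(2)]) (auto simp: algebra_simps add_divide_distrib)
  ultimately show ?thesis
    using PQ iB UV m by simp
qed

text \<open>\<open>Re v\<close> and \<open>Im v\<close> are combinations of \<open>v\<close> and its
  conjugate, so \<open>eq2\<close> and \<open>eq3\<close> together supply the hypothesis of the
  real-valued version for each part.\<close>

lemma integral_indicator_eqI_iexp_complex:
  fixes U :: "'a \<Rightarrow> real" and V :: "'b \<Rightarrow> real" and v :: "'a \<Rightarrow> complex" and w :: "'b \<Rightarrow> complex"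
  assumes M: "prob_space M" and N: "prob_space N"
    and [measurable]: "U \<in> borel_measurable M" "V \<in> borel_measurable N"
      "v \<in> borel_measurable M" "w \<in> borel_measurable N"
    and v: "\<And>x. cmod (v x) \<le> 1" and w: "\<And>x. cmod (w x) \<le> 1"
    and eq1: "\<And>\<theta>. (CLINT x|M. iexp (\<theta> * U x)) = (CLINT x|N. iexp (\<theta> * V x))"
    and eq2: "\<And>\<theta>. (CLINT x|M. v x * iexp (\<theta> * U x)) = (CLINT x|N. w x * iexp (\<theta> * V x))"
    and eq3: "\<And>\<theta>. (CLINT x|M. cnj (v x) * iexp (\<theta> * U x)) = (CLINT x|N. cnj (w x) * iexp (\<theta> * V x))"
    and B [measurable]: "B \<in> sets borel"
  shows "(CLINT x|M. v x * indicator B (U x)) = (CLINT x|N. w x * indicator B (V x))"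
proof -
  interpret M: prob_space M by fact
  interpret N: prob_space N by fact
  have [measurable]: "cnj \<in> borel_measurable borel"
    by (intro borel_measurable_continuous_onI continuous_intros)
  have iE: "integrable M (\<lambda>x. v x * iexp (\<theta> * U x))" "integrable N (\<lambda>x. w x * iexp (\<theta> * V x))"
    "integrable M (\<lambda>x. cnj (v x) * iexp (\<theta> * U x))" "integrable N (\<lambda>x. cnj (w x) * iexp (\<theta> * V x))" for \<theta>
    using v w by (auto intro!: M.integrable_const_bound[where B=1] N.integrable_const_bound[where B=1]
        simp: norm_mult)
  have Re: "complex_of_real (Re z) = (z + cnj z) / 2" and Im: "complex_of_real (Im z) = (- \<i> / 2) * (z - cnj z)" for z
    by (auto simp: complex_eq_iff Re_divide Im_divide power2_eq_square)
  have 1: "(LINT x|M. Re (v x) * indicator B (U x)) = (LINT x|N. Re (w x) * indicator B (V x))"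
  proof (rule integral_indicator_eqI_iexp[OF M N])
    show "\<bar>Re (v x)\<bar> \<le> 1" "\<bar>Re (w y)\<bar> \<le> 1" for x y
      using v[of x] w[of y] abs_Re_le_cmod order_trans by blast+
    have "(CLINT x|M. Re (v x) * iexp (\<theta> * U x))
      = ((CLINT x|M. v x * iexp (\<theta> * U x)) + (CLINT x|M. cnj (v x) * iexp (\<theta> * U x))) / 2" for \<theta>
      using iE by (simp add: Re algebra_simps add_divide_distrib)
    moreover have "(CLINT x|N. Re (w x) * iexp (\<theta> * V x))
      = ((CLINT x|N. w x * iexp (\<theta> * V x)) + (CLINT x|N. cnj (w x) * iexp (\<theta> * V x))) / 2" for \<theta>
      using iE by (simp add: Re algebra_simps add_divide_distrib)
    ultimately show "(CLINT x|M. Re (v x) * iexp (\<theta> * U x)) = (CLINT x|N. Re (w x) * iexp (\<theta> * V x))" for \<theta>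
      by (simp only: eq2 eq3)
  qed (use eq1 in auto)
  have Im_mult: "complex_of_real (Im z) * e = (- \<i> / 2) * (z * e - cnj z * e)" for z e
    unfolding Im by (simp only: mult.assoc left_diff_distrib)
  have 2: "(LINT x|M. Im (v x) * indicator B (U x)) = (LINT x|N. Im (w x) * indicator B (V x))"
  proof (rule integral_indicator_eqI_iexp[OF M N])
    show "\<bar>Im (v x)\<bar> \<le> 1" "\<bar>Im (w y)\<bar> \<le> 1" for x y
      using v[of x] w[of y] abs_Im_le_cmod order_trans by blast+
    have "(CLINT x|M. Im (v x) * iexp (\<theta> * U x))
      = (- \<i> / 2) * ((CLINT x|M. v x * iexp (\<theta> * U x)) - (CLINT x|M. cnj (v x) * iexp (\<theta> * U x)))" for \<theta>
      unfolding Im_mult integral_mult_right_zero using iE by simp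
    moreover have "(CLINT x|N. Im (w x) * iexp (\<theta> * V x))
      = (- \<i> / 2) * ((CLINT x|N. w x * iexp (\<theta> * V x)) - (CLINT x|N. cnj (w x) * iexp (\<theta> * V x)))" for \<theta>
      unfolding Im_mult integral_mult_right_zero using iE by simp
    ultimately show "(CLINT x|M. Im (v x) * iexp (\<theta> * U x)) = (CLINT x|N. Im (w x) * iexp (\<theta> * V x))" for \<theta>
      by (simp only: eq2 eq3)
  qed (use eq1 in auto)
  have iB: "integrable M (\<lambda>x. v x * indicator B (U x))" "integrable N (\<lambda>x. w x * indicator B (V x))"
    using v w by (auto intro!: M.integrable_const_bound[where B=1] N.integrable_const_bound[where B=1]
        simp: norm_mult indicator_def)
  have ind: "Re (z * indicator B x) = Re z * indicator B x" "Im (z * indicator B x) = Im z * indicator B x" for z x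
    by (auto simp: indicator_def)
  show ?thesis
  proof (rule complex_eqI)
    show "Re (CLINT x|M. v x * indicator B (U x)) = Re (CLINT x|N. w x * indicator B (V x))"
      unfolding integral_Re[OF iB(1), symmetric] integral_Re[OF iB(2), symmetric] ind by (rule 1)
    show "Im (CLINT x|M. v x * indicator B (U x)) = Im (CLINT x|N. w x * indicator B (V x))"
      unfolding integral_Im[OF iB(1), symmetric] integral_Im[OF iB(2), symmetric] ind by (rule 2)
  qed
qed

text \<open>The exponential factors are replaced by indicator functions one coordinate at a time.\<close>

theorem measure_eqI_borel_Rvec_iexp:
  assumes M: "prob_space \<mu>" and N: "prob_space \<nu>"
    and sets: "sets \<mu> = sets (borel_Rvec k)" "sets \<nu> = sets (borel_Rvec k)"
    and eq: "\<And>\<theta>. (CLINT x|\<mu>. iexp (\<Sum>j<k. \<theta> j * x j)) = (CLINT x|\<nu>. iexp (\<Sum>j<k. \<theta> j * x j))"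
  shows "\<mu> = \<nu>"
proof -
  interpret M: prob_space \<mu> by fact
  interpret N: prob_space \<nu> by fact
  note [measurable_cong] = sets
  \<comment> \<open>Invariant: the first \<open>m\<close> coordinates already carry indicators, the
    others still carry exponentials. \<open>m = 0\<close> is the hypothesis, \<open>m = k\<close>
    compares the measures of boxes.\<close>
  have claim: "(CLINT x|\<mu>. (\<Prod>j<m. indicator (B j) (x j)) * iexp (\<Sum>j=m..<k. \<theta> j * x j))
     = (CLINT x|\<nu>. (\<Prod>j<m. indicator (B j) (x j)) * iexp (\<Sum>j=m..<k. \<theta> j * x j))"
    if "m \<le> k" "\<And>j. B j \<in> sets borel" for m B \<theta>
    using that
  proof (induction m arbitrary: B \<theta>)
    case 0
    then show ?case using eq[of \<theta>] by (simp add: atLeast0LessThan)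
  next
    case (Suc m)
    note [measurable] = Suc.prems(2)
    have mk: "m < k" using Suc.prems by simp
    define c :: "(nat \<Rightarrow> real) \<Rightarrow> (nat \<Rightarrow> real) \<Rightarrow> complex" where
      "c \<theta> x = (\<Prod>j<m. indicator (B j) (x j)) * iexp (\<Sum>j=Suc m..<k. \<theta> j * x j)" for \<theta> x
    have split: "(\<Sum>j=m..<k. (\<theta>(m := t)) j * x j) = t * x m + (\<Sum>j=Suc m..<k. \<theta> j * x j)" for \<theta> t and x :: "nat \<Rightarrow> real"
      using mk by (simp add: sum.atLeast_Suc_lessThan)
    have cm: "c \<theta> \<in> borel_measurable (borel_Rvec k)" for \<theta>
    proof -
      have comp: "(\<lambda>x. x j) \<in> borel_measurable (borel_Rvec k)" if "j < k" for j
        using that by (intro measurable_component_singleton) simp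
      have "(\<lambda>x. \<Prod>j<m. indicator (B j) (x j) :: complex) \<in> borel_measurable (borel_Rvec k)"
        using mk by (intro borel_measurable_prod measurable_compose[OF comp]) auto
      moreover have "(\<lambda>x. \<Sum>j=Suc m..<k. \<theta> j * x j) \<in> borel_measurable (borel_Rvec k)"
        by (intro borel_measurable_sum borel_measurable_times comp) auto
      ultimately show ?thesis
        unfolding c_def by measurable
    qed
    have c1: "cmod (c \<theta> x) \<le> 1" for \<theta> x
    proof -
      have "(\<Prod>j<m. cmod (indicator (B j) (x j))) \<le> 1"
        by (intro prod_le_1) (auto simp: indicator_def)
      then show ?thesis by (simp add: c_def norm_mult prod_norm)
    qed
    \<comment> \<open>The exponential in coordinate \<open>m\<close> is absorbed by setting \<theta>
      at \<open>m\<close> to \<open>t\<close>; the induction hypothesis holds for all \<theta>,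
      hence for all \<open>t\<close>.\<close>
    have ceq: "(CLINT x|\<mu>. c \<theta> x * iexp (t * x m)) = (CLINT x|\<nu>. c \<theta> x * iexp (t * x m))" for \<theta> t
    proof -
      have "c \<theta> x * iexp (t * x m) = (\<Prod>j<m. indicator (B j) (x j)) * iexp (\<Sum>j=m..<k. (\<theta>(m := t)) j * x j)" for x
        unfolding split c_def by (simp add: exp_add algebra_simps)
      then show ?thesis
        using Suc.IH[of B "\<theta>(m := t)"] Suc.prems by simp
    qed
    \<comment> \<open>Conjugation only negates \<theta>, as the indicators are real, so the
      conjugate condition is \<open>ceq\<close> again.\<close>
    have cnj: "cnj (c \<theta> x) = c (\<lambda>j. - \<theta> j) x" for x
      by (auto simp: c_def exp_cnj indicator_def sum_negf intro!: prod.cong)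
    have xm: "(\<lambda>x. x m) \<in> borel_measurable (borel_Rvec k)"
      using mk by (intro measurable_component_singleton) simp
    have "(CLINT x|\<mu>. c \<theta> x * indicator (B m) (x m)) = (CLINT x|\<nu>. c \<theta> x * indicator (B m) (x m))"
    proof (rule integral_indicator_eqI_iexp_complex[OF M N])
      show "(\<lambda>x. x m) \<in> borel_measurable \<mu>" "(\<lambda>x. x m) \<in> borel_measurable \<nu>"
        using xm by measurable
      show "c \<theta> \<in> borel_measurable \<mu>" "c \<theta> \<in> borel_measurable \<nu>"
        using cm[of \<theta>] by measurable
      show "(CLINT x|\<mu>. iexp (t * x m)) = (CLINT x|\<nu>. iexp (t * x m))" for t
        using Suc.IH[of "\<lambda>_. UNIV" "(\<lambda>_. 0)(m := t)", unfolded split] Suc.prems by simp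
      show "(CLINT x|\<mu>. cnj (c \<theta> x) * iexp (t * x m)) = (CLINT x|\<nu>. cnj (c \<theta> x) * iexp (t * x m))" for t
        unfolding cnj by (rule ceq)
    qed (use ceq c1 in auto)
    moreover have "c \<theta> x * indicator (B m) (x m)
        = (\<Prod>j<Suc m. indicator (B j) (x j)) * iexp (\<Sum>j=Suc m..<k. \<theta> j * x j)" for x
      by (simp add: c_def algebra_simps)
    ultimately show ?case by simp
  qed
  show ?thesis
  proof (rule measure_eqI_PiM_finite[where I="{..<k}" and M="\<lambda>_. borel"])
    fix A :: "nat \<Rightarrow> real set" assume A: "\<And>i. i \<in> {..<k} \<Longrightarrow> A i \<in> sets borel"
    define B where "B j = (if j < k then A j else UNIV)" for j
    have B [measurable]: "B j \<in> sets borel" for j using A by (auto simp: B_def)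
    have box [measurable]: "Pi\<^sub>E {..<k} A \<in> sets (borel_Rvec k)"
      using A by (intro sets_PiM_I_finite) auto
    have ind: "(\<Prod>j<k. indicator (B j) (x j)) = complex_of_real (indicator (Pi\<^sub>E {..<k} A) x)"
      if x: "x \<in> space (borel_Rvec k)" for x
    proof (cases "x \<in> Pi\<^sub>E {..<k} A")
      case False
      then obtain j where "j < k" "x j \<notin> A j"
        using x False by (auto simp: space_PiM PiE_iff)
      then show ?thesis using False by (auto simp: B_def intro!: prod_zero bexI[of _ j])
    qed (auto simp: B_def PiE_iff intro!: prod.neutral)
    have sp: "space \<mu> = space (borel_Rvec k)" "space \<nu> = space (borel_Rvec k)"
      using sets by (auto dest: sets_eq_imp_space_eq)
    have "(CLINT x|\<mu>. complex_of_real (indicator (Pi\<^sub>E {..<k} A) x))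
        = (CLINT x|\<mu>. (\<Prod>j<k. indicator (B j) (x j)) * iexp (\<Sum>j=k..<k. 0 * x j))"
      by (intro Bochner_Integration.integral_cong) (auto simp: ind sp)
    also have "\<dots> = (CLINT x|\<nu>. (\<Prod>j<k. indicator (B j) (x j)) * iexp (\<Sum>j=k..<k. 0 * x j))"
      using claim[of k B "\<lambda>_. 0"] by simp
    also have "\<dots> = (CLINT x|\<nu>. complex_of_real (indicator (Pi\<^sub>E {..<k} A) x))"
      by (intro Bochner_Integration.integral_cong) (auto simp: ind sp)
    finally have "(LINT x|\<mu>. indicator (Pi\<^sub>E {..<k} A) x :: real) = (LINT x|\<nu>. indicator (Pi\<^sub>E {..<k} A) x)"
      by (simp only: integral_complex_of_real of_real_eq_iff)
    then have "measure \<mu> (Pi\<^sub>E {..<k} A) = measure \<nu> (Pi\<^sub>E {..<k} A)"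
      using box sets by simp
    then show "emeasure \<mu> (Pi\<^sub>E {..<k} A) = emeasure \<nu> (Pi\<^sub>E {..<k} A)"
      by (simp add: M.emeasure_eq_measure N.emeasure_eq_measure)
  next
    show "range (\<lambda>_::nat. space (borel_Rvec k)) \<subseteq> prod_algebra {..<k} (\<lambda>_. borel)"
      by (auto simp: space_PiM intro!: prod_algebraI_finite)
  qed (use sets in auto)
qed

section \<open>Continuous logarithms and infinite divisibility\<close>

text \<open>Two continuous logarithms differ by a continuous function with values in the multiples
  of \<open>2 * pi * \<i>\<close>. Distinct multiples are at distance at least 1, so the difference
  is constant on a connected set and vanishes with its value at \<open>a\<close>.\<close>

lemma continuous_log_unique:
  fixes f g :: "'a::topological_space \<Rightarrow> complex"
  assumes S: "connected S" and f: "continuous_on S f" and g: "continuous_on S g"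
    and a: "a \<in> S" "f a = g a" and e: "\<And>x. x \<in> S \<Longrightarrow> exp (f x) = exp (g x)" and x: "x \<in> S"
  shows "f x = g x"
proof -
  have int: "\<exists>n::int. f x - g x = of_int (2 * n) * pi * \<i>" if "x \<in> S" for x
    using e[OF that] by (auto simp: exp_eq)
  have "(\<lambda>x. f x - g x) constant_on S"
  proof (rule continuous_discrete_range_constant[OF S])
    show "continuous_on S (\<lambda>x. f x - g x)"
      using f g by (intro continuous_intros)
  next
    fix x assume x: "x \<in> S"
    have "1 \<le> norm ((f y - g y) - (f x - g x))" if y: "y \<in> S" "f y - g y \<noteq> f x - g x" for y
    proof -
      obtain m n :: int where "f x - g x = of_int (2 * m) * pi * \<i>" "f y - g y = of_int (2 * n) * pi * \<i>"
        using int x y by metis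
      moreover from this have "n \<noteq> m" using y by auto
      then have "1 \<le> \<bar>real_of_int (n - m)\<bar>" by linarith
      then have "1 * 1 \<le> \<bar>real_of_int (n - m)\<bar> * (2 * pi)"
        using pi_gt3 by (intro mult_mono) auto
      moreover have "of_int (2 * n) * pi * \<i> - of_int (2 * m) * pi * \<i>
          = of_real (real_of_int (n - m) * (2 * pi)) * \<i>"
        by (simp add: algebra_simps)
      ultimately show ?thesis
        by (simp add: norm_mult abs_mult del: of_real_mult)
    qed
    then show "\<exists>e>0. \<forall>y. y \<in> S \<and> f y - g y \<noteq> f x - g x \<longrightarrow> e \<le> norm ((f y - g y) - (f x - g x))"
      by (intro exI[of _ 1]) auto
  qed
  then have "f x - g x = f a - g a"
    using a(1) x unfolding constant_on_def by metis
  then show ?thesis using a by simp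
qed

lemma continuous_log_exists:
  fixes f :: "'a::real_normed_vector \<Rightarrow> complex"
  assumes "continuous_on UNIV f" "\<And>x. f x \<noteq> 0" "f 0 = 1"
  obtains g where "continuous_on UNIV g" "g 0 = 0" "\<And>x. f x = exp (g x)"
proof -
  obtain h where h: "continuous_on UNIV h" "\<And>x. f x = exp (h x)"
    using continuous_logarithm_on_contractible[of UNIV f] assms by auto
  have "exp (h 0) = 1" using h(2)[of 0] assms by simp
  then show ?thesis
    using h by (intro that[of "\<lambda>x. h x - h 0"]) (auto intro!: continuous_intros simp: exp_diff)
qed

text \<open>On the compact interval \<open>exp (f \<theta>)\<close> stays away from 0, so
  \<open>exp (F n \<theta> - f \<theta>)\<close> is uniformly close to 1, where \<open>Ln\<close> is
  continuous and close to 0. Uniqueness of continuous logarithms, anchored at \<theta> = 0,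
  identifies \<open>F n - f\<close> with this \<open>Ln\<close>.\<close>

lemma uniform_limit_log:
  fixes F :: "nat \<Rightarrow> real \<Rightarrow> complex" and f :: "real \<Rightarrow> complex"
  assumes F: "\<And>n. continuous_on UNIV (F n)" "\<And>n. F n 0 = 0"
    and f: "continuous_on UNIV f" "f 0 = 0"
    and R: "0 \<le> R"
    and lim: "uniform_limit {-R..R} (\<lambda>n \<theta>. exp (F n \<theta>)) (\<lambda>\<theta>. exp (f \<theta>)) sequentially"
  shows "uniform_limit {-R..R} F f sequentially"
proof (rule uniform_limitI)
  fix e :: real assume e: "e > 0"
  have "continuous_on {-R..R} (\<lambda>\<theta>. cmod (exp (f \<theta>)))"
    using f by (intro continuous_intros) (auto intro: continuous_on_subset)
  then obtain x where x: "x \<in> {-R..R}" "\<And>y. y \<in> {-R..R} \<Longrightarrow> cmod (exp (f x)) \<le> cmod (exp (f y))"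
    using R continuous_attains_inf[of "{-R..R}" "\<lambda>\<theta>. cmod (exp (f \<theta>))"] by auto
  define c where "c = cmod (exp (f x))"
  have c: "c > 0" by (simp add: c_def)
  \<comment> \<open>\<open>d \<le> 1 / 2\<close> is for the estimate
    \<open>cmod (Ln (1 + z)) \<le> 2 * cmod z\<close> and keeps \<open>1 + q \<theta>\<close> off
    the branch cut; \<open>2 * d \<le> e\<close> is for the conclusion.\<close>
  define d where "d = min (1 / 2) (e / 2)"
  have d: "d > 0" "d \<le> 1 / 2" "2 * d \<le> e" using e by (auto simp: d_def min_def)
  have "\<forall>\<^sub>F n in sequentially. \<forall>\<theta>\<in>{-R..R}. dist (exp (F n \<theta>)) (exp (f \<theta>)) < c * d"
    using lim c d by (intro uniform_limitD) auto
  then show "\<forall>\<^sub>F n in sequentially. \<forall>\<theta>\<in>{-R..R}. dist (F n \<theta>) (f \<theta>) < e"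
  proof eventually_elim
    case (elim n)
    define q where "q \<theta> = exp (F n \<theta> - f \<theta>) - 1" for \<theta>
    have q: "cmod (q \<theta>) < d" if \<theta>: "\<theta> \<in> {-R..R}" for \<theta>
    proof -
      have "exp (F n \<theta>) - exp (f \<theta>) = exp (f \<theta>) * q \<theta>"
        by (simp add: q_def algebra_simps exp_diff)
      then have "cmod (exp (f \<theta>)) * cmod (q \<theta>) < c * d"
        using bspec[OF elim \<theta>] by (simp only: dist_norm norm_mult)
      moreover have "c * cmod (q \<theta>) \<le> cmod (exp (f \<theta>)) * cmod (q \<theta>)"
        using x(2)[OF \<theta>] by (intro mult_right_mono) (auto simp: c_def)
      ultimately show ?thesis using c by (smt (verit) mult_less_cancel_left_pos)
    qed
    have cont: "continuous_on {-R..R} (\<lambda>\<theta>. F n \<theta> - f \<theta>)"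
      using f F by (intro continuous_intros) (auto intro: continuous_on_subset)
    have nonpos: "1 + q \<theta> \<notin> \<real>\<^sub>\<le>\<^sub>0" if "\<theta> \<in> {-R..R}" for \<theta>
    proof
      assume "1 + q \<theta> \<in> \<real>\<^sub>\<le>\<^sub>0"
      then have "Re (q \<theta>) \<le> -1" by (auto simp: complex_nonpos_Reals_iff)
      then show False using q[OF that] d abs_Re_le_cmod[of "q \<theta>"] by linarith
    qed
    have qc: "continuous_on {-R..R} q"
      unfolding q_def by (intro continuous_intros cont)
    show ?case
    proof
      fix \<theta> assume \<theta>: "\<theta> \<in> {-R..R}"
      have "F n \<theta> - f \<theta> = Ln (1 + q \<theta>)"
      proof (rule continuous_log_unique[of "{-R..R}" _ "\<lambda>\<theta>. Ln (1 + q \<theta>)" 0])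
        show "continuous_on {-R..R} (\<lambda>\<theta>. Ln (1 + q \<theta>))"
          by (rule continuous_on_Ln') (use nonpos qc in \<open>auto intro!: continuous_intros\<close>)
        show "exp (F n x - f x) = exp (Ln (1 + q x))" if "x \<in> {-R..R}" for x
          by (simp add: q_def)
      qed (use cont R \<theta> F f in \<open>auto simp: q_def\<close>)
      moreover have "cmod (Ln (1 + q \<theta>)) \<le> 2 * cmod (q \<theta>)"
        using q[OF \<theta>] d by (intro norm_Ln_le) auto
      ultimately show "dist (F n \<theta>) (f \<theta>) < e"
        using q[OF \<theta>] d by (auto simp: dist_norm)
    qed
  qed
qed

section \<open>Zeros of characteristic functions under infinite divisibility\<close>

lemma (in real_distribution) char_double:
  "1 - cmod (char M (2 * t)) \<le> 4 * (1 - cmod (char M t))"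
proof -
  \<comment> \<open>Rotating by the argument \<open>a\<close> turns the modulus of
    \<open>char M t\<close> into the mean of \<open>cos (t * x - a)\<close>; the modulus at
    \<open>2 * t\<close> is at least the mean of \<open>cos (2 * t * x - 2 * a)\<close>.\<close>
  define a where "a = Arg (char M t)"
  have pol: "char M t = cmod (char M t) * iexp a"
    using rcis_cmod_Arg[of "char M t"] by (simp add: a_def rcis_def cis_conv_exp)
  have int: "integrable M (\<lambda>x. iexp (s * x - b))" for s b
    by (auto intro!: integrable_const_bound[where B=1])
  have cosI: "integrable M (\<lambda>x. cos (s * x - b))" for s b
    by (auto intro!: integrable_const_bound[where B=1])
  have sh: "(LINT x|M. cos (s * x - b)) = Re (char M s * iexp (- b))" for s b
  proof -
    have "char M s * iexp (- b) = (CLINT x|M. iexp (s * x - b))"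
      unfolding char_def integral_mult_left_zero[symmetric]
      by (simp add: exp_add[symmetric] algebra_simps)
    then have "Re (char M s * iexp (- b)) = (LINT x|M. Re (iexp (s * x - b)))"
      using int by (simp add: integral_Re)
    then show ?thesis by (simp add: Re_exp)
  qed
  have "char M t * iexp (- a) = cmod (char M t) * (iexp a * iexp (- a))"
    using arg_cong[OF pol, of "\<lambda>z. z * iexp (- a)"] by (simp only: mult.assoc)
  also have "iexp a * iexp (- a) = 1"
    by (simp add: exp_add[symmetric])
  finally have "char M t * iexp (- a) = cmod (char M t)"
    by simp
  then have 1: "(LINT x|M. cos (t * x - a)) = cmod (char M t)"
    using sh[of t a] by simp
  have "Re (char M (2 * t) * iexp (- (2 * a))) \<le> cmod (char M (2 * t))"
    using complex_Re_le_cmod[of "char M (2 * t) * iexp (- (2 * a))"] by (simp add: norm_mult)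
  then have 2: "(LINT x|M. cos (2 * t * x - 2 * a)) \<le> cmod (char M (2 * t))"
    using sh[of "2 * t" "2 * a"] by simp
  \<comment> \<open>Pointwise, with \<open>c\<close> the cosine, this is
    \<open>2 * (1 - c\<^sup>2) \<le> 4 * (1 - c)\<close>, that is
    \<open>0 \<le> 2 * (1 - c)\<^sup>2\<close>.\<close>
  have "(LINT x|M. 1 - cos (2 * t * x - 2 * a)) \<le> (LINT x|M. 4 * (1 - cos (t * x - a)))"
  proof (rule integral_mono)
    fix x
    have "cos (2 * t * x - 2 * a) = 2 * (cos (t * x - a))\<^sup>2 - 1"
      using cos_double_cos[of "t * x - a"] by (simp add: algebra_simps)
    moreover have "0 \<le> (1 - cos (t * x - a))\<^sup>2" by simp
    ultimately show "1 - cos (2 * t * x - 2 * a) \<le> 4 * (1 - cos (t * x - a))"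
      by (simp add: power2_eq_square algebra_simps)
  qed (auto intro!: Bochner_Integration.integrable_diff cosI)
  then show ?thesis
    using 1 2 cosI prob_space by simp
qed

text \<open>Any exponent larger than 4 would do: \<open>1 - 4 y \<ge> (1 - y)\<^sup>5\<close> for small \<open>y \<ge> 0\<close>.\<close>

lemma char_roots_double:
  fixes \<phi> :: "real \<Rightarrow> complex"
  assumes "\<And>n. n \<ge> 1 \<Longrightarrow> \<exists>\<nu>. real_distribution \<nu> \<and> (\<forall>\<theta>. \<phi> \<theta> = char \<nu> \<theta> ^ n)"
  shows "cmod (\<phi> t) ^ 5 \<le> cmod (\<phi> (2 * t))"
proof (cases "\<phi> t = 0")
  case False
  \<comment> \<open>The doubling inequality says nothing when the modulus at \<open>t\<close> is
    small. Passing to an \<open>n\<close>-th root moves the modulus close to 1, where the inequality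
    takes a multiplicative form, and the \<open>n\<close>-th power transfers that form back.\<close>
  then have "(\<lambda>n. root n (cmod (\<phi> t))) \<longlonglongrightarrow> 1"
    by (intro LIMSEQ_root_const) auto
  then have "\<forall>\<^sub>F n in sequentially. root n (cmod (\<phi> t)) > 9 / 10 \<and> n \<ge> 1"
    by (intro eventually_conj order_tendstoD eventually_ge_at_top) auto
  then obtain n where n: "root n (cmod (\<phi> t)) > 9 / 10" "n \<ge> 1"
    using eventually_happens[of _ sequentially] by auto
  obtain \<nu> where \<nu>: "real_distribution \<nu>" "\<And>\<theta>. \<phi> \<theta> = char \<nu> \<theta> ^ n"
    using assms n by blast
  interpret \<nu>: real_distribution \<nu> by fact
  define y where "y = 1 - cmod (char \<nu> t)"
  have "root n (cmod (\<phi> t)) = cmod (char \<nu> t)"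
    using n by (simp add: \<nu>(2) norm_power real_root_power_cancel)
  then have y: "0 \<le> y" "y \<le> 1 / 10"
    using n \<nu>.cmod_char_le_1[of t] by (auto simp: y_def)
  have "(1 - y) ^ 5 = 1 - 5 * y + 10 * y\<^sup>2 - 5 * y ^ 3 * (2 - y) - y ^ 5"
    by (simp add: power2_eq_square numeral_3_eq_3 numeral_eq_Suc algebra_simps)
  also have "\<dots> \<le> 1 - 5 * y + 10 * y\<^sup>2"
  proof -
    have "0 \<le> 5 * y ^ 3 * (2 - y)" "0 \<le> y ^ 5" using y by auto
    then show ?thesis by linarith
  qed
  \<comment> \<open>Here \<open>y \<le> 1 / 10\<close> enters, as
    \<open>10 * y\<^sup>2 \<le> y\<close>.\<close>
  also have "\<dots> \<le> 1 - 4 * y"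
    using y mult_left_mono[of "10 * y" 1 y] by (simp add: power2_eq_square)
  finally have "cmod (char \<nu> t) ^ 5 \<le> cmod (char \<nu> (2 * t))"
    using \<nu>.char_double[of t] by (simp add: y_def)
  then have "(cmod (char \<nu> t) ^ 5) ^ n \<le> cmod (char \<nu> (2 * t)) ^ n"
    by (intro power_mono) auto
  then show ?thesis
    unfolding \<nu>(2) norm_power by (simp only: power_mult[symmetric] mult.commute)
qed auto

text \<open>Halving \<open>t\<close> often enough reaches the neighbourhood of 0 where continuity
  excludes zeros; \<open>double\<close> carries this back to \<open>t\<close> one doubling at a
  time. Being an inequality, \<open>double\<close> can be verified for limits of characteristic
  functions.\<close>

lemma nonzero_if_double:
  fixes \<phi> :: "real \<Rightarrow> complex"
  assumes cont: "isCont \<phi> 0" and 0: "\<phi> 0 \<noteq> 0"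
    and double: "\<And>t. cmod (\<phi> t) ^ 5 \<le> cmod (\<phi> (2 * t))"
  shows "\<phi> t \<noteq> 0"
proof -
  have "(\<lambda>n. \<phi> (t * (1 / 2) ^ n)) \<longlonglongrightarrow> \<phi> (t * 0)"
    using cont by (intro isCont_tendsto_compose[of _ \<phi>] tendsto_mult tendsto_const LIMSEQ_realpow_zero) auto
  then have "\<forall>\<^sub>F n in sequentially. \<phi> (t * (1 / 2) ^ n) \<noteq> 0"
    using 0 by (intro tendsto_imp_eventually_ne) auto
  then obtain n where n: "\<phi> (t * (1 / 2) ^ n) \<noteq> 0"
    using eventually_happens[of _ sequentially] by auto
  then show ?thesis
  proof (induction n)
    case (Suc n)
    have "2 * (t * (1 / 2) ^ Suc n) = t * (1 / 2) ^ n" by simp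
    then have "0 < cmod (\<phi> (t * (1 / 2) ^ n))"
      using double[of "t * (1 / 2) ^ Suc n"] Suc.prems by (smt (verit) zero_less_norm_iff zero_less_power)
    then show ?case using Suc.IH by simp
  qed simp
qed

lemma char_sum_PiM:
  assumes "real_distribution \<nu>"
  shows "char (distr (\<Pi>\<^sub>M i\<in>{..<n::nat}. \<nu>) borel (\<lambda>x. \<Sum>i<n. x i)) \<theta> = char \<nu> \<theta> ^ n"
proof -
  interpret \<nu>: real_distribution \<nu> by fact
  interpret product_sigma_finite "\<lambda>_::nat. \<nu>" ..
  have "char (distr (\<Pi>\<^sub>M i\<in>{..<n}. \<nu>) borel (\<lambda>x. \<Sum>i<n. x i)) \<theta>
      = (CLINT x|(\<Pi>\<^sub>M i\<in>{..<n}. \<nu>). (\<Prod>i<n. iexp (\<theta> * x i)))"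
    unfolding char_def
    by (subst integral_distr) (auto simp: sum_distrib_left exp_sum)
  also have "\<dots> = (\<Prod>i<n. CLINT x|\<nu>. iexp (\<theta> * x))"
    by (rule product_integral_prod) (auto intro!: \<nu>.integrable_const_bound[where B=1])
  finally show ?thesis by (simp add: char_def)
qed

lemma infdivI_char:
  assumes \<mu>: "real_distribution \<mu>"
    and "\<And>n. n \<ge> 1 \<Longrightarrow> \<exists>\<nu>. real_distribution \<nu> \<and> (\<forall>\<theta>. char \<mu> \<theta> = char \<nu> \<theta> ^ n)"
  shows "infdiv \<mu>"
  unfolding infdiv_def
proof (intro allI impI)
  fix n :: nat assume "n \<ge> 1"
  then obtain \<nu> where \<nu>: "real_distribution \<nu>" "\<And>\<theta>. char \<mu> \<theta> = char \<nu> \<theta> ^ n"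
    using assms by blast
  interpret \<nu>: real_distribution \<nu> by fact
  interpret P: prob_space "\<Pi>\<^sub>M i\<in>{..<n}. \<nu>"
    by (intro prob_space_PiM \<nu>.prob_space_axioms)
  have "\<mu> = distr (\<Pi>\<^sub>M i\<in>{..<n}. \<nu>) borel (\<lambda>x. \<Sum>i<n. x i)"
    by (intro Levy_uniqueness \<mu> P.real_distribution_distr) (auto simp: char_sum_PiM \<nu>)
  then show "\<exists>\<nu>. prob_space \<nu> \<and> sets \<nu> = sets borel \<and>
        \<mu> = distr (\<Pi>\<^sub>M i\<in>{..<n}. \<nu>) borel (\<lambda>x. \<Sum>i<n. x i)"
    using \<nu>.prob_space_axioms by (intro exI[of _ \<nu>]) auto
qed

text \<open>The linear form given by \<theta> maps an \<open>n\<close>-th root of the vector law to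
  an \<open>n\<close>-th root of its own law. One \<nu> serves the whole ray, which matters because
  doubling compares the same root at \<open>t\<close> and \<open>2 * t\<close>.\<close>

lemma infdiv_vec_char_root:
  assumes "infdiv_vec k \<mu>" "n \<ge> 1"
  shows "\<exists>\<nu>. real_distribution \<nu> \<and> (\<forall>t. (CLINT x|\<mu>. iexp (t * (\<Sum>j<k. \<theta> j * x j))) = char \<nu> t ^ n)"
proof -
  obtain \<nu> where \<nu>: "prob_space \<nu>" "sets \<nu> = sets (borel_Rvec k)"
    and \<mu>: "\<mu> = distr (\<Pi>\<^sub>M i\<in>{..<n}. \<nu>) (borel_Rvec k) (\<lambda>x. \<lambda>j\<in>{..<k}. \<Sum>i<n. x i j)"
    using assms unfolding infdiv_vec_def by blast
  interpret \<nu>: prob_space \<nu> by fact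
  interpret product_sigma_finite "\<lambda>_::nat. \<nu>" ..
  note [measurable_cong] = \<nu>(2)
  have lin [measurable]: "(\<lambda>x. \<Sum>j<k. \<theta> j * x j) \<in> borel_measurable (borel_Rvec k)"
    by (intro borel_measurable_sum borel_measurable_times measurable_component_singleton) auto
  have comp: "(\<lambda>x. x j) \<in> borel_measurable \<nu>" if "j < k" for j
  proof -
    have "(\<lambda>x. x j) \<in> borel_measurable (borel_Rvec k)"
      using that by (intro measurable_component_singleton) auto
    then show ?thesis by measurable
  qed
  have [measurable]: "(\<lambda>x. \<lambda>j\<in>{..<k}. \<Sum>i<n. x i j) \<in> (\<Pi>\<^sub>M i\<in>{..<n}. \<nu>) \<rightarrow>\<^sub>M borel_Rvec k"
    by (intro measurable_restrict borel_measurable_sum measurable_compose[OF measurable_component_singleton] comp) auto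
  have [measurable]: "(\<lambda>x. \<Sum>j<k. \<theta> j * x j) \<in> borel_measurable \<nu>"
    by (intro borel_measurable_sum borel_measurable_times comp) auto
  have "(CLINT x|\<mu>. iexp (t * (\<Sum>j<k. \<theta> j * x j))) = char (distr \<nu> borel (\<lambda>x. \<Sum>j<k. \<theta> j * x j)) t ^ n" for t
  proof -
    have swap: "t * (\<Sum>j<k. \<theta> j * (\<Sum>i<n. x i j)) = (\<Sum>i<n. t * (\<Sum>j<k. \<theta> j * x i j))" for x :: "nat \<Rightarrow> nat \<Rightarrow> real"
      by (simp add: sum_distrib_left) (rule sum.swap)
    have "(CLINT x|\<mu>. iexp (t * (\<Sum>j<k. \<theta> j * x j)))
        = (CLINT x|(\<Pi>\<^sub>M i\<in>{..<n}. \<nu>). iexp (t * (\<Sum>j<k. \<theta> j * (\<Sum>i<n. x i j))))"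
      unfolding \<mu> by (subst integral_distr) auto
    also have "\<dots> = (CLINT x|(\<Pi>\<^sub>M i\<in>{..<n}. \<nu>). (\<Prod>i<n. iexp (t * (\<Sum>j<k. \<theta> j * x i j))))"
      unfolding swap by (simp add: exp_sum sum_distrib_left)
    also have "\<dots> = (\<Prod>i<n. CLINT x|\<nu>. iexp (t * (\<Sum>j<k. \<theta> j * x j)))"
      by (rule product_integral_prod) (auto intro!: \<nu>.integrable_const_bound[where B=1])
    finally show ?thesis
      by (simp add: char_def integral_distr)
  qed
  moreover have "real_distribution (distr \<nu> borel (\<lambda>x. \<Sum>j<k. \<theta> j * x j))"
    by (intro \<nu>.real_distribution_distr) auto
  ultimately show ?thesis by blast
qed

section \<open>Exponents of increments\<close>

lemma sum_lessThan_2: "(\<Sum>j<2. g j) = g 0 + g (1::nat)"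
  by (simp add: numeral_2_eq_2)

lemma fdd_iexp:
  assumes "real_process M X" "\<forall>j<k. 0 \<le> t j"
  shows "(CLINT x|fdd M X k t. iexp (s * (\<Sum>j<k. \<theta> j * x j)))
       = (CLINT \<omega>|M. iexp (s * (\<Sum>j<k. \<theta> j * X (t j) \<omega>)))"
proof -
  have X: "X (t j) \<in> borel_measurable M" if "j < k" for j
    using assms that by (auto simp: real_process_def)
  have [measurable]: "(\<lambda>\<omega>. \<lambda>j\<in>{..<k}. X (t j) \<omega>) \<in> M \<rightarrow>\<^sub>M borel_Rvec k"
    by (intro measurable_restrict X) auto
  have [measurable]: "(\<lambda>x. \<Sum>j<k. \<theta> j * x j) \<in> borel_measurable (borel_Rvec k)"
    by (intro borel_measurable_sum borel_measurable_times measurable_component_singleton) auto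
  show ?thesis
    unfolding fdd_def by (subst integral_distr) auto
qed

text \<open>The predicate under \<open>THE\<close> in \<open>levy_exponent\<close>, named so that
  existence and uniqueness can be proved of it.\<close>

definition exponent_of where
  "exponent_of M X k t \<Psi> \<longleftrightarrow> \<Psi> \<in> extensional (Rvec k) \<and> continuous_on (Rvec k) \<Psi> \<and> \<Psi> (\<lambda>j\<in>{..<k}. 0) = 0 \<and>
        (\<forall>\<theta>\<in>Rvec k. (CLINT \<omega>|M. iexp (\<Sum>j<k. \<theta> j * X (t j) \<omega>)) = exp (\<Psi> \<theta>))"

lemma continuous_on_ray:
  "continuous_on UNIV (\<lambda>r::real. \<lambda>j\<in>{..<k::nat}. r * \<theta> j)"
  unfolding restrict_def
proof (rule continuous_on_coordinatewise_then_product)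
  show "continuous_on UNIV (\<lambda>r::real. if i \<in> {..<k} then r * \<theta> i else undefined)" for i
    by (cases "i \<in> {..<k}") (simp_all add: continuous_intros)
qed

text \<open>Along each ray through the origin this is uniqueness of continuous logarithms on the line.\<close>

lemma exponent_of_unique:
  assumes "exponent_of M X k t \<Psi>" "exponent_of M X k t \<Phi>"
  shows "\<Psi> = \<Phi>"
proof (rule extensionalityI)
  fix \<theta> :: "nat \<Rightarrow> real" assume \<theta>: "\<theta> \<in> Rvec k"
  let ?r = "\<lambda>r::real. \<lambda>j\<in>{..<k}. r * \<theta> j"
  have r: "?r r \<in> Rvec k" for r by auto
  have "\<Psi> (?r 1) = \<Phi> (?r 1)"
  proof (rule continuous_log_unique[where S=UNIV and a=0 and f="\<lambda>r. \<Psi> (?r r)" and g="\<lambda>r. \<Phi> (?r r)"])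
    show "continuous_on UNIV (\<lambda>r. \<Psi> (?r r))" "continuous_on UNIV (\<lambda>r. \<Phi> (?r r))"
    proof -
      have "continuous_on (Rvec k) \<Psi>" "continuous_on (Rvec k) \<Phi>"
        using assms by (auto simp: exponent_of_def)
      moreover have "?r ` UNIV \<subseteq> Rvec k" using r by blast
      ultimately show "continuous_on UNIV (\<lambda>r. \<Psi> (?r r))" "continuous_on UNIV (\<lambda>r. \<Phi> (?r r))"
        by (blast intro: continuous_on_compose2[OF _ continuous_on_ray])+
    qed
    show "exp (\<Psi> (?r x)) = exp (\<Phi> (?r x))" for x
    proof -
      let ?c = "CLINT \<omega>|M. iexp (\<Sum>j<k. ?r x j * X (t j) \<omega>)"
      have "?c = exp (\<Psi> (?r x))" "?c = exp (\<Phi> (?r x))"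
        using assms r[of x] unfolding exponent_of_def by blast+
      then show ?thesis by (rule subst)
    qed
  qed (use assms in \<open>auto simp: exponent_of_def\<close>)
  moreover have "?r 1 = \<theta>"
    using \<theta> by (auto simp: fun_eq_iff PiE_def extensional_def)
  ultimately show "\<Psi> \<theta> = \<Phi> \<theta>" by simp
qed (use assms in \<open>auto simp: exponent_of_def\<close>)

text \<open>Only two time points are needed below, so that the logarithm can be taken on the normed
  space \<open>real \<times> real\<close>.\<close>

lemma exponent_of_exists:
  assumes X: "infdiv_process M X" and t: "\<forall>j<2. 0 \<le> t j"
  shows "\<exists>\<Psi>. exponent_of M X 2 t \<Psi>"
proof -
  have RX: "real_process M X" using X by (simp add: infdiv_process_def)
  interpret prob_space M using RX by (simp add: real_process_def)
  have [measurable]: "X (t 0) \<in> borel_measurable M" "X (t (Suc 0)) \<in> borel_measurable M"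
    using RX t by (auto simp: real_process_def)
  define f where "f p = (CLINT \<omega>|M. iexp (fst p * X (t 0) \<omega> + snd p * X (t 1) \<omega>))" for p
  have cont: "continuous_on UNIV f"
    unfolding continuous_on_sequentially
  proof (intro ballI allI impI)
    fix p :: "nat \<Rightarrow> real \<times> real" and a
    assume "(\<forall>n. p n \<in> UNIV) \<and> p \<longlonglongrightarrow> a"
    then have p: "p \<longlonglongrightarrow> a" by simp
    show "(f \<circ> p) \<longlonglongrightarrow> f a"
      unfolding f_def o_def
      by (rule integral_dominated_convergence[where w="\<lambda>_. 1"])
         (auto intro!: tendsto_intros p)
  qed
  \<comment> \<open>Along the ray through \<open>p\<close> this is a one-dimensional characteristic
    function with roots of every order, so the doubling inequality applies.\<close>
  have nz: "f p \<noteq> 0" for p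
  proof -
    define \<theta> where "\<theta> j = (if j = 0 then fst p else snd p)" for j :: nat
    have ray: "f (s *\<^sub>R p) = (CLINT \<omega>|M. iexp (s * (\<Sum>j<2. \<theta> j * X (t j) \<omega>)))" for s
      by (simp add: f_def sum_lessThan_2 \<theta>_def algebra_simps)
    have "f (1 *\<^sub>R p) \<noteq> 0"
    proof (rule nonzero_if_double[of "\<lambda>s. f (s *\<^sub>R p)"])
      have "continuous_on UNIV (\<lambda>s::real. f (s *\<^sub>R p))"
        by (intro continuous_on_compose2[OF cont] continuous_intros) auto
      then show "isCont (\<lambda>s. f (s *\<^sub>R p)) 0"
        by (simp add: continuous_on_eq_continuous_at)
      show "f (0 *\<^sub>R p) \<noteq> 0" by (simp add: f_def prob_space)
      show "cmod (f (s *\<^sub>R p)) ^ 5 \<le> cmod (f ((2 * s) *\<^sub>R p))" for s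
      proof (rule char_roots_double)
        fix n :: nat assume n: "1 \<le> n"
        have "infdiv_vec 2 (fdd M X 2 t)"
          using X t by (auto simp: infdiv_process_def)
        from infdiv_vec_char_root[OF this n, of \<theta>]
        show "\<exists>\<nu>. real_distribution \<nu> \<and> (\<forall>s. f (s *\<^sub>R p) = char \<nu> s ^ n)"
          unfolding ray fdd_iexp[OF RX t] .
      qed
    qed
    then show ?thesis by simp
  qed
  have "f 0 = 1" by (simp add: f_def prob_space)
  then obtain g where g: "continuous_on UNIV g" "g 0 = 0" "\<And>p. f p = exp (g p)"
    using continuous_log_exists[OF cont nz] by blast
  have "exponent_of M X 2 t (restrict (\<lambda>\<theta>. g (\<theta> 0, \<theta> 1)) (Rvec 2))"
    unfolding exponent_of_def
  proof (intro conjI ballI)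
    have "continuous_on (Rvec 2) (\<lambda>\<theta>. g (\<theta> 0, \<theta> 1))"
      by (intro continuous_on_compose2[OF g(1)] continuous_on_Pair
          continuous_on_subset[OF continuous_on_product_coordinates]) auto
    then show "continuous_on (Rvec 2) (restrict (\<lambda>\<theta>. g (\<theta> 0, \<theta> 1)) (Rvec 2))"
      by (rule continuous_on_eq) simp
    show "(CLINT \<omega>|M. iexp (\<Sum>j<2. \<theta> j * X (t j) \<omega>)) = exp (restrict (\<lambda>\<theta>. g (\<theta> 0, \<theta> 1)) (Rvec 2) \<theta>)"
      if "\<theta> \<in> Rvec 2" for \<theta>
      using that g(3)[of "(\<theta> 0, \<theta> 1)"] by (simp add: f_def sum_lessThan_2)
  qed (use g(2) in \<open>auto simp: zero_prod_def\<close>)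
  then show ?thesis by blast
qed

lemma exponent_of_levy_exponent:
  assumes "infdiv_process M X" "\<forall>j<2. 0 \<le> t j"
  shows "exponent_of M X 2 t (levy_exponent M X 2 t)"
proof -
  have eq: "levy_exponent M X 2 t = (THE \<Psi>. exponent_of M X 2 t \<Psi>)"
    by (simp only: levy_exponent_def exponent_of_def)
  have "\<exists>!\<Psi>. exponent_of M X 2 t \<Psi>"
    using exponent_of_exists[OF assms] exponent_of_unique by (blast intro: ex_ex1I)
  from theI'[OF this] show ?thesis
    by (simp only: eq)
qed

text \<open>Read off from the two-dimensional exponent because dilative stability is a statement
  about exponents: it transfers without the ambiguity of multiples of \<open>2 * pi * \<i>\<close>
  that non-integer powers of characteristic functions would bring.\<close>

definition incr_exponent :: "'a measure \<Rightarrow> (real \<Rightarrow> 'a \<Rightarrow> real) \<Rightarrow> real \<Rightarrow> real \<Rightarrow> real \<Rightarrow> complex" where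
  "incr_exponent M X s t \<theta> =
     levy_exponent M X 2 (\<lambda>j. if j = 0 then s else t) (\<lambda>j\<in>{..<2}. if j = 0 then - \<theta> else \<theta>)"

lemma incr_exponent:
  assumes X: "infdiv_process M X" and st: "0 \<le> s" "0 \<le> t"
  shows continuous_on_incr_exponent: "continuous_on UNIV (incr_exponent M X s t)"
    and incr_exponent_0: "incr_exponent M X s t 0 = 0"
    and exp_incr_exponent: "(CLINT \<omega>|M. iexp (\<theta> * (X t \<omega> - X s \<omega>))) = exp (incr_exponent M X s t \<theta>)"
proof -
  let ?t = "\<lambda>j::nat. if j = 0 then s else t"
  let ?v = "\<lambda>\<theta>::real. \<lambda>j\<in>{..<2::nat}. if j = 0 then - \<theta> else \<theta>"
  have E: "exponent_of M X 2 ?t (levy_exponent M X 2 ?t)"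
    using X st by (intro exponent_of_levy_exponent) auto
  have v: "?v \<theta> \<in> Rvec 2" for \<theta> by auto
  have cv: "continuous_on UNIV ?v"
    unfolding restrict_def
  proof (rule continuous_on_coordinatewise_then_product)
    show "continuous_on UNIV (\<lambda>\<theta>::real. if i \<in> {..<2} then (if i = 0 then - \<theta> else \<theta>) else undefined)" for i :: nat
      by (cases "i \<in> {..<2}"; cases "i = 0") (simp_all add: continuous_intros)
  qed
  have "continuous_on (Rvec 2) (levy_exponent M X 2 ?t)"
    using E by (simp add: exponent_of_def)
  moreover have "?v ` UNIV \<subseteq> Rvec 2" using v by blast
  ultimately show "continuous_on UNIV (incr_exponent M X s t)"
    unfolding incr_exponent_def[abs_def] by (rule continuous_on_compose2[OF _ cv])
  have "?v 0 = (\<lambda>j\<in>{..<2}. 0)" by auto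
  then show "incr_exponent M X s t 0 = 0"
    using E by (simp add: incr_exponent_def exponent_of_def)
  have "(\<Sum>j<2. ?v \<theta> j * X (?t j) \<omega>) = \<theta> * (X t \<omega> - X s \<omega>)" for \<omega>
    by (simp add: sum_lessThan_2 algebra_simps)
  then show "(CLINT \<omega>|M. iexp (\<theta> * (X t \<omega> - X s \<omega>))) = exp (incr_exponent M X s t \<theta>)"
    using bspec[OF E[unfolded exponent_of_def, THEN conjunct2, THEN conjunct2, THEN conjunct2] v[of \<theta>]]
    by (simp only: incr_exponent_def)
qed

lemma incr_exponent_scale:
  assumes "dilatively_stable M X \<alpha> \<delta>" "T > 0" "0 \<le> s" "0 \<le> t"
  shows "incr_exponent M X (T * s) (T * t) \<theta>
     = of_real (T powr \<delta>) * incr_exponent M X s t (T powr (\<alpha> - \<delta> / 2) * \<theta>)"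
proof -
  let ?t = "\<lambda>j::nat. if j = 0 then s else t"
  let ?v = "\<lambda>\<theta>::real. \<lambda>j\<in>{..<2::nat}. if j = 0 then - \<theta> else \<theta>"
  have "(\<lambda>j::nat. if j = 0 then T * s else T * t) = (\<lambda>j. T * ?t j)" by auto
  moreover have "(\<lambda>j\<in>{..<2}. T powr (\<alpha> - \<delta> / 2) * ?v \<theta> j) = ?v (T powr (\<alpha> - \<delta> / 2) * \<theta>)"
    by auto
  moreover have "levy_exponent M X 2 (\<lambda>j. T * ?t j) (?v \<theta>) =
        of_real (T powr \<delta>) * levy_exponent M X 2 ?t (\<lambda>j\<in>{..<2}. T powr (\<alpha> - \<delta> / 2) * ?v \<theta> j)"
    using assms unfolding dilatively_stable_def by auto
  ultimately show ?thesis by (simp add: incr_exponent_def)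
qed

lemma incr_char_roots:
  assumes X: "infdiv_process M X" and st: "0 \<le> s" "0 \<le> t" and n: "n \<ge> 1"
  shows "\<exists>\<nu>. real_distribution \<nu> \<and> (\<forall>\<theta>. exp (incr_exponent M X s t \<theta>) = char \<nu> \<theta> ^ n)"
proof -
  let ?t = "\<lambda>j::nat. if j = 0 then s else t"
  let ?v = "\<lambda>j::nat. if j = 0 then - 1 else 1 :: real"
  have RX: "real_process M X" using X by (simp add: infdiv_process_def)
  have eq: "(\<Sum>j<2. ?v j * X (?t j) \<omega>) = X t \<omega> - X s \<omega>" for \<omega>
    by (simp add: sum_lessThan_2)
  have t: "\<forall>j<2. 0 \<le> ?t j" using st by auto
  have "infdiv_vec 2 (fdd M X 2 ?t)"
    using X t by (auto simp: infdiv_process_def)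
  from infdiv_vec_char_root[OF this n, of ?v] show ?thesis
    by (simp only: fdd_iexp[OF RX t] eq exp_incr_exponent[OF X st])
qed

section \<open>Riemann sums of right-continuous paths\<close>

text \<open>What the Riemann sums below need: right continuity for convergence, local boundedness
  for domination. Of the left limits of cadlag paths only this boundedness is kept.\<close>

definition regular_path :: "(real \<Rightarrow> real) \<Rightarrow> bool" where
  "regular_path z \<longleftrightarrow> (\<forall>u. continuous (at_right u) z) \<and> (\<forall>a b. bounded (z ` {a..b}))"

text \<open>Grid points are rounded up, so that right continuity is all that is needed.\<close>

definition grid :: "nat \<Rightarrow> real \<Rightarrow> real" where
  "grid n u = real_of_int \<lceil>u * real (Suc n)\<rceil> / real (Suc n)"

definition node :: "nat \<Rightarrow> int \<Rightarrow> real" where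
  "node n i = real_of_int i / real (Suc n)"

text \<open>The weight is evaluated at the left node, where dilative stability also places its
  scaling factor, so that the two can cancel exactly. Both ends are rounded up in the same way, so
  the sum runs over whole cells.\<close>

definition riemann_sum :: "real \<Rightarrow> (real \<Rightarrow> real) \<Rightarrow> nat \<Rightarrow> real \<Rightarrow> real \<Rightarrow> real" where
  "riemann_sum c z n a b = (\<Sum>i=\<lceil>a * real (Suc n)\<rceil>..<\<lceil>b * real (Suc n)\<rceil>.
     exp (c * node n i) * (z (node n (i + 1)) - z (node n i)))"

lemma grid_bounds: "u \<le> grid n u" "grid n u < u + 1 / real (Suc n)"
proof -
  have "u * real (Suc n) \<le> real_of_int \<lceil>u * real (Suc n)\<rceil>" "real_of_int \<lceil>u * real (Suc n)\<rceil> < u * real (Suc n) + 1"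
    by linarith+
  then show "u \<le> grid n u" "grid n u < u + 1 / real (Suc n)"
    unfolding grid_def by (simp_all add: field_simps del: of_nat_Suc)
qed

lemma grid_le_add_1: "grid n u \<le> u + 1"
proof -
  have "1 / real (Suc n) \<le> 1" by simp
  then show ?thesis using grid_bounds(2)[of n u] by linarith
qed

lemma tendsto_grid: "(\<lambda>n. grid n u) \<longlonglongrightarrow> u"
proof (rule tendsto_sandwich[of "\<lambda>_. u" _ _ "\<lambda>n. u + 1 / real (Suc n)"])
  show "(\<lambda>n. u + 1 / real (Suc n)) \<longlonglongrightarrow> u"
    using tendsto_add[OF tendsto_const[of u] LIMSEQ_inverse_real_of_nat] by (simp add: inverse_eq_divide)
qed (intro always_eventually allI grid_bounds less_imp_le tendsto_const)+

lemma regular_path_tendsto: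
  assumes "regular_path z" and "x \<longlonglongrightarrow> u" and "\<And>n. u \<le> x n"
  shows "(\<lambda>n. z (x n)) \<longlonglongrightarrow> z u"
proof -
  have "(z \<longlongrightarrow> z u) (at u within {u..})"
    using assms(1) by (simp add: regular_path_def continuous_within at_within_Ici_at_right)
  then have "continuous (at u within {u..}) z"
    by (simp add: continuous_within)
  then show ?thesis
    by (rule continuous_within_tendsto_compose) (use assms in auto)
qed

lemma regular_path_grid: "regular_path z \<Longrightarrow> (\<lambda>n. z (grid n u)) \<longlonglongrightarrow> z u"
  by (rule regular_path_tendsto) (auto intro: tendsto_grid grid_bounds)

text \<open>An arbitrary \<open>z\<close> is allowed because the composition factors through the
  integer-valued ceiling, and every function on a discrete space is measurable.\<close>

lemma measurable_comp_grid: "(\<lambda>u. z (grid n u)) \<in> borel_measurable borel" for z :: "real \<Rightarrow> real"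
proof -
  have "(\<lambda>u. \<lceil>u * real (Suc n)\<rceil>) \<in> borel \<rightarrow>\<^sub>M count_space UNIV"
    by measurable
  moreover have "(\<lambda>i. z (real_of_int i / real (Suc n))) \<in> count_space UNIV \<rightarrow>\<^sub>M borel"
    by simp
  ultimately show ?thesis
    unfolding grid_def by (rule measurable_compose)
qed

lemma regular_path_measurable:
  assumes "regular_path z"
  shows "z \<in> borel_measurable borel"
  by (rule borel_measurable_LIMSEQ_real[of _ "\<lambda>n u. z (grid n u)"])
     (use regular_path_grid[OF assms] measurable_comp_grid in auto)

lemma regular_path_bound:
  assumes "regular_path z"
  obtains C where "C > 0" "\<And>u. a \<le> u \<Longrightarrow> u \<le> b \<Longrightarrow> \<bar>z u\<bar> \<le> C"
  using assms unfolding regular_path_def bounded_pos by (metis atLeastAtMost_iff image_eqI real_norm_def)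

lemma sum_by_parts_int:
  fixes A z :: "int \<Rightarrow> real"
  assumes "p \<le> q"
  shows "(\<Sum>i=p..<q. A i * (z (i + 1) - z i))
     = A q * z q - A p * z p - (\<Sum>i=p..<q. z (i + 1) * (A (i + 1) - A i))"
  using assms
proof (induction q rule: int_ge_induct)
  case (step q)
  then have "{p..<q + 1} = insert q {p..<q}" by auto
  then show ?case using step.IH by (simp add: algebra_simps)
qed simp

lemma set_integrable_exp_regular:
  assumes z: "regular_path z"
  shows "set_integrable lborel {a..b} (\<lambda>u. c * exp (c * u) * z u)"
proof -
  note [measurable] = regular_path_measurable[OF z]
  obtain C where C: "C > 0" "\<And>u. a \<le> u \<Longrightarrow> u \<le> b \<Longrightarrow> \<bar>z u\<bar> \<le> C"
    using regular_path_bound[OF z, of a b] by metis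
  show ?thesis
  proof (rule set_integrable_bound)
    show "set_integrable lborel {a..b} (\<lambda>u. c * exp (c * u) * C)"
      by (intro borel_integrable_atLeastAtMost' continuous_intros)
    show "set_borel_measurable lborel {a..b} (\<lambda>u. c * exp (c * u) * z u)"
      unfolding set_borel_measurable_def by measurable
    show "AE u in lborel. u \<in> {a..b} \<longrightarrow> norm (c * exp (c * u) * z u) \<le> norm (c * exp (c * u) * C)"
      using C by (auto simp: abs_mult intro!: mult_left_mono)
  qed
qed

lemma integral_exp_regular:
  assumes z: "regular_path z"
  shows "integral {a..b} (\<lambda>u. c * exp (c * u) * z u) = (LBINT u:{a..b}. c * exp (c * u) * z u)"
  using set_borel_integral_eq_integral(2)[OF set_integrable_exp_regular[OF z]] by simp

lemma deriv_exp_mult: "deriv (\<lambda>u. exp (u * c)) t = c * exp (c * t)" for c t :: real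
  by (rule DERIV_imp_deriv) (auto intro!: derivative_eq_intros simp: mult.commute)

lemma random_integral_exp:
  "random_integral (\<lambda>u. exp (u * c)) z a b
     = exp (c * b) * z b - exp (c * a) * z a - integral {a..b} (\<lambda>u. c * exp (c * u) * z u)"
  unfolding random_integral_def deriv_exp_mult by (simp add: mult.commute)

text \<open>Summation by parts moves the differences from \<open>z\<close> to the exponential,
  matching the integration by parts in \<open>random_integral\<close>. The remaining sum
  \<open>S n\<close> is exactly the integral of the step function \<open>z (grid n u)\<close>
  against \<open>h\<close>, so that only dominated convergence is left.\<close>

lemma riemann_sum_tendsto:
  assumes z: "regular_path z" and ab: "a \<le> b"
  shows "(\<lambda>n. riemann_sum c z n a b) \<longlonglongrightarrow> random_integral (\<lambda>u. exp (u * c)) z a b"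
proof -
  note [measurable] = regular_path_measurable[OF z] measurable_comp_grid
  \<comment> \<open>The margin 2 covers two roundings, each by at most 1: that of \<open>b\<close>,
    and that of a point up to \<open>grid n b\<close>.\<close>
  obtain C where C: "C > 0" "\<And>u. a \<le> u \<Longrightarrow> u \<le> b + 2 \<Longrightarrow> \<bar>z u\<bar> \<le> C"
    using regular_path_bound[OF z, of a "b + 2"] by metis
  define h where "h u = c * exp (c * u)" for u
  have hcont: "continuous_on S h" for S
    unfolding h_def by (intro continuous_intros)
  have [measurable]: "h \<in> borel_measurable borel"
    using hcont by (rule borel_measurable_continuous_onI)
  define k where "k i n = real_of_int i / real (Suc n)" for i n
  define S where "S n = (\<Sum>i=\<lceil>a * real (Suc n)\<rceil>..<\<lceil>b * real (Suc n)\<rceil>. z (k (i + 1) n) * (exp (c * k (i + 1) n) - exp (c * k i n)))" for n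
  define f where "f n u = indicator {grid n a <.. grid n b} u * (h u * z (grid n u))" for n u
  have mono: "\<lceil>a * real (Suc n)\<rceil> \<le> \<lceil>b * real (Suc n)\<rceil>" for n
    using ab by (intro ceiling_mono mult_right_mono) auto
  have S: "S n = (LBINT u. f n u)" for n
  proof -
    define p where "p = \<lceil>a * real (Suc n)\<rceil>"
    define q where "q = \<lceil>b * real (Suc n)\<rceil>"
    have kle: "k i n \<le> k (i + 1) n" for i by (simp add: k_def divide_right_mono)
    have piece: "has_bochner_integral lborel (\<lambda>u. indicator {k i n <.. k (i + 1) n} u * h u)
        (exp (c * k (i + 1) n) - exp (c * k i n))" for i
    proof -
      have "has_bochner_integral lborel (\<lambda>u. indicator {k i n .. k (i + 1) n} u *\<^sub>R h u)
          (exp (c * k (i + 1) n) - exp (c * k i n))"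
        by (rule has_bochner_integral_FTC_Icc[OF kle])
           (auto simp: h_def intro!: hcont[unfolded h_def] derivative_eq_intros simp flip: has_real_derivative_iff_has_vector_derivative)
      \<comment> \<open>The left end point is a null set; half-open cells are disjoint, so the sum
        in \<open>fsum\<close> has at most one nonzero term.\<close>
      then show ?thesis
        by (rule has_bochner_integralI_AE) (use AE_lborel_singleton[of "k i n"] in \<open>auto simp: indicator_def\<close>)
    qed
    have fsum: "f n u = (\<Sum>i=p..<q. z (k (i + 1) n) * (indicator {k i n <.. k (i + 1) n} u * h u))" for u
    proof -
      have iff: "u \<in> {k i n <.. k (i + 1) n} \<longleftrightarrow> i = \<lceil>u * real (Suc n)\<rceil> - 1" for i
      proof -
        have "u \<in> {k i n <.. k (i + 1) n} \<longleftrightarrow> real_of_int i < u * real (Suc n) \<and> u * real (Suc n) \<le> real_of_int (i + 1)"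
          by (simp add: k_def field_simps del: of_nat_Suc)
        also have "\<dots> \<longleftrightarrow> i = \<lceil>u * real (Suc n)\<rceil> - 1"
          by linarith
        finally show ?thesis .
      qed
      have "(\<Sum>i=p..<q. z (k (i + 1) n) * (indicator {k i n <.. k (i + 1) n} u * h u))
          = (\<Sum>i=p..<q. if i = \<lceil>u * real (Suc n)\<rceil> - 1 then z (grid n u) * h u else 0)"
        by (intro sum.cong refl, simp only: indicator_def iff) (auto simp: grid_def k_def)
      also have "\<dots> = (if \<lceil>u * real (Suc n)\<rceil> - 1 \<in> {p..<q} then z (grid n u) * h u else 0)"
        by (simp add: sum.delta)
      also have "\<lceil>u * real (Suc n)\<rceil> - 1 \<in> {p..<q} \<longleftrightarrow> u \<in> {grid n a <.. grid n b}"
      proof -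
        have "u \<in> {grid n a <.. grid n b} \<longleftrightarrow> real_of_int p < u * real (Suc n) \<and> u * real (Suc n) \<le> real_of_int q"
          by (simp add: grid_def p_def q_def field_simps del: of_nat_Suc)
        also have "\<dots> \<longleftrightarrow> \<lceil>u * real (Suc n)\<rceil> - 1 \<in> {p..<q}"
          by (simp add: ceiling_le_iff less_ceiling_iff[symmetric]) linarith
        finally show ?thesis ..
      qed
      finally show ?thesis by (simp add: f_def indicator_def)
    qed
    have "has_bochner_integral lborel (f n) (S n)"
      unfolding fsum S_def p_def[symmetric] q_def[symmetric]
      by (intro has_bochner_integral_sum has_bochner_integral_mult_right piece)
    then show ?thesis by (simp add: has_bochner_integral_integral_eq)
  qed
  have "(\<lambda>n. LBINT u. f n u) \<longlonglongrightarrow> (LBINT u. indicator {a..b} u * (h u * z u))"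
  proof (rule integral_dominated_convergence)
    show "integrable lborel (\<lambda>u. indicator {a..b + 1} u *\<^sub>R (\<bar>h u\<bar> * C))"
    proof -
      have "continuous_on {a..b + 1} (\<lambda>u. \<bar>h u\<bar> * C)"
        by (intro continuous_intros hcont)
      from borel_integrable_atLeastAtMost'[OF this] show ?thesis
        by (simp add: set_integrable_def)
    qed
    show "AE u in lborel. norm (f n u) \<le> indicator {a..b + 1} u *\<^sub>R (\<bar>h u\<bar> * C)" for n
    proof (rule AE_I2)
      fix u
      show "norm (f n u) \<le> indicator {a..b + 1} u *\<^sub>R (\<bar>h u\<bar> * C)"
      proof (cases "u \<in> {grid n a <.. grid n b}")
        case True
        then have u: "a \<le> u" "u \<le> b + 1"
          using grid_bounds(1)[of a n] grid_le_add_1[of n b] by auto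
        then have "\<bar>z (grid n u)\<bar> \<le> C"
          using grid_bounds(1)[of u n] grid_le_add_1[of n u] by (intro C(2)) auto
        then show ?thesis
          using True u by (auto simp: f_def abs_mult intro!: mult_left_mono)
      qed (use C(1) in \<open>auto simp: f_def\<close>)
    qed
    \<comment> \<open>The point \<open>a\<close> is left out: it never lies in the half-open rounded
      interval, since \<open>a \<le> grid n a\<close>.\<close>
    show "AE u in lborel. (\<lambda>n. f n u) \<longlonglongrightarrow> indicator {a..b} u * (h u * z u)"
      using AE_lborel_singleton[of a]
    proof eventually_elim
      case (elim u)
      have "(\<lambda>n. indicator {grid n a <.. grid n b} u :: real) \<longlonglongrightarrow> indicator {a..b} u"
      proof -
        consider "u < a" | "a < u" "u \<le> b" | "b < u" using elim by linarith
        then have "\<forall>\<^sub>F n in sequentially. (indicator {grid n a <.. grid n b} u :: real) = indicator {a..b} u"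
        proof cases
          case 1
          then show ?thesis
            using grid_bounds(1)[of a] by (intro always_eventually) (auto simp: indicator_def not_less intro: order.strict_implies_order less_le_trans)
        next
          case 2
          then have "\<forall>\<^sub>F n in sequentially. grid n a < u"
            by (intro order_tendstoD(2)[OF tendsto_grid])
          then show ?thesis
            by eventually_elim (use 2 grid_bounds(1)[of b] order_trans in \<open>auto simp: indicator_def\<close>)
        next
          case 3
          then have "\<forall>\<^sub>F n in sequentially. grid n b < u"
            by (intro order_tendstoD(2)[OF tendsto_grid])
          then show ?thesis
            by eventually_elim (use 3 in \<open>auto simp: indicator_def\<close>)
        qed
        then show ?thesis by (rule tendsto_eventually)
      qed
      then show ?case
        unfolding f_def by (intro tendsto_mult tendsto_const regular_path_grid[OF z])
    qed
  qed (auto simp: f_def)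
  then have Slim: "S \<longlonglongrightarrow> integral {a..b} (\<lambda>u. c * exp (c * u) * z u)"
    unfolding S[symmetric] integral_exp_regular[OF z] set_lebesgue_integral_def by (simp add: h_def)
  have eq: "riemann_sum c z n a b
     = exp (c * grid n b) * z (grid n b) - exp (c * grid n a) * z (grid n a) - S n" for n
    using sum_by_parts_int[where A="\<lambda>i. exp (c * k i n)" and z="\<lambda>i. z (k i n)", OF mono]
    by (simp add: riemann_sum_def node_def S_def k_def grid_def del: of_nat_Suc)
  show ?thesis
    unfolding eq random_integral_exp
    by (intro tendsto_intros tendsto_grid regular_path_grid[OF z] Slim)
qed

section \<open>Additive processes and cadlag paths\<close>

lemma sum_int_shift: "p \<le> q \<Longrightarrow> (\<Sum>i=p..<q. g i) = (\<Sum>j<nat (q - p). g (p + int j))"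
  by (rule sum.reindex_bij_witness[of _ "\<lambda>j. p + int j" "\<lambda>i. nat (i - p)"]) auto

lemma prod_int_shift: "p \<le> q \<Longrightarrow> (\<Prod>i=p..<q. g i) = (\<Prod>j<nat (q - p). g (p + int j))"
  by (rule prod.reindex_bij_witness[of _ "\<lambda>j. p + int j" "\<lambda>i. nat (i - p)"]) auto

lemma additive_process_measurable:
  "additive_process M X \<Longrightarrow> 0 \<le> t \<Longrightarrow> X t \<in> borel_measurable M"
  by (simp add: additive_process_def real_process_def)

lemma additive_process_prob_space: "additive_process M X \<Longrightarrow> prob_space M"
  by (simp add: additive_process_def real_process_def)

lemma additive_char_nat:
  fixes t :: "nat \<Rightarrow> real"
  assumes X: "additive_process M X" and t0: "0 \<le> t 0" and t: "\<forall>i<n. t i < t (Suc i)"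
  shows "(CLINT \<omega>|M. iexp (\<Sum>i<n. c i * (X (t (Suc i)) \<omega> - X (t i) \<omega>)))
       = (\<Prod>i<n. CLINT \<omega>|M. iexp (c i * (X (t (Suc i)) \<omega> - X (t i) \<omega>)))"
proof -
  interpret prob_space M using X by (rule additive_process_prob_space)
  define D where "D i \<omega> = (if i = 0 then X (t 0) \<omega> else X (t i) \<omega> - X (t (i - 1)) \<omega>)" for i \<omega>
  have "indep_vars (\<lambda>_. borel) D {..n}"
    using X t0 t unfolding additive_process_def D_def by blast
  \<comment> \<open>Index 0 carries the initial value \<open>X (t 0)\<close>, which is no increment,
    and is dropped.\<close>
  then have D: "indep_vars (\<lambda>_. borel) D {1..n}"
    by (rule indep_vars_subset) auto
  define E where "E i \<omega> = c (i - 1) * D i \<omega>" for i \<omega>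
  have E: "indep_vars (\<lambda>_. borel) E {1..n}"
    unfolding E_def[abs_def] by (rule indep_vars_compose2[OF D]) auto
  have meas: "E i \<in> borel_measurable M" if "i \<in> {1..n}" for i
    using E that unfolding indep_vars_def by auto
  have "(CLINT \<omega>|M. iexp (\<Sum>i\<in>{1..n}. E i \<omega>)) = (\<Prod>i\<in>{1..n}. CLINT \<omega>|M. iexp (E i \<omega>))"
  proof -
    have "(CLINT \<omega>|M. iexp (\<Sum>i\<in>{1..n}. E i \<omega>)) = char (distr M borel (\<lambda>\<omega>. \<Sum>i\<in>{1..n}. E i \<omega>)) 1"
      unfolding char_def by (subst integral_distr) (auto intro!: borel_measurable_sum meas)
    also have "\<dots> = (\<Prod>i\<in>{1..n}. char (distr M borel (E i)) 1)"
      by (rule char_distr_sum[OF E])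
    also have "\<dots> = (\<Prod>i\<in>{1..n}. CLINT \<omega>|M. iexp (E i \<omega>))"
      unfolding char_def by (intro prod.cong refl, subst integral_distr) (auto intro!: meas)
    finally show ?thesis .
  qed
  moreover have "E (Suc i) \<omega> = c i * (X (t (Suc i)) \<omega> - X (t i) \<omega>)" for i \<omega>
    by (simp add: E_def D_def)
  ultimately show ?thesis
    by (simp only: One_nat_def sum.atLeast1_atMost_eq prod.atLeast1_atMost_eq)
qed

lemma additive_char_increments:
  fixes s :: "int \<Rightarrow> real"
  assumes X: "additive_process M X" and pq: "p \<le> q" and s0: "0 \<le> s p"
    and s: "\<And>i. p \<le> i \<Longrightarrow> i < q \<Longrightarrow> s i < s (i + 1)"
  shows "(CLINT \<omega>|M. iexp (\<Sum>i=p..<q. c i * (X (s (i + 1)) \<omega> - X (s i) \<omega>)))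
       = (\<Prod>i=p..<q. CLINT \<omega>|M. iexp (c i * (X (s (i + 1)) \<omega> - X (s i) \<omega>)))"
proof -
  have sh: "p + int (Suc j) = p + int j + 1" for j by simp
  have "(CLINT \<omega>|M. iexp (\<Sum>j<nat (q - p). c (p + int j) * (X (s (p + int (Suc j))) \<omega> - X (s (p + int j)) \<omega>)))
       = (\<Prod>j<nat (q - p). CLINT \<omega>|M. iexp (c (p + int j) * (X (s (p + int (Suc j))) \<omega> - X (s (p + int j)) \<omega>)))"
  proof (rule additive_char_nat[OF X])
    show "\<forall>j<nat (q - p). s (p + int j) < s (p + int (Suc j))"
      unfolding sh using s by auto
  qed (use s0 in simp)
  then show ?thesis
    by (simp only: sum_int_shift[OF pq] prod_int_shift[OF pq] sh)
qed

section \<open>Boundedness and one-sided limits of cadlag paths\<close>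

lemma bounded_image_compact:
  fixes f :: "'a::metric_space \<Rightarrow> 'b::metric_space"
  assumes K: "compact K" and loc: "\<And>u. u \<in> K \<Longrightarrow> \<exists>e>0. bounded (f ` (ball u e \<inter> K))"
  shows "bounded (f ` K)"
proof -
  obtain e where e: "\<And>u. u \<in> K \<Longrightarrow> e u > 0 \<and> bounded (f ` (ball u (e u) \<inter> K))"
    using loc by metis
  obtain D where D: "D \<subseteq> K" "finite D" "K \<subseteq> (\<Union>u\<in>D. ball u (e u))"
    by (rule compactE_image[OF K, of K "\<lambda>u. ball u (e u)"]) (use e in auto)
  have "bounded (\<Union>u\<in>D. f ` (ball u (e u) \<inter> K))"
    using D e by (intro bounded_UN) auto
  then show ?thesis
  proof (rule bounded_subset)
    show "f ` K \<subseteq> (\<Union>u\<in>D. f ` (ball u (e u) \<inter> K))"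
    proof
      fix y assume "y \<in> f ` K"
      then obtain v where v: "v \<in> K" "y = f v" by blast
      with D(3) obtain u where "u \<in> D" "v \<in> ball u (e u)" by blast
      with v show "y \<in> (\<Union>u\<in>D. f ` (ball u (e u) \<inter> K))" by blast
    qed
  qed
qed

lemma tendsto_imp_bounded_image:
  fixes f :: "real \<Rightarrow> real"
  assumes "(f \<longlongrightarrow> l) (at u within S)"
  shows "\<exists>e>0. bounded (f ` (ball u e \<inter> S))"
proof -
  have "\<forall>\<^sub>F v in at u within S. dist (f v) l < 1"
    using assms by (rule tendstoD) simp
  then obtain e where e: "e > 0" "\<And>v. v \<in> S \<Longrightarrow> v \<noteq> u \<Longrightarrow> dist v u < e \<Longrightarrow> dist (f v) l < 1"
    unfolding eventually_at by blast
  have "f ` (ball u e \<inter> S) \<subseteq> insert (f u) (ball l 1)"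
  proof
    fix y assume "y \<in> f ` (ball u e \<inter> S)"
    then obtain v where v: "y = f v" "v \<in> S" "dist v u < e"
      by (auto simp: dist_commute)
    then show "y \<in> insert (f u) (ball l 1)"
      using e(2)[of v] by (cases "v = u") (auto simp: dist_commute)
  qed
  then have "bounded (f ` (ball u e \<inter> S))"
    by (rule bounded_subset[rotated]) (simp add: bounded_ball)
  with e(1) show ?thesis by blast
qed

lemma cadlag_bounded:
  assumes f: "cadlag_on {0..} f"
  shows "bounded (f ` {0..b})"
proof (rule bounded_image_compact)
  fix u :: real assume u: "u \<in> {0..b}"
  then obtain l where "(f \<longlongrightarrow> f u) (at u within {0..} \<inter> {u<..})" "(f \<longlongrightarrow> l) (at u within {0..} \<inter> {..<u})"
    using f unfolding cadlag_on_def by force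
  then obtain e1 e2 where e: "e1 > 0" "bounded (f ` (ball u e1 \<inter> ({0..} \<inter> {u<..})))"
    "e2 > 0" "bounded (f ` (ball u e2 \<inter> ({0..} \<inter> {..<u})))"
    using tendsto_imp_bounded_image by metis
  have "f ` (ball u (min e1 e2) \<inter> {0..b})
      \<subseteq> insert (f u) (f ` (ball u e1 \<inter> ({0..} \<inter> {u<..})) \<union> f ` (ball u e2 \<inter> ({0..} \<inter> {..<u})))"
  proof
    fix y assume "y \<in> f ` (ball u (min e1 e2) \<inter> {0..b})"
    then obtain v where v: "y = f v" "v \<in> ball u e1" "v \<in> ball u e2" "0 \<le> v" by auto
    then show "y \<in> insert (f u) (f ` (ball u e1 \<inter> ({0..} \<inter> {u<..})) \<union> f ` (ball u e2 \<inter> ({0..} \<inter> {..<u})))"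
      by (cases v u rule: linorder_cases) auto
  qed
  moreover have "bounded (insert (f u) (f ` (ball u e1 \<inter> ({0..} \<inter> {u<..})) \<union> f ` (ball u e2 \<inter> ({0..} \<inter> {..<u}))))"
    using e by simp
  ultimately have "bounded (f ` (ball u (min e1 e2) \<inter> {0..b}))"
    by (rule bounded_subset[rotated])
  moreover have "min e1 e2 > 0" using e by simp
  ultimately show "\<exists>e>0. bounded (f ` (ball u e \<inter> {0..b}))" by blast
qed simp

lemma cadlag_right_limit:
  assumes "cadlag_on {0..} f" "0 \<le> t"
  shows "(f \<longlongrightarrow> f t) (at_right t)"
proof -
  have "{0..} \<inter> {t<..} = {t<..}" using assms(2) by auto
  then show ?thesis
    using bspec[OF assms(1)[unfolded cadlag_on_def], of t] assms(2) by simp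
qed

lemma cadlag_left_limit:
  assumes f: "cadlag_on {0..} f" and t: "0 < t"
  shows "(f \<longlongrightarrow> Lim (at_left t) f) (at_left t)"
proof -
  have "at t within ({0..} \<inter> {..<t}) = at_left t"
    by (rule at_within_nhd[of t "{0<..}"]) (use t in auto)
  then obtain l where l: "(f \<longlongrightarrow> l) (at_left t)"
    using bspec[OF f[unfolded cadlag_on_def], of t] t by auto
  then have "Lim (at_left t) f = l"
    by (intro tendsto_Lim) auto
  with l show ?thesis by simp
qed

text \<open>Needed for the negative half-line: there the two-sided process is minus the left limit
  at the reflected time, and reflection turns this left continuity into right continuity.\<close>

lemma tendsto_at_left_Lim:
  assumes f: "cadlag_on {0..} f" and t: "0 < t"
  shows "((\<lambda>s. Lim (at_left s) f) \<longlongrightarrow> Lim (at_left t) f) (at_left t)"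
proof (rule tendstoI)
  fix e :: real assume e: "e > 0"
  let ?g = "\<lambda>s. Lim (at_left s) f"
  have "\<forall>\<^sub>F s in at_left t. dist (f s) (?g t) < e / 2"
    using cadlag_left_limit[OF f t] e by (intro tendstoD) auto
  then obtain d where d: "d < t" "\<And>s. d < s \<Longrightarrow> s < t \<Longrightarrow> dist (f s) (?g t) < e / 2"
    using eventually_at_left[of "t - 1" t] by auto
  have "dist (?g s) (?g t) < e" if s: "max d 0 < s" "s < t" for s
  proof -
    have "\<forall>\<^sub>F r in at_left s. dist (f r) (?g t) \<le> e / 2"
    proof -
      have "\<forall>\<^sub>F r in at_left s. r \<in> {d<..<s}"
        using s by (intro eventually_at_left_real) simp
      then show ?thesis
      proof eventually_elim
        case (elim r)
        then show ?case using d(2)[of r] s by simp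
      qed
    qed
    moreover have "((\<lambda>r. dist (f r) (?g t)) \<longlongrightarrow> dist (?g s) (?g t)) (at_left s)"
      using s by (intro tendsto_dist cadlag_left_limit[OF f] tendsto_const) auto
    ultimately have "dist (?g s) (?g t) \<le> e / 2"
      by (intro tendsto_upperbound) auto
    then show ?thesis using e by simp
  qed
  moreover have "\<forall>\<^sub>F s in at_left t. s \<in> {max d 0<..<t}"
    using d t by (intro eventually_at_left_real) auto
  ultimately show "\<forall>\<^sub>F s in at_left t. dist (?g s) (?g t) < e"
    by (auto elim!: eventually_mono)
qed

lemma regular_path_two_sided:
  assumes f: "cadlag_on {0..} f" and h: "cadlag_on {0..} h"
  shows "regular_path (\<lambda>t. if 0 \<le> t then f t else - Lim (at_left (- t)) h)"
    (is "regular_path ?y")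
  unfolding regular_path_def
proof (intro conjI allI)
  fix u :: real
  show "continuous (at_right u) ?y"
  proof (cases "0 \<le> u")
    case True
    have "\<forall>\<^sub>F v in at_right u. f v = ?y v"
      using eventually_at_right_less[of u] by eventually_elim (use True in auto)
    with cadlag_right_limit[OF f True] have "(?y \<longlongrightarrow> f u) (at_right u)"
      by (rule Lim_transform_eventually)
    then show ?thesis using True by (simp add: continuous_within)
  next
    case False
    have "((\<lambda>v. - Lim (at_left (- v)) h) \<longlongrightarrow> - Lim (at_left (- u)) h) (at_right u)"
      using tendsto_at_left_Lim[OF h, of "- u"] False
      by (intro tendsto_minus) (simp add: filterlim_at_left_to_right[of _ _ "- u"])
    moreover have "\<forall>\<^sub>F v in at_right u. - Lim (at_left (- v)) h = ?y v"
      using eventually_at_right_real[of u 0] False by (auto elim!: eventually_mono)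
    ultimately have "(?y \<longlongrightarrow> - Lim (at_left (- u)) h) (at_right u)"
      by (rule Lim_transform_eventually)
    then show ?thesis using False by (simp add: continuous_within)
  qed
next
  fix a b :: real
  obtain B where "\<forall>x\<in>f ` {0..b}. norm x \<le> B"
    using cadlag_bounded[OF f, of b] unfolding bounded_iff by blast
  then have B: "\<bar>f s\<bar> \<le> B" if "s \<in> {0..b}" for s
    using that by auto
  obtain C where "\<forall>x\<in>h ` {0..- a}. norm x \<le> C"
    using cadlag_bounded[OF h, of "- a"] unfolding bounded_iff by blast
  then have C: "\<bar>h s\<bar> \<le> C" if "s \<in> {0..- a}" for s
    using that by auto
  have left: "\<bar>Lim (at_left s) h\<bar> \<le> C" if s: "0 < s" "s \<le> - a" for s
  proof (rule tendsto_upperbound)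
    show "((\<lambda>r. \<bar>h r\<bar>) \<longlongrightarrow> \<bar>Lim (at_left s) h\<bar>) (at_left s)"
      by (intro tendsto_rabs cadlag_left_limit[OF h s(1)])
    show "\<forall>\<^sub>F r in at_left s. \<bar>h r\<bar> \<le> C"
      using eventually_at_left_real[OF s(1)] by eventually_elim (use s in \<open>auto intro!: C\<close>)
  qed simp
  have bnd: "\<bar>?y t\<bar> \<le> max B C" if "t \<in> {a..b}" for t
  proof (cases "0 \<le> t")
    case True
    then show ?thesis using B[of t] that by auto
  next
    case False
    then show ?thesis using left[of "- t"] that by auto
  qed
  show "bounded (?y ` {a..b})"
  proof (rule boundedI)
    fix x assume "x \<in> ?y ` {a..b}"
    then obtain t where "t \<in> {a..b}" "x = ?y t" by blast
    with bnd[of t] show "norm x \<le> max B C" by simp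
  qed
qed

text \<open>Freezing the path at its initial value extends it to negative times, as
  \<open>regular_path\<close> speaks of the whole line.\<close>

lemma regular_path_cadlag:
  assumes "cadlag_on {0..} f"
  shows "regular_path (\<lambda>t. f (max 0 t))"
  unfolding regular_path_def
proof (intro conjI allI)
  fix u :: real
  show "continuous (at_right u) (\<lambda>t. f (max 0 t))"
  proof (cases "0 \<le> u")
    case True
    have "\<forall>\<^sub>F v in at_right u. f v = f (max 0 v)"
      using eventually_at_right_less[of u] by eventually_elim (use True in auto)
    with cadlag_right_limit[OF assms True] have "((\<lambda>t. f (max 0 t)) \<longlongrightarrow> f u) (at_right u)"
      by (rule Lim_transform_eventually)
    then show ?thesis using True by (simp add: continuous_within)
  next
    case False
    have "\<forall>\<^sub>F v in at_right u. f 0 = f (max 0 v)"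
      using eventually_at_right_real[of u 0] False by (auto elim!: eventually_mono)
    with tendsto_const have "((\<lambda>t. f (max 0 t)) \<longlongrightarrow> f 0) (at_right u)"
      by (rule Lim_transform_eventually)
    then show ?thesis using False by (simp add: continuous_within)
  qed
next
  fix a b :: real
  have "(\<lambda>t. f (max 0 t)) ` {a..b} \<subseteq> f ` {0..max 0 b}" by auto
  then show "bounded ((\<lambda>t. f (max 0 t)) ` {a..b})"
    by (rule bounded_subset[OF cadlag_bounded[OF assms]])
qed

lemma regular_path_compose:
  assumes z: "regular_path z" and g: "mono g" "continuous_on UNIV g"
  shows "regular_path (\<lambda>u. z (g u))"
  unfolding regular_path_def
proof (intro conjI allI)
  fix u :: real
  show "continuous (at_right u) (\<lambda>u. z (g u))"
    unfolding continuous_within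
  proof (rule tendsto_at_right_sequentially[of u "u + 1"])
    fix S :: "nat \<Rightarrow> real" assume S: "\<And>n. u < S n" "S \<longlonglongrightarrow> u"
    show "(\<lambda>n. z (g (S n))) \<longlonglongrightarrow> z (g u)"
    proof (rule regular_path_tendsto[OF z])
      show "(\<lambda>n. g (S n)) \<longlonglongrightarrow> g u"
        using S g(2) by (intro continuous_on_tendsto_compose[OF g(2)]) auto
      show "g u \<le> g (S n)" for n
        using g(1) S(1)[of n] by (auto simp: mono_def)
    qed
  qed simp
next
  fix a b
  have "(\<lambda>u. z (g u)) ` {a..b} \<subseteq> z ` {g a..g b}"
    using g(1) by (auto simp: mono_def)
  then show "bounded ((\<lambda>u. z (g u)) ` {a..b})"
    using z unfolding regular_path_def by (meson bounded_subset)
qed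

section \<open>L\'evy processes\<close>

lemma additive_process_AE:
  assumes "additive_process M X"
  shows "AE \<omega> in M. cadlag_on {0..} (\<lambda>t. X t \<omega>)" "AE \<omega> in M. X 0 \<omega> = 0"
  using assms by (auto simp: additive_process_def)

lemma levy_process_additive: "levy_process N L \<Longrightarrow> additive_process N L"
  by (simp add: levy_process_def)

lemma levy_char_diff:
  assumes L: "levy_process N L" and st: "0 \<le> s" "s \<le> t"
  shows "(CLINT \<omega>|N. iexp (\<theta> * (L t \<omega> - L s \<omega>))) = (CLINT \<omega>|N. iexp (\<theta> * L (t - s) \<omega>))"
proof -
  note m [measurable] = additive_process_measurable[OF levy_process_additive[OF L]]
  have [measurable]: "L t \<in> borel_measurable N" "L s \<in> borel_measurable N" "L (t - s) \<in> borel_measurable N"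
    using st by (auto intro!: m)
  have "char (distr N borel (\<lambda>\<omega>. L t \<omega> - L s \<omega>)) \<theta> = char (distr N borel (L (t - s))) \<theta>"
    using L st by (simp add: levy_process_def)
  then show ?thesis by (simp add: char_def integral_distr)
qed

lemma levy_char_rational:
  assumes L: "levy_process N L" and n: "n > 0"
  shows "(CLINT \<omega>|N. iexp (\<theta> * L (real m / real n) \<omega>)) = (CLINT \<omega>|N. iexp (\<theta> * L (1 / real n) \<omega>)) ^ m"
proof -
  note A = levy_process_additive[OF L]
  define t where "t i = real i / real n" for i
  have t: "t (Suc i) - t i = 1 / real n" "t i \<le> t (Suc i)" "0 \<le> t i" "t i < t (Suc i)" for i
    using n by (auto simp: t_def field_simps)
  have [measurable]: "L (t i) \<in> borel_measurable N" for i
    using t by (intro additive_process_measurable[OF A])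
  have "(CLINT \<omega>|N. iexp (\<theta> * L (t m) \<omega>)) = (CLINT \<omega>|N. iexp (\<Sum>i<m. \<theta> * (L (t (Suc i)) \<omega> - L (t i) \<omega>)))"
  proof (rule integral_cong_AE)
    show "AE \<omega> in N. iexp (\<theta> * L (t m) \<omega>) = iexp (\<Sum>i<m. \<theta> * (L (t (Suc i)) \<omega> - L (t i) \<omega>))"
      using additive_process_AE(2)[OF A]
    proof eventually_elim
      case (elim \<omega>)
      have "(\<Sum>i<m. \<theta> * (L (t (Suc i)) \<omega> - L (t i) \<omega>)) = \<theta> * (L (t m) \<omega> - L (t 0) \<omega>)"
        unfolding sum_distrib_left[symmetric] by (simp only: sum_lessThan_telescope[of "\<lambda>i. L (t i) \<omega>"])
      then show ?case using elim by (simp add: t_def)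
    qed
  qed measurable
  also have "\<dots> = (\<Prod>i<m. CLINT \<omega>|N. iexp (\<theta> * (L (t (Suc i)) \<omega> - L (t i) \<omega>)))"
    using t by (intro additive_char_nat[OF A]) auto
  also have "\<dots> = (\<Prod>i<m. CLINT \<omega>|N. iexp (\<theta> * L (1 / real n) \<omega>))"
    using t by (intro prod.cong refl) (subst levy_char_diff[OF L], auto)
  finally show ?thesis by (simp add: t_def)
qed

text \<open>At time \<open>1 / n\<close> the characteristic function is some \<open>n\<close>-th
  root of that at time 1; continuity singles out the branch whose logarithm is
  \<open>\<psi> / n\<close>. Powers give all rational times, and right continuity of the paths along
  rounded-up times gives the rest.\<close>

lemma levy_char:
  assumes L: "levy_process N L"
    and \<psi>: "continuous_on UNIV \<psi>" "\<psi> 0 = 0" "\<And>\<theta>. (CLINT \<omega>|N. iexp (\<theta> * L 1 \<omega>)) = exp (\<psi> \<theta>)"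
    and t: "0 \<le> t"
  shows "(CLINT \<omega>|N. iexp (\<theta> * L t \<omega>)) = exp (of_real t * \<psi> \<theta>)"
proof -
  note A = levy_process_additive[OF L]
  interpret prob_space N using additive_process_prob_space[OF A] .
  note m = additive_process_measurable[OF A]
  have frac: "(CLINT \<omega>|N. iexp (\<theta> * L (real k / real n) \<omega>)) = exp (of_real (real k / real n) * \<psi> \<theta>)"
    if n: "n > 0" for k n
  proof -
    have [measurable]: "L (1 / real n) \<in> borel_measurable N" using n by (intro m) auto
    interpret D: real_distribution "distr N borel (L (1 / real n))"
      by (intro real_distribution_distr) auto
    define f where "f \<theta> = (CLINT \<omega>|N. iexp (\<theta> * L (1 / real n) \<omega>))" for \<theta>
    have f: "f = char (distr N borel (L (1 / real n)))"
      by (simp add: f_def[abs_def] char_def[abs_def] integral_distr)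
    have pow: "f \<theta> ^ n = exp (\<psi> \<theta>)" for \<theta>
      using levy_char_rational[OF L n, of \<theta> n] n \<psi>(3)[of \<theta>] by (simp add: f_def)
    have "f \<theta> \<noteq> 0" for \<theta>
      using pow[of \<theta>] n by (auto simp: zero_power)
    moreover have "continuous_on UNIV f"
      unfolding f by (intro continuous_at_imp_continuous_on ballI D.isCont_char)
    moreover have "f 0 = 1" by (simp add: f D.char_zero)
    ultimately obtain g where g: "continuous_on UNIV g" "g 0 = 0" "\<And>\<theta>. f \<theta> = exp (g \<theta>)"
      using continuous_log_exists[of f] by blast
    have "of_nat n * g \<theta> = \<psi> \<theta>"
    proof (rule continuous_log_unique[where S=UNIV and a=0 and f="\<lambda>\<theta>. of_nat n * g \<theta>" and g=\<psi> and x=\<theta>])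
      show "exp (of_nat n * g x) = exp (\<psi> x)" for x
        using pow[of x] by (simp add: g(3) exp_of_nat_mult)
    qed (use g \<psi> in \<open>auto intro!: continuous_intros\<close>)
    then have "of_nat k * g \<theta> = of_real (real k / real n) * \<psi> \<theta>"
      using n by (auto simp: field_simps)
    moreover have "(CLINT \<omega>|N. iexp (\<theta> * L (real k / real n) \<omega>)) = f \<theta> ^ k"
      unfolding f_def by (rule levy_char_rational[OF L n])
    moreover have "f \<theta> ^ k = exp (of_nat k * g \<theta>)"
      by (simp only: g(3) exp_of_nat_mult)
    ultimately show ?thesis by (simp only:)
  qed
  have eq: "(CLINT \<omega>|N. iexp (\<theta> * L (grid n t) \<omega>)) = exp (of_real (grid n t) * \<psi> \<theta>)" for n
  proof -
    have "0 \<le> t * real (Suc n)" using t by simp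
    then have "real_of_int \<lceil>t * real (Suc n)\<rceil> = real (nat \<lceil>t * real (Suc n)\<rceil>)"
      by (simp del: of_nat_Suc)
    then have "grid n t = real (nat \<lceil>t * real (Suc n)\<rceil>) / real (Suc n)"
      by (simp only: grid_def)
    then show ?thesis using frac[of "Suc n"] by simp
  qed
  have nonneg: "0 \<le> grid n t" for n using grid_bounds(1)[of t n] t by simp
  have [measurable]: "L t \<in> borel_measurable N" "L (grid n t) \<in> borel_measurable N" for n
    using t nonneg by (auto intro!: m)
  have "(\<lambda>n. CLINT \<omega>|N. iexp (\<theta> * L (grid n t) \<omega>)) \<longlonglongrightarrow> (CLINT \<omega>|completion N. iexp (\<theta> * L t \<omega>))"
  proof (rule tendsto_iexp_integral)
    show "AE \<omega> in N. (\<lambda>n. \<theta> * L (grid n t) \<omega>) \<longlonglongrightarrow> \<theta> * L t \<omega>"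
      using additive_process_AE(1)[OF A]
    proof eventually_elim
      case (elim \<omega>)
      from regular_path_grid[OF regular_path_cadlag[OF elim], of t]
      show ?case using nonneg t by (intro tendsto_intros) (simp add: max_def)
    qed
  qed (auto intro: prob_space_axioms)
  moreover have "(\<lambda>n. exp (of_real (grid n t) * \<psi> \<theta>)) \<longlonglongrightarrow> exp (of_real t * \<psi> \<theta>)"
    by (intro tendsto_intros tendsto_grid)
  ultimately show ?thesis
    unfolding eq by (simp add: integral_completion LIMSEQ_unique)
qed

text \<open>By continuity of the exponent in time, the jump at \<open>t\<close> has characteristic function 1.\<close>

lemma levy_no_fixed_jump:
  assumes L: "levy_process N L"
    and \<psi>: "continuous_on UNIV \<psi>" "\<psi> 0 = 0" "\<And>\<theta>. (CLINT \<omega>|N. iexp (\<theta> * L 1 \<omega>)) = exp (\<psi> \<theta>)"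
    and t: "0 < t"
  shows "AE \<omega> in N. Lim (at_left t) (\<lambda>s. L s \<omega>) = L t \<omega>"
proof -
  note A = levy_process_additive[OF L]
  interpret prob_space N using additive_process_prob_space[OF A] .
  interpret C: prob_space "completion N" by (rule prob_space_completion)
  \<comment> \<open>Starting at 0, these times increase to \<open>t\<close> without reaching it, so
    the path values converge to the left limit.\<close>
  define s where "s n = t - t / real (Suc n)" for n
  have s: "0 \<le> s n" "s n < t" for n
    using t by (auto simp: s_def field_simps)
  have "(\<lambda>n. t - t * inverse (real (Suc n))) \<longlonglongrightarrow> t - t * 0"
    by (intro tendsto_intros LIMSEQ_inverse_real_of_nat)
  then have slim: "s \<longlonglongrightarrow> t"
    by (simp add: s_def[abs_def] divide_inverse)
  have sleft: "filterlim s (at_left t) sequentially"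
    using s slim by (auto simp: filterlim_at intro!: always_eventually)
  have m [measurable]: "L t \<in> borel_measurable N" "L (s n) \<in> borel_measurable N" for n
    using t s by (auto intro!: additive_process_measurable[OF A])
  define J where "J \<omega> = L t \<omega> - Lim (at_left t) (\<lambda>s. L s \<omega>)" for \<omega>
  have lim: "AE \<omega> in N. (\<lambda>n. L t \<omega> - L (s n) \<omega>) \<longlonglongrightarrow> J \<omega>"
    using additive_process_AE(1)[OF A]
  proof eventually_elim
    case (elim \<omega>)
    show ?case
      unfolding J_def
      by (intro tendsto_diff tendsto_const filterlim_compose[OF cadlag_left_limit[OF elim t] sleft])
  qed
  have J [measurable]: "J \<in> borel_measurable (completion N)"
    using lim by (rule borel_measurable_completion_AE_LIMSEQ[rotated]) simp
  have one: "(CLINT \<omega>|completion N. iexp (\<theta> * J \<omega>)) = 1" for \<theta>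
  proof -
    have "(\<lambda>n. CLINT \<omega>|N. iexp (\<theta> * (L t \<omega> - L (s n) \<omega>))) \<longlonglongrightarrow> (CLINT \<omega>|completion N. iexp (\<theta> * J \<omega>))"
    proof (rule tendsto_iexp_integral)
      show "AE \<omega> in N. (\<lambda>n. \<theta> * (L t \<omega> - L (s n) \<omega>)) \<longlonglongrightarrow> \<theta> * J \<omega>"
        using lim by eventually_elim (intro tendsto_intros)
    qed (auto intro: prob_space_axioms)
    moreover have "(CLINT \<omega>|N. iexp (\<theta> * (L t \<omega> - L (s n) \<omega>))) = exp (of_real (t - s n) * \<psi> \<theta>)" for n
      using s[of n] levy_char_diff[OF L, of "s n" t \<theta>] levy_char[OF L \<psi>, of "t - s n" \<theta>] by simp
    moreover have "(\<lambda>n. exp (of_real (t - s n) * \<psi> \<theta>)) \<longlonglongrightarrow> exp (of_real (t - t) * \<psi> \<theta>)"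
      by (intro tendsto_intros slim)
    ultimately show ?thesis by (simp add: LIMSEQ_unique)
  qed
  have "distr (completion N) borel J = return borel 0"
  proof (rule Levy_uniqueness)
    show "real_distribution (distr (completion N) borel J)"
      by (intro C.real_distribution_distr J)
    show "real_distribution (return borel (0::real))"
      by (auto simp: real_distribution_def real_distribution_axioms_def intro!: prob_space_return)
    show "char (distr (completion N) borel J) = char (return borel 0)"
      using one by (auto simp: char_def fun_eq_iff integral_distr integral_return)
  qed
  moreover have "AE x in return borel (0::real). x = 0"
    by (subst AE_return) auto
  ultimately have "AE x in distr (completion N) borel J. x = 0" by (simp only:)
  then have "AE \<omega> in completion N. J \<omega> = 0"
    by (subst (asm) AE_distr_iff) auto
  then have "AE \<omega> in N. J \<omega> = 0"
    by (simp add: AE_completion_iff)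
  then show ?thesis by eventually_elim (simp add: J_def)
qed

section \<open>The time-changed two-sided process\<close>

lemma time_change_0 [simp]: "time_change \<delta> 0 = 0"
  by (simp add: time_change_def)

lemma time_change_1 [simp]: "time_change \<delta> 1 = 1"
  by (simp add: time_change_def)

lemma time_change_add: "time_change \<delta> (u + h) - time_change \<delta> u = exp (\<delta> * u) * time_change \<delta> h"
  by (simp add: time_change_def distrib_left exp_add diff_divide_distrib[symmetric] right_diff_distrib)

lemma time_change_pos: "h > 0 \<Longrightarrow> time_change \<delta> h > 0"
  by (cases \<delta> "0 :: real" rule: linorder_cases)
     (auto simp: time_change_def mult_neg_pos divide_neg_neg)

lemma strict_mono_time_change: "strict_mono (time_change \<delta>)"
proof (rule strict_monoI)
  fix u v :: real assume "u < v"
  then have "0 < exp (\<delta> * u) * time_change \<delta> (v - u)"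
    by (intro mult_pos_pos time_change_pos) auto
  then show "time_change \<delta> u < time_change \<delta> v"
    using time_change_add[of \<delta> u "v - u"] by simp
qed

lemma continuous_on_time_change: "continuous_on S (time_change \<delta>)"
  by (cases "\<delta> = 0") (auto simp: time_change_def[abs_def] intro!: continuous_intros)

text \<open>An everywhere measurable version of the two-sided process, without left limits.\<close>

definition two_sided_version :: "(real \<Rightarrow> 'a \<Rightarrow> real) \<Rightarrow> (real \<Rightarrow> 'a \<Rightarrow> real) \<Rightarrow> real \<Rightarrow> 'a \<Rightarrow> real" where
  "two_sided_version L1 L2 t \<omega> = (if 0 \<le> t then L1 t \<omega> - L1 0 \<omega> else - (L2 (- t) \<omega> - L2 0 \<omega>))"

lemma two_sided_version_measurable:
  assumes "levy_process N L1" "levy_process N L2"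
  shows "two_sided_version L1 L2 t \<in> borel_measurable N"
proof -
  have "L1 s \<in> borel_measurable N" "L2 s \<in> borel_measurable N" if "0 \<le> s" for s
    using that assms by (auto intro!: additive_process_measurable levy_process_additive)
  then show ?thesis
    unfolding two_sided_version_def[abs_def] by (cases "0 \<le> t") auto
qed

lemma two_sided_version_AE:
  assumes L1: "levy_process N L1" and L2: "levy_process N L2"
    and \<psi>: "continuous_on UNIV \<psi>" "\<psi> 0 = 0" "\<And>\<theta>. (CLINT \<omega>|N. iexp (\<theta> * L2 1 \<omega>)) = exp (\<psi> \<theta>)"
  shows "AE \<omega> in N. two_sided L1 L2 t \<omega> = two_sided_version L1 L2 t \<omega>"
proof (cases "0 \<le> t")
  case True
  show ?thesis
    using additive_process_AE(2)[OF levy_process_additive[OF L1]]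
    by eventually_elim (use True in \<open>simp add: two_sided_def two_sided_version_def\<close>)
next
  case False
  then have "AE \<omega> in N. Lim (at_left (- t)) (\<lambda>s. L2 s \<omega>) = L2 (- t) \<omega>"
    by (intro levy_no_fixed_jump[OF L2 \<psi>]) auto
  with additive_process_AE(2)[OF levy_process_additive[OF L2]] show ?thesis
    by eventually_elim (use False in \<open>simp add: two_sided_def two_sided_version_def\<close>)
qed

lemma two_sided_regular_AE:
  assumes L1: "levy_process N L1" and L2: "levy_process N L2"
  shows "AE \<omega> in N. regular_path (\<lambda>t. two_sided L1 L2 t \<omega>)"
  using additive_process_AE(1)[OF levy_process_additive[OF L1]]
    additive_process_AE(1)[OF levy_process_additive[OF L2]]
proof eventually_elim
  case (elim \<omega>)
  from regular_path_two_sided[OF elim] show ?case by (simp add: two_sided_def)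
qed

lemma levy_char_increments:
  fixes s :: "int \<Rightarrow> real"
  assumes L: "levy_process N L"
    and \<psi>: "continuous_on UNIV \<psi>" "\<psi> 0 = 0" "\<And>\<theta>. (CLINT \<omega>|N. iexp (\<theta> * L 1 \<omega>)) = exp (\<psi> \<theta>)"
    and q: "0 \<le> q" and s: "strict_mono s" "s 0 = 0"
  shows "(CLINT \<omega>|N. iexp (\<Sum>i=0..<q. c i * (L (s (i + 1)) \<omega> - L (s i) \<omega>)))
       = exp (\<Sum>i=0..<q. of_real (s (i + 1) - s i) * \<psi> (c i))"
proof -
  note A = levy_process_additive[OF L]
  have s': "0 \<le> s i" "s i < s (i + 1)" if "0 \<le> i" for i
    using that s(2) strict_mono_less_eq[OF s(1), of 0 i] strict_mono_less[OF s(1), of i "i + 1"] by auto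
  have "(CLINT \<omega>|N. iexp (\<Sum>i=0..<q. c i * (L (s (i + 1)) \<omega> - L (s i) \<omega>)))
      = (\<Prod>i=0..<q. CLINT \<omega>|N. iexp (c i * (L (s (i + 1)) \<omega> - L (s i) \<omega>)))"
    by (rule additive_char_increments[OF A q]) (use s' in auto)
  also have "\<dots> = (\<Prod>i=0..<q. exp (of_real (s (i + 1) - s i) * \<psi> (c i)))"
  proof (rule prod.cong[OF refl])
    fix i assume "i \<in> {0..<q}"
    then have "0 \<le> s i" "s i \<le> s (i + 1)" using s'[of i] by auto
    then show "(CLINT \<omega>|N. iexp (c i * (L (s (i + 1)) \<omega> - L (s i) \<omega>))) = exp (of_real (s (i + 1) - s i) * \<psi> (c i))"
      using levy_char[OF L \<psi>, of "s (i + 1) - s i" "c i"] by (subst levy_char_diff[OF L]) auto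
  qed
  finally show ?thesis by (simp add: exp_sum)
qed

text \<open>Since \<open>s 0 = 0\<close>, no cell straddles the junction at 0. The cells to its
  right are increments of \<open>L1\<close>; those to its left become forward increments of
  \<open>L2\<close> after time reversal, the two minus signs cancelling. Independence of
  \<open>L1\<close> and \<open>L2\<close> joins the two halves.\<close>

lemma two_sided_char_increments:
  fixes s :: "int \<Rightarrow> real"
  assumes L1: "levy_process N L1" and L2: "levy_process N L2"
    and indep: "prob_space.indep_var N
          (\<Pi>\<^sub>M t\<in>{0..}. borel) (\<lambda>\<omega>. \<lambda>t\<in>{0..}. L1 t \<omega>)
          (\<Pi>\<^sub>M t\<in>{0..}. borel) (\<lambda>\<omega>. \<lambda>t\<in>{0..}. L2 t \<omega>)"
    and \<psi>: "continuous_on UNIV \<psi>" "\<psi> 0 = 0"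
    and \<psi>1: "\<And>\<theta>. (CLINT \<omega>|N. iexp (\<theta> * L1 1 \<omega>)) = exp (\<psi> \<theta>)"
    and \<psi>2: "\<And>\<theta>. (CLINT \<omega>|N. iexp (\<theta> * L2 1 \<omega>)) = exp (\<psi> \<theta>)"
    and pq: "p \<le> 0" "0 \<le> q" and s: "strict_mono s" "s 0 = 0"
  shows "(CLINT \<omega>|N. iexp (\<Sum>i=p..<q. c i * (two_sided_version L1 L2 (s (i + 1)) \<omega> - two_sided_version L1 L2 (s i) \<omega>)))
       = exp (\<Sum>i=p..<q. of_real (s (i + 1) - s i) * \<psi> (c i))"
proof -
  interpret prob_space N using additive_process_prob_space[OF levy_process_additive[OF L1]] .
  let ?V = "two_sided_version L1 L2"
  have s_iff: "0 \<le> s i \<longleftrightarrow> 0 \<le> i" "s i \<le> 0 \<longleftrightarrow> i \<le> 0" for i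
    using s(2) strict_mono_less_eq[OF s(1), of 0 i] strict_mono_less_eq[OF s(1), of i 0] by auto
  define u where "u f = (\<Sum>i=0..<q. c i * (f (s (i + 1)) - f (s i)))" for f
  \<comment> \<open>The reflected grid, running forward in time for \<open>L2\<close>: the cell from
    \<open>- j - 1\<close> to \<open>- j\<close> becomes the cell from \<open>j\<close> to
    \<open>j + 1\<close>.\<close>
  define r where "r j = - s (- j)" for j
  define v where "v f = (\<Sum>j=0..<-p. c (- j - 1) * (f (r (j + 1)) - f (r j)))" for f
  have r: "strict_mono r" "r 0 = 0"
    using s by (auto simp: strict_mono_def r_def)
  have r_nonneg: "0 \<le> r j" if "0 \<le> j" for j
    using that s_iff(2)[of "- j"] by (simp add: r_def)
  have split: "(\<Sum>i=p..<q. g i) = (\<Sum>j=0..<-p. g (- j - 1)) + (\<Sum>i=0..<q. g i)" for g :: "int \<Rightarrow> 'z::comm_monoid_add"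
  proof -
    have "{p..<q} = {p..<0} \<union> {0..<q}" using pq by auto
    then have "(\<Sum>i=p..<q. g i) = (\<Sum>i=p..<0. g i) + (\<Sum>i=0..<q. g i)"
      by (simp add: sum.union_disjoint)
    also have "(\<Sum>i=p..<0. g i) = (\<Sum>j=0..<-p. g (- j - 1))"
      by (rule sum.reindex_bij_witness[of _ "\<lambda>j. - j - 1" "\<lambda>i. - i - 1"]) auto
    finally show ?thesis .
  qed
  have V1: "?V (s (i + 1)) \<omega> - ?V (s i) \<omega> = L1 (s (i + 1)) \<omega> - L1 (s i) \<omega>" if "0 \<le> i" for i \<omega>
    using that s_iff(1)[of i] s_iff(1)[of "i + 1"] by (simp add: two_sided_version_def)
  have V2: "?V (s (- j - 1 + 1)) \<omega> - ?V (s (- j - 1)) \<omega> = L2 (r (j + 1)) \<omega> - L2 (r j) \<omega>" if "0 \<le> j" for j \<omega>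
  proof (cases "j = 0")
    case True
    \<comment> \<open>The cell ending at 0 has its right end in the \<open>L1\<close> branch; both
      branches vanish there because \<open>two_sided_version\<close> subtracts the initial
      values.\<close>
    have "\<not> 0 \<le> s (- 1)" using s_iff(1)[of "- 1"] by simp
    then show ?thesis using s(2) by (simp add: two_sided_version_def r_def True)
  next
    case False
    then have "\<not> 0 \<le> s (- j)" "\<not> 0 \<le> s (- j - 1)"
      using that s_iff(1)[of "- j"] s_iff(1)[of "- j - 1"] by auto
    then show ?thesis by (simp add: two_sided_version_def r_def)
  qed
  have eq: "(\<Sum>i=p..<q. c i * (?V (s (i + 1)) \<omega> - ?V (s i) \<omega>)) = v (\<lambda>t\<in>{0..}. L2 t \<omega>) + u (\<lambda>t\<in>{0..}. L1 t \<omega>)" for \<omega>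
  proof -
    have "(\<Sum>j=0..<-p. c (- j - 1) * (?V (s (- j - 1 + 1)) \<omega> - ?V (s (- j - 1)) \<omega>)) = v (\<lambda>t\<in>{0..}. L2 t \<omega>)"
      unfolding v_def by (intro sum.cong refl, subst V2) (use r_nonneg in auto)
    moreover have "(\<Sum>i=0..<q. c i * (?V (s (i + 1)) \<omega> - ?V (s i) \<omega>)) = u (\<lambda>t\<in>{0..}. L1 t \<omega>)"
      unfolding u_def by (intro sum.cong refl, subst V1) (use s_iff in auto)
    ultimately show ?thesis by (simp only: split)
  qed
  have um: "u \<in> borel_measurable (\<Pi>\<^sub>M t\<in>{0..}. borel)"
    unfolding u_def[abs_def]
    by (intro borel_measurable_sum borel_measurable_times borel_measurable_diff measurable_component_singleton)
       (use s_iff in auto)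
  have vm: "v \<in> borel_measurable (\<Pi>\<^sub>M t\<in>{0..}. borel)"
    unfolding v_def[abs_def]
    by (intro borel_measurable_sum borel_measurable_times borel_measurable_diff measurable_component_singleton)
       (use r_nonneg in auto)
  define U where "U = u \<circ> (\<lambda>\<omega>. \<lambda>t\<in>{0..}. L1 t \<omega>)"
  define W where "W = v \<circ> (\<lambda>\<omega>. \<lambda>t\<in>{0..}. L2 t \<omega>)"
  have ind: "indep_var borel U borel W"
    unfolding U_def W_def using indep um vm by (rule indep_var_compose)
  have [measurable]: "U \<in> borel_measurable N" "W \<in> borel_measurable N"
    using indep_var_rv1[OF ind] indep_var_rv2[OF ind] by auto
  have eq': "(\<Sum>i=p..<q. c i * (?V (s (i + 1)) \<omega> - ?V (s i) \<omega>)) = U \<omega> + W \<omega>" for \<omega>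
    unfolding eq by (simp add: U_def W_def)
  have "(CLINT \<omega>|N. iexp (\<Sum>i=p..<q. c i * (?V (s (i + 1)) \<omega> - ?V (s i) \<omega>))) = char (distr N borel (\<lambda>\<omega>. U \<omega> + W \<omega>)) 1"
    unfolding char_def eq' by (subst integral_distr) auto
  also have "\<dots> = char (distr N borel U) 1 * char (distr N borel W) 1"
    by (rule char_distr_add[OF ind])
  also have "char (distr N borel U) 1 = (CLINT \<omega>|N. iexp (\<Sum>i=0..<q. c i * (L1 (s (i + 1)) \<omega> - L1 (s i) \<omega>)))"
  proof -
    have "U \<omega> = (\<Sum>i=0..<q. c i * (L1 (s (i + 1)) \<omega> - L1 (s i) \<omega>))" for \<omega>
      unfolding U_def u_def o_def by (intro sum.cong refl) (use s_iff in auto)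
    then show ?thesis
      unfolding char_def by (subst integral_distr) auto
  qed
  also have "\<dots> = exp (\<Sum>i=0..<q. of_real (s (i + 1) - s i) * \<psi> (c i))"
    by (rule levy_char_increments[OF L1 \<psi> \<psi>1 pq(2) s])
  also have "char (distr N borel W) 1 = (CLINT \<omega>|N. iexp (\<Sum>j=0..<-p. c (- j - 1) * (L2 (r (j + 1)) \<omega> - L2 (r j) \<omega>)))"
  proof -
    have "W \<omega> = (\<Sum>j=0..<-p. c (- j - 1) * (L2 (r (j + 1)) \<omega> - L2 (r j) \<omega>))" for \<omega>
      unfolding W_def v_def o_def by (intro sum.cong refl) (use r_nonneg in auto)
    then show ?thesis
      unfolding char_def by (subst integral_distr) auto
  qed
  also have "\<dots> = exp (\<Sum>j=0..<-p. of_real (r (j + 1) - r j) * \<psi> (c (- j - 1)))"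
    by (rule levy_char_increments[OF L2 \<psi> \<psi>2 _ r]) (use pq in auto)
  also have "(\<Sum>j=0..<-p. of_real (r (j + 1) - r j) * \<psi> (c (- j - 1)))
      = (\<Sum>j=0..<-p. of_real (s (- j - 1 + 1) - s (- j - 1)) * \<psi> (c (- j - 1)))"
    by (intro sum.cong refl) (simp add: r_def)
  finally show ?thesis
    unfolding split[of "\<lambda>i. of_real (s (i + 1) - s i) * \<psi> (c i)"] by (simp only: exp_add mult.commute)
qed

section \<open>Dilatively stable additive processes\<close>

lemma node_0 [simp]: "node n 0 = 0"
  by (simp add: node_def)

lemma node_Suc: "node n (i + 1) = node n i + 1 / real (Suc n)"
  by (simp add: node_def add_divide_distrib)

lemma strict_mono_node: "strict_mono (node n)"
  by (auto simp: strict_mono_def node_def divide_strict_right_mono)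

lemma grid_eq_node: "grid n u = node n \<lceil>u * real (Suc n)\<rceil>"
  by (simp add: grid_def node_def)

lemma sum_int_telescope:
  fixes f :: "int \<Rightarrow> 'a::ab_group_add"
  assumes "p \<le> q"
  shows "(\<Sum>i=p..<q. f (i + 1) - f i) = f q - f p"
  using assms
proof (induction q rule: int_ge_induct)
  case (step q)
  then have "{p..<q + 1} = insert q {p..<q}" by auto
  then show ?case using step.IH by simp
qed simp

text \<open>Intervals with different end points may overlap. Recording for every cell which of them
  cover it turns a linear combination into one sum over disjoint cells, where independence of
  increments applies.\<close>

lemma sum_int_subintervals:
  fixes g :: "int \<Rightarrow> real"
  assumes "\<And>j. j < k \<Longrightarrow> p \<le> l j \<and> u j \<le> q"
  shows "(\<Sum>j<k. \<theta> j * (\<Sum>i=l j..<u j. g i))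
       = (\<Sum>i=p..<q. (\<Sum>j<k. \<theta> j * of_bool (l j \<le> i \<and> i < u j)) * g i)"
proof -
  have "(\<Sum>i=l j..<u j. g i) = (\<Sum>i=p..<q. of_bool (l j \<le> i \<and> i < u j) * g i)" if "j < k" for j
    using assms[OF that] by (intro sum.mono_neutral_cong_left) auto
  then have "(\<Sum>j<k. \<theta> j * (\<Sum>i=l j..<u j. g i))
      = (\<Sum>j<k. \<Sum>i=p..<q. \<theta> j * of_bool (l j \<le> i \<and> i < u j) * g i)"
    by (intro sum.cong refl) (simp only: lessThan_iff sum_distrib_left mult.assoc)
  also have "\<dots> = (\<Sum>i=p..<q. \<Sum>j<k. \<theta> j * of_bool (l j \<le> i \<and> i < u j) * g i)"
    by (rule sum.swap)
  finally show ?thesis by (simp add: sum_distrib_right)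
qed

text \<open>No measurability of \<open>f\<close> is assumed: a non-integrable integrand has integral
  0.\<close>

lemma (in prob_space) cmod_iexp_integral_le_1: "cmod (CLINT \<omega>|M. iexp (f \<omega>)) \<le> 1"
proof (cases "integrable M (\<lambda>\<omega>. iexp (f \<omega>))")
  case True
  have "cmod (CLINT \<omega>|M. iexp (f \<omega>)) \<le> (LINT \<omega>|M. cmod (iexp (f \<omega>)))"
    by (rule integral_norm_bound)
  then show ?thesis by (simp add: prob_space)
qed (simp add: not_integrable_integral_eq)

text \<open>Substitution of \<open>exp x\<close> in the pathwise integral. Paths may jump, so the
  change of variables is the one for absolutely integrable functions.\<close>

lemma random_integral_powr_exp:
  assumes z: "regular_path (\<lambda>u. f (exp u))"
  shows "random_integral (\<lambda>u. u powr c) f 1 (exp 1) = random_integral (\<lambda>u. exp (u * c)) (\<lambda>u. f (exp u)) 0 1"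
proof -
  define F where "F t = deriv (\<lambda>u. u powr c) t * f t" for t
  have F: "\<bar>exp x\<bar> * F (exp x) = c * exp (c * x) * f (exp x)" for x
  proof -
    have "deriv (\<lambda>u. u powr c) (exp x) = c * exp x powr (c - 1)"
      by (rule DERIV_imp_deriv) (rule has_real_derivative_powr, simp)
    also have "exp x powr (c - 1) = exp (c * x) / exp x"
      by (simp add: powr_def left_diff_distrib exp_diff)
    finally show ?thesis by (simp add: F_def)
  qed
  have range: "exp ` {0..1::real} = {1..exp 1}"
  proof
    show "{1..exp 1} \<subseteq> exp ` {0..1::real}"
    proof
      fix y :: real assume "y \<in> {1..exp 1}"
      then have "y = exp (ln y)" "ln y \<in> {0..1}"
        by (auto simp: ln_ge_zero_iff ln_le_cancel_iff[of y "exp 1", simplified])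
      then show "y \<in> exp ` {0..1}" by blast
    qed
  qed auto
  have "set_integrable lborel {0..1} (\<lambda>x. c * exp (c * x) * f (exp x))"
    using set_integrable_exp_regular[OF z] .
  then have "(\<lambda>x. c * exp (c * x) * f (exp x)) absolutely_integrable_on {0..1}"
    unfolding set_integrable_def
    by (subst integrable_completion) (auto intro: borel_measurable_integrable)
  then have abs: "(\<lambda>x. \<bar>exp x\<bar> * F (exp x)) absolutely_integrable_on {0..1}"
    by (simp only: F)
  have leb: "{0..1::real} \<in> sets lebesgue" by simp
  have der: "(exp has_field_derivative exp x) (at x within {0..1})" for x :: real
    by (auto intro!: derivative_eq_intros)
  have inj: "inj_on exp {0..1::real}"
    by (simp add: inj_on_def)
  note has_absolute_integral_change_of_variables_1'[OF leb der inj, THEN iffD1, OF conjI[OF abs refl], THEN conjunct2]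
  then have "integral {1..exp 1} F = integral {0..1} (\<lambda>x. c * exp (c * x) * f (exp x))"
    by (simp only: range F)
  then show ?thesis
    unfolding random_integral_exp unfolding random_integral_def F_def[symmetric]
    by (simp add: powr_def)
qed

section \<open>Exponents of the increments in logarithmic time\<close>

locale dilatively_stable_additive =
  fixes M :: "'a measure" and X :: "real \<Rightarrow> 'a \<Rightarrow> real" and \<alpha> \<delta> :: real
  assumes additive: "additive_process M X" and stable: "dilatively_stable M X \<alpha> \<delta>"
begin

sublocale prob_space M
  using additive by (rule additive_process_prob_space)

abbreviation \<beta> :: real where "\<beta> \<equiv> \<alpha> - \<delta> / 2"

text \<open>Logarithmic time turns dilations into translations and moves time 0 to minus
  infinity.\<close>

definition W :: "real \<Rightarrow> 'a \<Rightarrow> real" where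
  "W u = X (exp u)"

lemma infdiv_X: "infdiv_process M X"
  using stable by (simp add: dilatively_stable_def)

lemma W_measurable [measurable]: "W u \<in> borel_measurable M"
  unfolding W_def by (intro additive_process_measurable[OF additive]) simp

lemma W_regular_AE: "AE \<omega> in M. regular_path (\<lambda>u. W u \<omega>)"
  using additive_process_AE(1)[OF additive]
proof eventually_elim
  case (elim \<omega>)
  have "regular_path (\<lambda>u. X (max 0 (exp u)) \<omega>)"
    by (rule regular_path_compose[OF regular_path_cadlag[OF elim]]) (auto simp: mono_def intro!: continuous_intros)
  then show ?case by (simp add: W_def max_def)
qed

definition psi_approx :: "nat \<Rightarrow> real \<Rightarrow> complex" where
  "psi_approx n \<theta> = incr_exponent M X 1 (exp (1 / real (Suc n))) \<theta> / of_real (time_change \<delta> (1 / real (Suc n)))"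

lemma W_char_increment:
  "(CLINT \<omega>|M. iexp (\<theta> * (W (node n (i + 1)) \<omega> - W (node n i) \<omega>)))
   = exp (of_real (time_change \<delta> (node n (i + 1)) - time_change \<delta> (node n i)) * psi_approx n (exp (\<beta> * node n i) * \<theta>))"
proof -
  define h where "h = 1 / real (Suc n)"
  have h: "time_change \<delta> h > 0" by (intro time_change_pos) (simp add: h_def)
  \<comment> \<open>Dilating by \<open>T\<close> moves the first cell, from \<open>exp 0\<close> to
    \<open>exp h\<close>, onto the cell at node \<open>i\<close>.\<close>
  define T where "T = exp (node n i)"
  have T: "exp (node n (i + 1)) = T * exp h" "T powr \<delta> = exp (\<delta> * node n i)" "T powr \<beta> = exp (\<beta> * node n i)"
    by (simp_all add: T_def node_Suc h_def exp_add powr_def)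
  have "(CLINT \<omega>|M. iexp (\<theta> * (W (node n (i + 1)) \<omega> - W (node n i) \<omega>)))
      = exp (incr_exponent M X (T * 1) (T * exp h) \<theta>)"
    unfolding W_def T(1) using exp_incr_exponent[OF infdiv_X, of "T * 1" "T * exp h" \<theta>]
    by (simp add: T_def)
  also have "incr_exponent M X (T * 1) (T * exp h) \<theta>
      = of_real (exp (\<delta> * node n i)) * incr_exponent M X 1 (exp h) (exp (\<beta> * node n i) * \<theta>)"
    unfolding T(2,3)[symmetric] by (rule incr_exponent_scale[OF stable]) (simp_all add: T_def)
  also have "incr_exponent M X 1 (exp h) \<theta>' = of_real (time_change \<delta> h) * psi_approx n \<theta>'" for \<theta>'
    using h by (simp add: psi_approx_def h_def)
  finally show ?thesis
    unfolding node_Suc h_def[symmetric] time_change_add by (simp add: mult.assoc)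
qed

lemma W_char_increments:
  assumes pq: "p \<le> q"
  shows "(CLINT \<omega>|M. iexp (\<Sum>i=p..<q. c i * (W (node n (i + 1)) \<omega> - W (node n i) \<omega>)))
   = exp (\<Sum>i=p..<q. of_real (time_change \<delta> (node n (i + 1)) - time_change \<delta> (node n i)) * psi_approx n (exp (\<beta> * node n i) * c i))"
proof -
  have "(CLINT \<omega>|M. iexp (\<Sum>i=p..<q. c i * (W (node n (i + 1)) \<omega> - W (node n i) \<omega>)))
      = (\<Prod>i=p..<q. CLINT \<omega>|M. iexp (c i * (W (node n (i + 1)) \<omega> - W (node n i) \<omega>)))"
    unfolding W_def
    by (rule additive_char_increments[OF additive pq, of "\<lambda>i. exp (node n i)"])
       (auto intro: strict_monoD[OF strict_mono_node])
  then show ?thesis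
    by (simp only: W_char_increment exp_sum[OF finite_atLeastLessThan_int])
qed

lemma riemann_sum_W_measurable [measurable]: "(\<lambda>\<omega>. riemann_sum c (\<lambda>u. W u \<omega>) n a b) \<in> borel_measurable M"
  unfolding riemann_sum_def by measurable

text \<open>The weight \<open>exp (- \<beta> * node n i)\<close> undoes the scaling of the argument,
  so every cell contributes \<open>psi_approx n\<close> at the same \<theta> and the time-change
  increments telescope. The case \<open>b = 1\<close> is for \<open>Y\<close>; other values of
  \<open>b\<close> provide the roots of its law.\<close>

lemma riemann_sum_W_char:
  assumes b: "0 \<le> b"
  shows "(CLINT \<omega>|M. iexp (\<theta> * riemann_sum (- \<beta>) (\<lambda>u. W u \<omega>) n 0 b))
       = exp (of_real (time_change \<delta> (grid n b)) * psi_approx n \<theta>)"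
proof -
  define q where "q = \<lceil>b * real (Suc n)\<rceil>"
  have q: "0 \<le> q"
  proof -
    have "0 \<le> b * real (Suc n)" using b by simp
    then show ?thesis unfolding q_def by (metis ceiling_mono ceiling_zero)
  qed
  have cancel: "exp (\<beta> * x) * (\<theta> * exp (- \<beta> * x)) = \<theta>" for x
  proof -
    have "exp (c * x) * (\<theta> * exp (- c * x)) = \<theta>" for c
      by (simp add: exp_minus field_simps)
    then show ?thesis .
  qed
  have "\<theta> * riemann_sum (- \<beta>) (\<lambda>u. W u \<omega>) n 0 b
      = (\<Sum>i=0..<q. (\<theta> * exp (- \<beta> * node n i)) * (W (node n (i + 1)) \<omega> - W (node n i) \<omega>))" for \<omega>
    by (simp add: riemann_sum_def q_def sum_distrib_left mult.assoc del: of_nat_Suc)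
  then have "(CLINT \<omega>|M. iexp (\<theta> * riemann_sum (- \<beta>) (\<lambda>u. W u \<omega>) n 0 b))
      = exp (\<Sum>i=0..<q. of_real (time_change \<delta> (node n (i + 1)) - time_change \<delta> (node n i)) * psi_approx n \<theta>)"
    by (simp only: W_char_increments[OF q] cancel)
  also have "(\<Sum>i=0..<q. of_real (time_change \<delta> (node n (i + 1)) - time_change \<delta> (node n i)) * psi_approx n \<theta>)
      = of_real (\<Sum>i=0..<q. time_change \<delta> (node n (i + 1)) - time_change \<delta> (node n i)) * psi_approx n \<theta>"
    by (simp only: of_real_sum sum_distrib_right)
  also have "(\<Sum>i=0..<q. time_change \<delta> (node n (i + 1)) - time_change \<delta> (node n i)) = time_change \<delta> (grid n b)"
    using sum_int_telescope[OF q, of "\<lambda>i. time_change \<delta> (node n i)"] by (simp add: grid_eq_node q_def)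
  finally show ?thesis .
qed

lemma riemann_sum_W_AE:
  assumes "a \<le> b"
  shows "AE \<omega> in M. (\<lambda>n. riemann_sum c (\<lambda>u. W u \<omega>) n a b)
           \<longlonglongrightarrow> random_integral (\<lambda>u. exp (u * c)) (\<lambda>u. W u \<omega>) a b"
  using W_regular_AE by eventually_elim (rule riemann_sum_tendsto[OF _ assms])

definition Y :: "'a \<Rightarrow> real" where
  "Y \<omega> = random_integral (\<lambda>u. u powr (- \<alpha> + \<delta> / 2)) (\<lambda>u. X u \<omega>) 1 (exp 1)"

lemma riemann_sum_Y_AE: "AE \<omega> in M. (\<lambda>n. riemann_sum (- \<beta>) (\<lambda>u. W u \<omega>) n 0 1) \<longlonglongrightarrow> Y \<omega>"
  using W_regular_AE
proof eventually_elim
  case (elim \<omega>)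
  have "Y \<omega> = random_integral (\<lambda>u. exp (u * - \<beta>)) (\<lambda>u. W u \<omega>) 0 1"
    using random_integral_powr_exp[of "\<lambda>u. X u \<omega>" "- \<beta>"] elim by (simp add: Y_def W_def)
  with riemann_sum_tendsto[OF elim, of 0 1 "- \<beta>"] show ?case by simp
qed

lemma Y_measurable [measurable]: "Y \<in> borel_measurable (completion M)"
  by (rule borel_measurable_completion_AE_LIMSEQ[OF _ riemann_sum_Y_AE]) simp

text \<open>In logarithmic form the inequality of \<open>char_roots_double\<close> can be divided by
  the positive time-change length of a cell, which passes from a single increment to
  \<open>psi_approx n\<close>.\<close>

lemma psi_approx_double: "5 * Re (psi_approx n \<theta>) \<le> Re (psi_approx n (2 * \<theta>))"
proof -
  let ?h = "1 / real (Suc n)"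
  have h: "time_change \<delta> ?h > 0" by (intro time_change_pos) simp
  let ?e = "incr_exponent M X 1 (exp ?h)"
  have "cmod (exp (?e \<theta>)) ^ 5 \<le> cmod (exp (?e (2 * \<theta>)))"
    by (intro char_roots_double incr_char_roots[OF infdiv_X]) auto
  then have "exp (5 * Re (?e \<theta>)) \<le> exp (Re (?e (2 * \<theta>)))"
    using exp_of_nat_mult[of 5 "Re (?e \<theta>)"] by simp
  then have "5 * Re (?e \<theta>) \<le> Re (?e (2 * \<theta>))"
    by (simp only: exp_le_cancel_iff)
  then show ?thesis
    using h by (simp add: psi_approx_def divide_right_mono Re_divide_of_real)
qed

lemma continuous_psi_approx: "continuous_on UNIV (psi_approx n)"
proof -
  have "time_change \<delta> (1 / real (Suc n)) > 0" by (intro time_change_pos) simp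
  then show ?thesis
    unfolding psi_approx_def[abs_def]
    by (intro continuous_intros continuous_on_incr_exponent[OF infdiv_X]) auto
qed

lemma psi_approx_0: "psi_approx n 0 = 0"
  by (simp add: psi_approx_def incr_exponent_0[OF infdiv_X])

lemma riemann_sum_Y_char:
  "(CLINT \<omega>|M. iexp (\<theta> * riemann_sum (- \<beta>) (\<lambda>u. W u \<omega>) n 0 1)) = exp (psi_approx n \<theta>)"
proof -
  have "grid n 1 = 1" by (simp add: grid_def del: of_nat_Suc)
  then show ?thesis using riemann_sum_W_char[of 1 \<theta> n] by simp
qed

lemma uniform_limit_exp_psi_approx:
  "uniform_limit {-R..R} (\<lambda>n \<theta>. exp (psi_approx n \<theta>)) (\<lambda>\<theta>. CLINT \<omega>|completion M. iexp (\<theta> * Y \<omega>)) sequentially"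
  using uniform_limit_char[OF prob_space_axioms _ riemann_sum_Y_AE, of R]
  by (simp only: riemann_sum_Y_char) simp

lemma psi_exists:
  obtains \<psi> where "continuous_on UNIV \<psi>" "\<psi> 0 = 0"
    "\<And>\<theta>. (CLINT \<omega>|completion M. iexp (\<theta> * Y \<omega>)) = exp (\<psi> \<theta>)"
    "\<And>R. 0 \<le> R \<Longrightarrow> uniform_limit {-R..R} psi_approx \<psi> sequentially"
proof -
  interpret C: prob_space "completion M" by (rule prob_space_completion)
  interpret D: real_distribution "distr (completion M) borel Y"
    by (intro C.real_distribution_distr) simp
  define \<phi> where "\<phi> \<theta> = (CLINT \<omega>|completion M. iexp (\<theta> * Y \<omega>))" for \<theta>
  have \<phi>: "\<phi> = char (distr (completion M) borel Y)"
    by (simp add: \<phi>_def[abs_def] char_def[abs_def] integral_distr)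
  have cont: "continuous_on UNIV \<phi>"
    unfolding \<phi> by (intro continuous_at_imp_continuous_on ballI D.isCont_char)
  have lim: "(\<lambda>n. exp (psi_approx n \<theta>)) \<longlonglongrightarrow> \<phi> \<theta>" for \<theta>
    unfolding \<phi>_def by (rule tendsto_uniform_limitI[OF uniform_limit_exp_psi_approx[of "\<bar>\<theta>\<bar>"]]) (simp add: abs_if)
  \<comment> \<open>The modulus inequality holds for every
    \<open>exp (psi_approx n \<theta>)\<close> and survives the limit, so \<phi> has no zeros
    although nothing is known yet about its own roots.\<close>
  have nz: "\<phi> \<theta> \<noteq> 0" for \<theta>
  proof (rule nonzero_if_double)
    show "isCont \<phi> 0" unfolding \<phi> by (rule D.isCont_char)
    show "\<phi> 0 \<noteq> 0" unfolding \<phi> D.char_zero by simp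
    show "cmod (\<phi> \<theta>) ^ 5 \<le> cmod (\<phi> (2 * \<theta>))" for \<theta>
    proof (rule LIMSEQ_le)
      show "(\<lambda>n. cmod (exp (psi_approx n \<theta>)) ^ 5) \<longlonglongrightarrow> cmod (\<phi> \<theta>) ^ 5"
        by (intro tendsto_intros lim)
      show "(\<lambda>n. cmod (exp (psi_approx n (2 * \<theta>)))) \<longlonglongrightarrow> cmod (\<phi> (2 * \<theta>))"
        by (intro tendsto_intros lim)
      have "cmod (exp (psi_approx n \<theta>)) ^ 5 \<le> cmod (exp (psi_approx n (2 * \<theta>)))" for n
      proof -
        have "exp (Re (psi_approx n \<theta>)) ^ 5 = exp (5 * Re (psi_approx n \<theta>))"
          using exp_of_nat_mult[of 5 "Re (psi_approx n \<theta>)"] by simp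
        then show ?thesis
          by (simp only: norm_exp_eq_Re exp_le_cancel_iff psi_approx_double)
      qed
      then show "\<exists>N. \<forall>n\<ge>N. cmod (exp (psi_approx n \<theta>)) ^ 5 \<le> cmod (exp (psi_approx n (2 * \<theta>)))"
        by blast
    qed
  qed
  have "\<phi> 0 = 1" unfolding \<phi> by (rule D.char_zero)
  then obtain \<psi> where \<psi>: "continuous_on UNIV \<psi>" "\<psi> 0 = 0" "\<And>\<theta>. \<phi> \<theta> = exp (\<psi> \<theta>)"
    using continuous_log_exists[OF cont nz] by blast
  show ?thesis
  proof (rule that[OF \<psi>(1,2)])
    show "(CLINT \<omega>|completion M. iexp (\<theta> * Y \<omega>)) = exp (\<psi> \<theta>)" for \<theta>
      using \<psi>(3)[of \<theta>] by (simp only: \<phi>_def)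
    show "uniform_limit {-R..R} psi_approx \<psi> sequentially" if R: "0 \<le> R" for R
    proof (rule uniform_limit_log[OF continuous_psi_approx psi_approx_0 \<psi>(1,2) R])
      show "uniform_limit {-R..R} (\<lambda>n \<theta>. exp (psi_approx n \<theta>)) (\<lambda>\<theta>. exp (\<psi> \<theta>)) sequentially"
        using uniform_limit_exp_psi_approx[of R] by (simp only: \<phi>_def[symmetric] \<psi>(3))
    qed
  qed
qed

text \<open>The \<open>m\<close>-th root is found in the same family: the integral from 0 to
  \<open>b\<close> has exponent \<open>time_change \<delta> b\<close> times \<psi>, and
  \<open>b\<close> is chosen where the time change, which runs from 0 to 1, equals
  \<open>1 / m\<close>.\<close>

lemma infdiv_law_Y: "infdiv (law M Y)"
proof (rule infdivI_char)
  interpret C: prob_space "completion M" by (rule prob_space_completion)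
  show "real_distribution (law M Y)"
    unfolding law_def by (intro C.real_distribution_distr) simp
  obtain \<psi> where \<psi>: "\<And>\<theta>. (CLINT \<omega>|completion M. iexp (\<theta> * Y \<omega>)) = exp (\<psi> \<theta>)"
    "\<And>R. 0 \<le> R \<Longrightarrow> uniform_limit {-R..R} psi_approx \<psi> sequentially"
    using psi_exists by metis
  have lim: "(\<lambda>n. psi_approx n \<theta>) \<longlonglongrightarrow> \<psi> \<theta>" for \<theta>
    by (rule tendsto_uniform_limitI[OF \<psi>(2)[of "\<bar>\<theta>\<bar>"]]) (simp_all add: abs_if)
  fix m :: nat assume m: "m \<ge> 1"
  obtain b where b: "0 \<le> b" "b \<le> 1" "time_change \<delta> b = 1 / real m"
    using IVT'[of "time_change \<delta>" 0 "1 / real m" 1] m continuous_on_time_change by auto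
  define I where "I \<omega> = random_integral (\<lambda>u. exp (u * - \<beta>)) (\<lambda>u. W u \<omega>) 0 b" for \<omega>
  have lim_I: "AE \<omega> in M. (\<lambda>n. riemann_sum (- \<beta>) (\<lambda>u. W u \<omega>) n 0 b) \<longlonglongrightarrow> I \<omega>"
    unfolding I_def by (rule riemann_sum_W_AE[OF b(1)])
  have [measurable]: "I \<in> borel_measurable (completion M)"
    by (rule borel_measurable_completion_AE_LIMSEQ[OF _ lim_I]) simp
  have "(CLINT \<omega>|completion M. iexp (\<theta> * I \<omega>)) = exp (of_real (1 / real m) * \<psi> \<theta>)" for \<theta>
  proof (rule LIMSEQ_unique)
    show "(\<lambda>n. exp (of_real (time_change \<delta> (grid n b)) * psi_approx n \<theta>)) \<longlonglongrightarrow> (CLINT \<omega>|completion M. iexp (\<theta> * I \<omega>))"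
      unfolding riemann_sum_W_char[OF b(1), symmetric]
    proof (rule tendsto_iexp_integral[OF prob_space_axioms])
      show "AE \<omega> in M. (\<lambda>n. \<theta> * riemann_sum (- \<beta>) (\<lambda>u. W u \<omega>) n 0 b) \<longlonglongrightarrow> \<theta> * I \<omega>"
        using lim_I by eventually_elim (intro tendsto_intros)
    qed simp
    have "(\<lambda>n. time_change \<delta> (grid n b)) \<longlonglongrightarrow> time_change \<delta> b"
      by (rule continuous_on_tendsto_compose[OF continuous_on_time_change[of UNIV] tendsto_grid]) auto
    then show "(\<lambda>n. exp (of_real (time_change \<delta> (grid n b)) * psi_approx n \<theta>)) \<longlonglongrightarrow> exp (of_real (1 / real m) * \<psi> \<theta>)"
      unfolding b(3)[symmetric] by (intro tendsto_intros lim)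
  qed
  then have "char (law M Y) \<theta> = char (law M I) \<theta> ^ m" for \<theta>
    using m \<psi>(1)[of \<theta>] by (simp add: char_def law_def integral_distr exp_of_nat_mult[symmetric])
  moreover have "real_distribution (law M I)"
    unfolding law_def by (intro C.real_distribution_distr) simp
  ultimately show "\<exists>\<nu>. real_distribution \<nu> \<and> (\<forall>\<theta>. char (law M Y) \<theta> = char \<nu> \<theta> ^ m)"
    by blast
qed

end

section \<open>Laws of sequences and pathwise limits\<close>

text \<open>Almost sure limits of variables on a completion are measurable for a second completion;
  this leads back to the first.\<close>

lemma sets_completion_completion: "sets (completion (completion M)) = sets (completion M)"
proof
  show "sets (completion (completion M)) \<subseteq> sets (completion M)"
  proof
    fix A assume "A \<in> sets (completion (completion M))"
    then obtain S N N' where A: "A = S \<union> N" "N \<subseteq> N'" "N' \<in> null_sets (completion M)" "S \<in> sets (completion M)"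
      by (rule sets_completionE)
    then have "N \<in> sets (completion M)" by (metis completion.complete)
    with A show "A \<in> sets (completion M)" by simp
  qed
qed auto

lemma distr_borel_Rvec_eqI:
  fixes f :: "nat \<Rightarrow> 'a \<Rightarrow> real" and g :: "nat \<Rightarrow> 'b \<Rightarrow> real"
  assumes P: "prob_space P" and Q: "prob_space Q"
    and f: "\<And>j. j < k \<Longrightarrow> f j \<in> borel_measurable P" and g: "\<And>j. j < k \<Longrightarrow> g j \<in> borel_measurable Q"
    and eq: "\<And>\<theta>. (CLINT \<omega>|P. iexp (\<Sum>j<k. \<theta> j * f j \<omega>)) = (CLINT \<omega>|Q. iexp (\<Sum>j<k. \<theta> j * g j \<omega>))"
  shows "distr P (borel_Rvec k) (\<lambda>\<omega>. \<lambda>j\<in>{..<k}. f j \<omega>) = distr Q (borel_Rvec k) (\<lambda>\<omega>. \<lambda>j\<in>{..<k}. g j \<omega>)"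
proof (rule measure_eqI_borel_Rvec_iexp)
  have [measurable]: "(\<lambda>\<omega>. \<lambda>j\<in>{..<k}. f j \<omega>) \<in> P \<rightarrow>\<^sub>M borel_Rvec k" "(\<lambda>\<omega>. \<lambda>j\<in>{..<k}. g j \<omega>) \<in> Q \<rightarrow>\<^sub>M borel_Rvec k"
    by (intro measurable_restrict f g; simp)+
  have [measurable]: "(\<lambda>x. \<Sum>j<k. \<theta> j * x j) \<in> borel_measurable (borel_Rvec k)" for \<theta>
    by (intro borel_measurable_sum borel_measurable_times measurable_component_singleton) auto
  show "prob_space (distr P (borel_Rvec k) (\<lambda>\<omega>. \<lambda>j\<in>{..<k}. f j \<omega>))"
    by (intro prob_space.prob_space_distr[OF P]) simp
  show "prob_space (distr Q (borel_Rvec k) (\<lambda>\<omega>. \<lambda>j\<in>{..<k}. g j \<omega>))"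
    by (intro prob_space.prob_space_distr[OF Q]) simp
  fix \<theta>
  show "(CLINT x|distr P (borel_Rvec k) (\<lambda>\<omega>. \<lambda>j\<in>{..<k}. f j \<omega>). iexp (\<Sum>j<k. \<theta> j * x j))
      = (CLINT x|distr Q (borel_Rvec k) (\<lambda>\<omega>. \<lambda>j\<in>{..<k}. g j \<omega>). iexp (\<Sum>j<k. \<theta> j * x j))"
    using eq[of \<theta>] by (subst (1 2) integral_distr) auto
qed auto

text \<open>Convergence at minus infinity will be an event on a sequence of integrals, and the law
  of a sequence is determined by its initial segments.\<close>

lemma distr_PiM_nat_eqI:
  fixes f :: "nat \<Rightarrow> 'a \<Rightarrow> real" and g :: "nat \<Rightarrow> 'b \<Rightarrow> real"
  assumes P: "prob_space P" and Q: "prob_space Q"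
    and f: "\<And>j. f j \<in> borel_measurable P" and g: "\<And>j. g j \<in> borel_measurable Q"
    and eq: "\<And>k. distr P (borel_Rvec k) (\<lambda>\<omega>. \<lambda>j\<in>{..<k}. f j \<omega>) = distr Q (borel_Rvec k) (\<lambda>\<omega>. \<lambda>j\<in>{..<k}. g j \<omega>)"
  shows "distr P (\<Pi>\<^sub>M j\<in>UNIV. borel) (\<lambda>\<omega> j. f j \<omega>) = distr Q (\<Pi>\<^sub>M j\<in>UNIV. borel) (\<lambda>\<omega> j. g j \<omega>)"
proof (rule measure_eqI_PiM_infinite[where M="\<lambda>_. borel" and I=UNIV])
  have m: "(\<lambda>\<omega> j. f j \<omega>) \<in> P \<rightarrow>\<^sub>M (\<Pi>\<^sub>M j\<in>UNIV. borel)" "(\<lambda>\<omega> j. g j \<omega>) \<in> Q \<rightarrow>\<^sub>M (\<Pi>\<^sub>M j\<in>UNIV. borel)"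
    using measurable_restrict[of UNIV f P "\<lambda>_. borel"] measurable_restrict[of UNIV g Q "\<lambda>_. borel"] f g
    by (auto simp: restrict_UNIV)
  interpret D: prob_space "distr P (\<Pi>\<^sub>M j\<in>UNIV. borel) (\<lambda>\<omega> j. f j \<omega>)"
    by (rule prob_space.prob_space_distr[OF P m(1)])
  show "finite_measure (distr P (\<Pi>\<^sub>M j\<in>UNIV. borel) (\<lambda>\<omega> j. f j \<omega>))"
    by (rule D.finite_measure_axioms)
  fix A :: "nat \<Rightarrow> real set" and J :: "nat set"
  assume J: "finite J" and A: "\<And>i. i \<in> J \<Longrightarrow> A i \<in> sets borel"
  obtain k where k: "J \<subseteq> {..<k}" using J finite_nat_iff_bounded by blast
  \<comment> \<open>Padding with \<open>UNIV\<close> turns a cylinder over \<open>J\<close> into a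
    box over the initial segment \<open>{..<k}\<close>.\<close>
  define B where "B i = (if i \<in> J then A i else UNIV)" for i
  have B: "B i \<in> sets borel" for i using A by (simp add: B_def)
  have emb: "prod_emb UNIV (\<lambda>_. borel) J (Pi\<^sub>E J A) \<in> sets (\<Pi>\<^sub>M j\<in>UNIV. borel)"
    using J A by (intro sets_PiM_I) auto
  have box: "Pi\<^sub>E {..<k} B \<in> sets (borel_Rvec k)"
    using B by (intro sets_PiM_I_finite) auto
  have fk: "(\<lambda>\<omega>. \<lambda>j\<in>{..<k}. f j \<omega>) \<in> P \<rightarrow>\<^sub>M borel_Rvec k" "(\<lambda>\<omega>. \<lambda>j\<in>{..<k}. g j \<omega>) \<in> Q \<rightarrow>\<^sub>M borel_Rvec k"
    by (intro measurable_restrict f g)+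
  have pre: "(\<lambda>\<omega> j. h j \<omega>) -` prod_emb UNIV (\<lambda>_. borel) J (Pi\<^sub>E J A) \<inter> S
      = (\<lambda>\<omega>. \<lambda>j\<in>{..<k}. h j \<omega>) -` Pi\<^sub>E {..<k} B \<inter> S" for h :: "nat \<Rightarrow> 'z \<Rightarrow> real" and S
  proof -
    have "(\<forall>i\<in>{..<k}. h i x \<in> B i) \<longleftrightarrow> (\<forall>i\<in>J. h i x \<in> A i)" for x
    proof (intro iffI ballI)
      fix i assume *: "\<forall>i\<in>{..<k}. h i x \<in> B i" "i \<in> J"
      with k have "h i x \<in> B i" by blast
      with * show "h i x \<in> A i" by (simp add: B_def)
    qed (simp add: B_def)
    then show ?thesis
      by (auto simp: prod_emb_def PiE_iff space_PiM)
  qed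
  have "emeasure (distr P (\<Pi>\<^sub>M j\<in>UNIV. borel) (\<lambda>\<omega> j. f j \<omega>)) (prod_emb UNIV (\<lambda>_. borel) J (Pi\<^sub>E J A))
      = emeasure (distr P (borel_Rvec k) (\<lambda>\<omega>. \<lambda>j\<in>{..<k}. f j \<omega>)) (Pi\<^sub>E {..<k} B)"
    by (simp only: emeasure_distr[OF m(1) emb] emeasure_distr[OF fk(1) box] pre)
  also have "\<dots> = emeasure (distr Q (borel_Rvec k) (\<lambda>\<omega>. \<lambda>j\<in>{..<k}. g j \<omega>)) (Pi\<^sub>E {..<k} B)"
    by (simp only: eq)
  also have "\<dots> = emeasure (distr Q (\<Pi>\<^sub>M j\<in>UNIV. borel) (\<lambda>\<omega> j. g j \<omega>)) (prod_emb UNIV (\<lambda>_. borel) J (Pi\<^sub>E J A))"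
    by (simp only: emeasure_distr[OF m(2) emb] emeasure_distr[OF fk(2) box] pre)
  finally show "emeasure (distr P (\<Pi>\<^sub>M j\<in>UNIV. borel) (\<lambda>\<omega> j. f j \<omega>)) (prod_emb UNIV (\<lambda>_. borel) J (Pi\<^sub>E J A))
      = emeasure (distr Q (\<Pi>\<^sub>M j\<in>UNIV. borel) (\<lambda>\<omega> j. g j \<omega>)) (prod_emb UNIV (\<lambda>_. borel) J (Pi\<^sub>E J A))" .
qed auto

section \<open>Pathwise integrals towards minus infinity\<close>

lemma random_integral_same [simp]: "random_integral A z a a = 0"
  by (simp add: random_integral_def)

lemma random_integral_split:
  assumes z: "regular_path z" and "a \<le> b" "b \<le> d"
  shows "random_integral (\<lambda>u. exp (u * c)) z a d
     = random_integral (\<lambda>u. exp (u * c)) z a b + random_integral (\<lambda>u. exp (u * c)) z b d"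
proof -
  have "(\<lambda>u. c * exp (c * u) * z u) integrable_on {a..d}"
    using set_borel_integral_eq_integral(1)[OF set_integrable_exp_regular[OF z]] .
  then have "integral {a..b} (\<lambda>u. c * exp (c * u) * z u) + integral {b..d} (\<lambda>u. c * exp (c * u) * z u)
      = integral {a..d} (\<lambda>u. c * exp (c * u) * z u)"
    using assms by (intro Henstock_Kurzweil_Integration.integral_combine) auto
  then show ?thesis by (simp add: random_integral_exp)
qed

lemma random_integral_tendsto:
  assumes z: "regular_path z" and x: "x \<longlonglongrightarrow> u" "\<And>n. u \<le> x n" "\<And>n. x n \<le> u + 1" and au: "a \<le> u"
  shows "(\<lambda>n. random_integral (\<lambda>u. exp (u * c)) z a (x n)) \<longlonglongrightarrow> random_integral (\<lambda>u. exp (u * c)) z a u"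
proof -
  have "(\<lambda>u. c * exp (c * u) * z u) integrable_on {a..u + 1}"
    using set_borel_integral_eq_integral(1)[OF set_integrable_exp_regular[OF z]] .
  then have "continuous_on {a..u + 1} (\<lambda>x. integral {a..x} (\<lambda>u. c * exp (c * u) * z u))"
    by (rule indefinite_integral_continuous_1)
  then have "(\<lambda>n. integral {a..x n} (\<lambda>u. c * exp (c * u) * z u)) \<longlonglongrightarrow> integral {a..u} (\<lambda>u. c * exp (c * u) * z u)"
    by (rule continuous_on_tendsto_compose) (use x au order_trans[OF au] in auto)
  then show ?thesis
    unfolding random_integral_exp
    by (intro tendsto_intros x regular_path_tendsto[OF z x(1,2)])
qed

text \<open>By right continuity, increments over rational end points control all increments.\<close>

lemma random_integral_convergent_at_bot:
  assumes z: "regular_path z"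
    and small: "\<And>e::nat. \<exists>n::nat. \<forall>p\<in>\<rat>. \<forall>q\<in>\<rat>. p \<le> q \<and> q \<le> - real n \<longrightarrow>
      \<bar>random_integral (\<lambda>u. exp (u * c)) z p q\<bar> \<le> 1 / real (Suc e)"
  shows "\<exists>l. ((\<lambda>a. random_integral (\<lambda>u. exp (u * c)) z a b) \<longlongrightarrow> l) at_bot"
proof -
  let ?I = "random_integral (\<lambda>u. exp (u * c)) z"
  have grid_rat: "grid n u \<in> \<rat>" for n u
    unfolding grid_def by (simp del: of_nat_Suc)
  have grid_mono: "u \<le> v \<Longrightarrow> grid n u \<le> grid n v" for n u v
    unfolding grid_def by (intro divide_right_mono) (auto intro!: ceiling_mono mult_right_mono simp del: of_nat_Suc)
  have small': "\<exists>K. \<forall>u v. u \<le> v \<and> v \<le> K \<longrightarrow> \<bar>?I u v\<bar> < e" if e: "e > 0" for e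
  proof -
    obtain k where k: "1 / real (Suc k) < e"
      using nat_approx_posE[OF e] by blast
    obtain n :: nat where n: "\<And>p q. p \<in> \<rat> \<Longrightarrow> q \<in> \<rat> \<Longrightarrow> p \<le> q \<Longrightarrow> q \<le> - real n \<Longrightarrow> \<bar>?I p q\<bar> \<le> 1 / real (Suc k)"
      using small[of k] by blast
    \<comment> \<open>The extra 1 leaves room for rounding \<open>v\<close> up to the rational
      \<open>grid m v\<close>, which must not exceed \<open>- real n\<close>.\<close>
    have "\<bar>?I u v\<bar> \<le> 1 / real (Suc k)" if uv: "u \<le> v" "v \<le> - real n - 1" for u v
    proof (rule LIMSEQ_le_const2)
      have "(\<lambda>m. ?I u (grid m v) - ?I u (grid m u)) \<longlonglongrightarrow> ?I u v - ?I u u"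
        by (intro tendsto_diff random_integral_tendsto[OF z] tendsto_grid grid_bounds grid_le_add_1 uv order_refl)
      moreover have "?I u (grid m v) - ?I u (grid m u) = ?I (grid m u) (grid m v)" for m
        using random_integral_split[where c=c and a=u and b="grid m u" and d="grid m v", OF z grid_bounds(1) grid_mono[OF uv(1)]] by simp
      ultimately show "(\<lambda>m. \<bar>?I (grid m u) (grid m v)\<bar>) \<longlonglongrightarrow> \<bar>?I u v\<bar>"
        by (intro tendsto_rabs) simp
      show "\<exists>N. \<forall>m\<ge>N. \<bar>?I (grid m u) (grid m v)\<bar> \<le> 1 / real (Suc k)"
        using grid_le_add_1[of _ v] uv(2) by (intro exI[of _ 0] allI impI n grid_rat grid_mono uv(1)) (smt (verit))
    qed
    then show ?thesis
      using k by (intro exI[of _ "- real n - 1"]) (auto intro: le_less_trans)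
  qed
  \<comment> \<open>\<open>min\<close> keeps the lower limit to the left of \<open>b\<close>, where
    integrals can be split.\<close>
  define s where "s n = ?I (min b (- real n)) b" for n
  have diff: "?I u b = ?I u v + ?I v b" if "u \<le> v" "v \<le> b" for u v
    using random_integral_split[OF z that] .
  have "Cauchy s"
  proof (rule CauchyI')
    fix e :: real assume "e > 0"
    then obtain K where K: "\<And>u v. u \<le> v \<Longrightarrow> v \<le> K \<Longrightarrow> \<bar>?I u v\<bar> < e" using small' by metis
    obtain n0 :: nat where n0: "- K \<le> real n0" using real_arch_simple by blast
    show "\<exists>M. \<forall>m\<ge>M. \<forall>n>m. dist (s m) (s n) < e"
    proof (intro exI allI impI)
      fix m n assume mn: "m \<ge> n0" "n > m"
      have "s n - s m = ?I (min b (- real n)) (min b (- real m))"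
        using diff[of "min b (- real n)" "min b (- real m)"] mn by (simp add: s_def)
      moreover have "\<bar>?I (min b (- real n)) (min b (- real m))\<bar> < e"
        using n0 mn by (intro K) auto
      ultimately show "dist (s m) (s n) < e" by (simp add: dist_real_def)
    qed
  qed
  then obtain l where l: "s \<longlonglongrightarrow> l" using convergent_def real_Cauchy_convergent by blast
  have "((\<lambda>a. ?I a b) \<longlongrightarrow> l) at_bot"
  proof (rule tendstoI)
    fix e :: real assume e: "e > 0"
    then obtain K where K: "\<And>u v. u \<le> v \<Longrightarrow> v \<le> K \<Longrightarrow> \<bar>?I u v\<bar> < e / 2" using small'[of "e / 2"] by auto
    obtain n0 :: nat where n0: "- K \<le> real n0" using real_arch_simple by blast
    have "\<forall>\<^sub>F n in sequentially. dist (s n) l < e / 2 \<and> n0 \<le> n"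
      using l e by (intro eventually_conj tendstoD eventually_ge_at_top) auto
    then obtain n where n: "dist (s n) l < e / 2" "n0 \<le> n"
      using eventually_happens[of _ sequentially] by auto
    have "dist (?I a b) l < e" if a: "a \<le> min b (- real n)" for a
    proof -
      have "?I a b = ?I a (min b (- real n)) + s n"
        using diff[OF a] by (simp add: s_def)
      moreover have "\<bar>?I a (min b (- real n))\<bar> < e / 2"
        using a n n0 by (intro K) auto
      ultimately show ?thesis using n(1) unfolding dist_real_def by linarith
    qed
    then show "\<forall>\<^sub>F a in at_bot. dist (?I a b) l < e"
      unfolding eventually_at_bot_linorder by blast
  qed
  then show ?thesis by blast
qed

section \<open>Integrals against the time-changed process\<close>

context dilatively_stable_additive
begin

definition levy_integral :: "(real \<Rightarrow> 'b \<Rightarrow> real) \<Rightarrow> real \<Rightarrow> real \<Rightarrow> 'b \<Rightarrow> real" where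
  "levy_integral L a b \<omega> = random_integral (\<lambda>u. exp (u * \<beta>)) (\<lambda>u. L (time_change \<delta> u) \<omega>) a b"

lemma mono_time_change: "mono (time_change \<delta>)"
  using strict_mono_time_change by (rule strict_mono_mono)

text \<open>Collects what the Riemann sums use of \<open>L\<close>: regular paths, and agreement at
  the countably many time-changed nodes, outside one null set, with an everywhere measurable
  \<open>V\<close> whose increments have a known joint exponent.\<close>

lemma two_sided_version_exists:
  fixes N :: "'b measure"
  assumes "two_sided_levy_process N L (law M Y)"
    and \<psi>: "continuous_on UNIV \<psi>" "\<psi> 0 = 0"
    and Y: "\<And>\<theta>. (CLINT \<omega>|completion M. iexp (\<theta> * Y \<omega>)) = exp (\<psi> \<theta>)"
  obtains V where "prob_space N" "\<And>t. V t \<in> borel_measurable N"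
    "AE \<omega> in N. regular_path (\<lambda>u. L (time_change \<delta> u) \<omega>) \<and>
       (\<forall>n i. L (time_change \<delta> (node n i)) \<omega> = V (time_change \<delta> (node n i)) \<omega>)"
    "\<And>p q c n. p \<le> 0 \<Longrightarrow> 0 \<le> q \<Longrightarrow>
       (CLINT \<omega>|N. iexp (\<Sum>i=p..<q. c i * (V (time_change \<delta> (node n (i + 1))) \<omega> - V (time_change \<delta> (node n i)) \<omega>)))
       = exp (\<Sum>i=p..<q. of_real (time_change \<delta> (node n (i + 1)) - time_change \<delta> (node n i)) * \<psi> (c i))"
proof -
  obtain L1 L2 where L12: "levy_process N L1" "levy_process N L2"
    and law: "distr N borel (L1 1) = law M Y" "distr N borel (L2 1) = law M Y"
    and ind: "prob_space.indep_var N
          (\<Pi>\<^sub>M t\<in>{0..}. borel) (\<lambda>\<omega>. \<lambda>t\<in>{0..}. L1 t \<omega>)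
          (\<Pi>\<^sub>M t\<in>{0..}. borel) (\<lambda>\<omega>. \<lambda>t\<in>{0..}. L2 t \<omega>)"
    and L: "L = two_sided L1 L2"
    using assms(1) unfolding two_sided_levy_process_def by blast
  have N: "prob_space N"
    using L12(1) by (intro additive_process_prob_space levy_process_additive)
  have charY: "char (law M Y) \<theta> = exp (\<psi> \<theta>)" for \<theta>
    using Y[of \<theta>] by (simp add: char_def law_def integral_distr)
  have char1: "(CLINT \<omega>|N. iexp (\<theta> * K 1 \<omega>)) = exp (\<psi> \<theta>)"
    if K: "levy_process N K" "distr N borel (K 1) = law M Y" for K \<theta>
  proof -
    have "K 1 \<in> borel_measurable N"
      using K(1) by (intro additive_process_measurable levy_process_additive) auto
    then have "(CLINT \<omega>|N. iexp (\<theta> * K 1 \<omega>)) = char (distr N borel (K 1)) \<theta>"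
      by (simp add: char_def integral_distr)
    then show ?thesis by (simp only: K(2) charY)
  qed
  show ?thesis
  proof (rule that[of "two_sided_version L1 L2"])
    have "AE \<omega> in N. \<forall>n i. two_sided L1 L2 (time_change \<delta> (node n i)) \<omega> = two_sided_version L1 L2 (time_change \<delta> (node n i)) \<omega>"
      unfolding AE_all_countable
      by (intro allI two_sided_version_AE[OF L12 \<psi>] char1[OF L12(2) law(2)])
    with two_sided_regular_AE[OF L12]
    show "AE \<omega> in N. regular_path (\<lambda>u. L (time_change \<delta> u) \<omega>) \<and>
       (\<forall>n i. L (time_change \<delta> (node n i)) \<omega> = two_sided_version L1 L2 (time_change \<delta> (node n i)) \<omega>)"
      unfolding L
      by eventually_elim (auto intro: regular_path_compose[OF _ mono_time_change continuous_on_time_change])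
    fix p q :: int and c :: "int \<Rightarrow> real" and n :: nat
    assume pq: "p \<le> 0" "0 \<le> q"
    show "(CLINT \<omega>|N. iexp (\<Sum>i=p..<q. c i * (two_sided_version L1 L2 (time_change \<delta> (node n (i + 1))) \<omega> - two_sided_version L1 L2 (time_change \<delta> (node n i)) \<omega>)))
       = exp (\<Sum>i=p..<q. of_real (time_change \<delta> (node n (i + 1)) - time_change \<delta> (node n i)) * \<psi> (c i))"
    proof (rule two_sided_char_increments[OF L12 ind \<psi> char1[OF L12(1) law(1)] char1[OF L12(2) law(2)] pq, of "\<lambda>i. time_change \<delta> (node n i)"])
      show "strict_mono (\<lambda>i. time_change \<delta> (node n i))"
        by (intro strict_monoI strict_monoD[OF strict_mono_time_change] strict_monoD[OF strict_mono_node])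
    qed simp
  qed (use N two_sided_version_measurable[OF L12] in auto)
qed

text \<open>Both exponents are sums over the same grid, of \<open>psi_approx n\<close> and of \<open>\<psi>\<close> at the same
  bounded arguments.\<close>

lemma levy_integral_char:
  fixes N :: "'b measure" and a b :: "nat \<Rightarrow> real"
  assumes L: "two_sided_levy_process N L (law M Y)"
    and ab: "\<forall>j<k. a j \<le> b j"
  shows "(CLINT \<omega>|M. iexp (\<Sum>j<k. \<theta> j * (W (b j) \<omega> - W (a j) \<omega>)))
       = (CLINT \<omega>|completion N. iexp (\<Sum>j<k. \<theta> j * levy_integral L (a j) (b j) \<omega>))" (is "?EW = ?EZ")
proof -
  obtain \<psi> where \<psi>: "continuous_on UNIV \<psi>" "\<psi> 0 = 0"
    "\<And>\<theta>. (CLINT \<omega>|completion M. iexp (\<theta> * Y \<omega>)) = exp (\<psi> \<theta>)"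
    and ulim: "\<And>R. 0 \<le> R \<Longrightarrow> uniform_limit {-R..R} psi_approx \<psi> sequentially"
    using psi_exists by metis
  obtain V where N: "prob_space N" and V [measurable]: "\<And>t. V t \<in> borel_measurable N"
    and reg: "AE \<omega> in N. regular_path (\<lambda>u. L (time_change \<delta> u) \<omega>) \<and>
       (\<forall>n i. L (time_change \<delta> (node n i)) \<omega> = V (time_change \<delta> (node n i)) \<omega>)"
    and Vchar: "\<And>p q c n. p \<le> 0 \<Longrightarrow> 0 \<le> q \<Longrightarrow>
       (CLINT \<omega>|N. iexp (\<Sum>i=p..<q. c i * (V (time_change \<delta> (node n (i + 1))) \<omega> - V (time_change \<delta> (node n i)) \<omega>)))
       = exp (\<Sum>i=p..<q. of_real (time_change \<delta> (node n (i + 1)) - time_change \<delta> (node n i)) * \<psi> (c i))"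
    using two_sided_version_exists[OF L \<psi>] by blast
  interpret N: prob_space N by fact
  \<comment> \<open>An integer bound for all end points, so that the window from \<open>- K\<close>
    to \<open>K\<close> consists of whole cells for every mesh.\<close>
  obtain K :: nat where K: "(\<Sum>j<k. \<bar>a j\<bar> + \<bar>b j\<bar>) \<le> real K"
    using real_arch_simple by blast
  have K': "- real K \<le> a j" "b j \<le> real K" if "j < k" for j
  proof -
    have "\<bar>a j\<bar> + \<bar>b j\<bar> \<le> (\<Sum>j<k. \<bar>a j\<bar> + \<bar>b j\<bar>)"
      using that by (intro member_le_sum) auto
    then show "- real K \<le> a j" "b j \<le> real K" using K by linarith+
  qed
  define p where "p n = - int (K * Suc n)" for n
  define q where "q n = int (K * Suc n)" for n
  define l where "l n j = \<lceil>a j * real (Suc n)\<rceil>" for n j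
  define u where "u n j = \<lceil>b j * real (Suc n)\<rceil>" for n j
  have pq: "p n \<le> 0" "0 \<le> q n" "p n \<le> q n" for n
    by (simp_all add: p_def q_def del: of_nat_Suc of_nat_mult)
  have node_pq: "node n (p n) = - real K" "node n (q n) = real K" for n
  proof -
    have "real_of_int (p n) = - real K * real (Suc n)" "real_of_int (q n) = real K * real (Suc n)"
      by (simp_all add: p_def q_def algebra_simps)
    then show "node n (p n) = - real K" "node n (q n) = real K"
      by (simp_all add: node_def del: of_nat_Suc)
  qed
  have lu: "p n \<le> l n j \<and> u n j \<le> q n" if "j < k" for n j
  proof -
    have "real_of_int (p n) = - real K * real (Suc n)" "real_of_int (q n) = real K * real (Suc n)"
      by (simp_all add: p_def q_def algebra_simps)
    moreover have "- real K * real (Suc n) \<le> a j * real (Suc n)" "b j * real (Suc n) \<le> real K * real (Suc n)"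
      by (intro mult_right_mono K' that; simp)+
    ultimately have "real_of_int (p n) \<le> a j * real (Suc n)" "b j * real (Suc n) \<le> real_of_int (q n)"
      by simp_all
    then show ?thesis unfolding l_def u_def by (simp add: ceiling_le_iff) linarith
  qed
  define f where "f n i = (\<Sum>j<k. \<theta> j * of_bool (l n j \<le> i \<and> i < u n j))" for n i
  define \<Theta> where "\<Theta> = (\<Sum>j<k. \<bar>\<theta> j\<bar>)"
  have f_le: "\<bar>f n i\<bar> \<le> \<Theta>" for n i
    unfolding f_def \<Theta>_def by (intro order_trans[OF sum_abs] sum_mono) auto
  \<comment> \<open>All arguments of \<open>psi_approx n\<close> and \<psi> stay within
    \<open>R\<close>, whatever the mesh, so convergence is needed on one compact interval
    only.\<close>
  define R where "R = exp (\<bar>\<beta>\<bar> * real K) * \<Theta>"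
  have R: "0 \<le> R" by (simp add: R_def \<Theta>_def sum_nonneg)
  have arg: "exp (\<beta> * node n i) * f n i \<in> {-R..R}" if "i \<in> {p n..<q n}" for n i
  proof -
    have "- real K \<le> node n i" "node n i \<le> real K"
      using that strict_mono_less_eq[OF strict_mono_node, of n "p n" i] strict_mono_less_eq[OF strict_mono_node, of n i "q n"]
      by (auto simp: node_pq)
    then have "\<bar>node n i\<bar> \<le> real K" by linarith
    then have "\<bar>\<beta>\<bar> * \<bar>node n i\<bar> \<le> \<bar>\<beta>\<bar> * real K"
      by (rule mult_left_mono) (rule abs_ge_zero)
    with abs_ge_self[of "\<beta> * node n i"] have "\<beta> * node n i \<le> \<bar>\<beta>\<bar> * real K"
      unfolding abs_mult by (rule order_trans)
    then have "\<bar>exp (\<beta> * node n i) * f n i\<bar> \<le> R"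
      unfolding R_def abs_mult by (intro mult_mono f_le) auto
    then show ?thesis
      unfolding atLeastAtMost_iff by (intro conjI; linarith)
  qed
  let ?d = "\<lambda>n i. time_change \<delta> (node n (i + 1)) - time_change \<delta> (node n i)"
  define P where "P n = (\<Sum>i=p n..<q n. of_real (?d n i) * psi_approx n (exp (\<beta> * node n i) * f n i))" for n
  define Q where "Q n = (\<Sum>i=p n..<q n. of_real (?d n i) * \<psi> (exp (\<beta> * node n i) * f n i))" for n
  \<comment> \<open>The total time-change length of the window, the same for every mesh: a uniform
    error in the exponents is multiplied by at most \<open>C\<close>.\<close>
  define C where "C = time_change \<delta> (real K) - time_change \<delta> (- real K)"
  have d_pos: "0 \<le> ?d n i" for n i
    using strict_monoD[OF strict_mono_time_change strict_monoD[OF strict_mono_node, of i "i + 1"], of \<delta> n] by simp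
  have d_sum: "(\<Sum>i=p n..<q n. ?d n i) = C" for n
    using sum_int_telescope[OF pq(3), of "\<lambda>i. time_change \<delta> (node n i)" n] by (simp add: node_pq C_def)
  have C: "0 \<le> C" using d_sum[of 0] sum_nonneg[of "{p 0..<q 0}" "?d 0"] d_pos by simp
  have PQ: "(\<lambda>n. P n - Q n) \<longlonglongrightarrow> 0"
  proof (rule LIMSEQ_I)
    fix e :: real assume e: "e > 0"
    \<comment> \<open>Dividing by \<open>C + 1\<close> avoids a case distinction for
      \<open>C = 0\<close>.\<close>
    have "\<forall>\<^sub>F n in sequentially. \<forall>x\<in>{-R..R}. dist (psi_approx n x) (\<psi> x) < e / (C + 1)"
      using ulim[OF R] e C by (intro uniform_limitD) auto
    then obtain n0 where n0: "\<And>n x. n \<ge> n0 \<Longrightarrow> x \<in> {-R..R} \<Longrightarrow> dist (psi_approx n x) (\<psi> x) < e / (C + 1)"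
      unfolding eventually_sequentially by blast
    have "norm (P n - Q n - 0) < e" if n: "n \<ge> n0" for n
    proof -
      have "norm (P n - Q n) = norm (\<Sum>i=p n..<q n. of_real (?d n i) * (psi_approx n (exp (\<beta> * node n i) * f n i) - \<psi> (exp (\<beta> * node n i) * f n i)))"
        by (simp add: P_def Q_def sum_subtractf right_diff_distrib)
      also have "\<dots> \<le> (\<Sum>i=p n..<q n. ?d n i * (e / (C + 1)))"
      proof (rule sum_norm_le)
        fix i assume i: "i \<in> {p n..<q n}"
        have "norm (complex_of_real (?d n i)) = ?d n i"
          using d_pos[of n i] by (simp only: norm_of_real abs_of_nonneg)
        then show "norm (of_real (?d n i) * (psi_approx n (exp (\<beta> * node n i) * f n i) - \<psi> (exp (\<beta> * node n i) * f n i))) \<le> ?d n i * (e / (C + 1))"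
          unfolding norm_mult using n0[OF n arg[OF i]] d_pos[of n i]
          by (intro mult_mono) (simp_all only: dist_norm less_imp_le norm_ge_zero order_refl)
      qed
      also have "\<dots> = C * (e / (C + 1))"
        by (simp only: sum_distrib_right[symmetric] d_sum)
      also have "\<dots> < e"
        using e C by (simp add: field_simps)
      finally show ?thesis by simp
    qed
    then show "\<exists>no. \<forall>n\<ge>no. norm (P n - Q n - 0) < e" by blast
  qed
  have EW: "(\<lambda>n. exp (P n)) \<longlonglongrightarrow> (CLINT \<omega>|completion M. iexp (\<Sum>j<k. \<theta> j * (W (b j) \<omega> - W (a j) \<omega>)))"
  proof -
    have "(\<lambda>n. CLINT \<omega>|M. iexp (\<Sum>j<k. \<theta> j * (W (grid n (b j)) \<omega> - W (grid n (a j)) \<omega>)))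
        \<longlonglongrightarrow> (CLINT \<omega>|completion M. iexp (\<Sum>j<k. \<theta> j * (W (b j) \<omega> - W (a j) \<omega>)))"
    proof (rule tendsto_iexp_integral[OF prob_space_axioms])
      show "AE \<omega> in M. (\<lambda>n. \<Sum>j<k. \<theta> j * (W (grid n (b j)) \<omega> - W (grid n (a j)) \<omega>))
          \<longlonglongrightarrow> (\<Sum>j<k. \<theta> j * (W (b j) \<omega> - W (a j) \<omega>))"
        using W_regular_AE by eventually_elim (intro tendsto_intros regular_path_grid)
    qed measurable
    moreover have "(CLINT \<omega>|M. iexp (\<Sum>j<k. \<theta> j * (W (grid n (b j)) \<omega> - W (grid n (a j)) \<omega>))) = exp (P n)" for n
    proof -
      have "(\<Sum>j<k. \<theta> j * (W (grid n (b j)) \<omega> - W (grid n (a j)) \<omega>))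
          = (\<Sum>i=p n..<q n. f n i * (W (node n (i + 1)) \<omega> - W (node n i) \<omega>))" for \<omega>
      proof -
        have "W (grid n (b j)) \<omega> - W (grid n (a j)) \<omega> = (\<Sum>i=l n j..<u n j. W (node n (i + 1)) \<omega> - W (node n i) \<omega>)"
          if "j < k" for j
        proof -
          have "l n j \<le> u n j"
            using ab that unfolding l_def u_def by (intro ceiling_mono mult_right_mono) auto
          then show ?thesis
            by (subst sum_int_telescope[of _ _ "\<lambda>i. W (node n i) \<omega>"]) (simp_all only: grid_eq_node l_def u_def)
        qed
        then have "(\<Sum>j<k. \<theta> j * (W (grid n (b j)) \<omega> - W (grid n (a j)) \<omega>))
            = (\<Sum>j<k. \<theta> j * (\<Sum>i=l n j..<u n j. W (node n (i + 1)) \<omega> - W (node n i) \<omega>))"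
          by (intro sum.cong refl) simp
        also have "\<dots> = (\<Sum>i=p n..<q n. f n i * (W (node n (i + 1)) \<omega> - W (node n i) \<omega>))"
          unfolding f_def by (rule sum_int_subintervals[OF lu])
        finally show ?thesis .
      qed
      then show ?thesis
        unfolding P_def by (simp only: W_char_increments[OF pq(3)])
    qed
    ultimately show ?thesis by simp
  qed
  have EZ: "(\<lambda>n. exp (Q n)) \<longlonglongrightarrow> ?EZ" and Q1: "norm (exp (Q n)) \<le> 1" for n
  proof -
    let ?R = "\<lambda>n j \<omega>. riemann_sum \<beta> (\<lambda>u. V (time_change \<delta> u) \<omega>) n (a j) (b j)"
    have [measurable]: "?R n j \<in> borel_measurable N" for n j
      unfolding riemann_sum_def by measurable
    have "(\<lambda>n. CLINT \<omega>|N. iexp (\<Sum>j<k. \<theta> j * ?R n j \<omega>)) \<longlonglongrightarrow> ?EZ"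
    proof (rule tendsto_iexp_integral[OF N])
      show "AE \<omega> in N. (\<lambda>n. \<Sum>j<k. \<theta> j * ?R n j \<omega>) \<longlonglongrightarrow> (\<Sum>j<k. \<theta> j * levy_integral L (a j) (b j) \<omega>)"
        using reg
      proof eventually_elim
        case (elim \<omega>)
        \<comment> \<open>Riemann sums see only the nodes, where \<open>V\<close> and
          \<open>L\<close> agree almost surely; the limit involves the whole path of
          \<open>L\<close>.\<close>
        have "?R n j \<omega> = riemann_sum \<beta> (\<lambda>u. L (time_change \<delta> u) \<omega>) n (a j) (b j)" for n j
          using elim by (simp add: riemann_sum_def)
        moreover have "(\<lambda>n. riemann_sum \<beta> (\<lambda>u. L (time_change \<delta> u) \<omega>) n (a j) (b j)) \<longlonglongrightarrow> levy_integral L (a j) (b j) \<omega>"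
          if "j \<in> {..<k}" for j
          unfolding levy_integral_def using elim ab that by (intro riemann_sum_tendsto) auto
        ultimately show ?case
          by (intro tendsto_sum tendsto_mult tendsto_const) (simp only:)
      qed
    qed measurable
    moreover have eq: "(CLINT \<omega>|N. iexp (\<Sum>j<k. \<theta> j * ?R n j \<omega>)) = exp (Q n)" for n
    proof -
      have "(\<Sum>j<k. \<theta> j * ?R n j \<omega>)
          = (\<Sum>i=p n..<q n. (exp (\<beta> * node n i) * f n i) * (V (time_change \<delta> (node n (i + 1))) \<omega> - V (time_change \<delta> (node n i)) \<omega>))" for \<omega>
      proof -
        have "(\<Sum>j<k. \<theta> j * ?R n j \<omega>)
          = (\<Sum>i=p n..<q n. f n i * (exp (\<beta> * node n i) * (V (time_change \<delta> (node n (i + 1))) \<omega> - V (time_change \<delta> (node n i)) \<omega>)))"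
          unfolding f_def riemann_sum_def l_def[symmetric] u_def[symmetric] by (rule sum_int_subintervals[OF lu])
        then show ?thesis by (simp only: mult.assoc mult.left_commute)
      qed
      then show ?thesis
        unfolding Q_def by (simp only: Vchar[OF pq(1,2)])
    qed
    ultimately show "(\<lambda>n. exp (Q n)) \<longlonglongrightarrow> ?EZ" by (simp only:)
    show "norm (exp (Q n)) \<le> 1" for n
      unfolding eq[symmetric] by (rule N.cmod_iexp_integral_le_1)
  qed
  \<comment> \<open>Only \<open>P n - Q n\<close> is known to converge. As \<open>exp (Q n)\<close>
    is a value of a characteristic function, its modulus is at most 1, so the exponentials differ by
    at most \<open>norm (exp (P n - Q n) - 1)\<close>.\<close>
  have "(\<lambda>n. exp (P n) - exp (Q n)) \<longlonglongrightarrow> 0"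
  proof (rule Lim_null_comparison)
    show "\<forall>\<^sub>F n in sequentially. norm (exp (P n) - exp (Q n)) \<le> norm (exp (P n - Q n) - 1)"
    proof (intro always_eventually allI)
      fix n
      have "exp (P n) - exp (Q n) = exp (Q n) * (exp (P n - Q n) - 1)"
        by (simp add: right_diff_distrib exp_add[symmetric])
      then show "norm (exp (P n) - exp (Q n)) \<le> norm (exp (P n - Q n) - 1)"
        using mult_right_mono[OF Q1[of n], of "norm (exp (P n - Q n) - 1)"] by (simp add: norm_mult)
    qed
    have "(\<lambda>n. norm (exp (P n - Q n) - 1)) \<longlonglongrightarrow> norm (exp 0 - 1 :: complex)"
      by (intro tendsto_intros PQ)
    then show "(\<lambda>n. norm (exp (P n - Q n) - 1)) \<longlonglongrightarrow> 0" by simp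
  qed
  from LIMSEQ_unique[OF tendsto_diff[OF EW EZ] this]
  have "(CLINT \<omega>|completion M. iexp (\<Sum>j<k. \<theta> j * (W (b j) \<omega> - W (a j) \<omega>))) = ?EZ"
    by (simp only: right_minus_eq)
  moreover have "(CLINT \<omega>|completion M. iexp (\<Sum>j<k. \<theta> j * (W (b j) \<omega> - W (a j) \<omega>))) = ?EW"
    by (rule integral_completion) measurable
  ultimately show ?thesis by simp
qed

end

section \<open>Existence of the improper integral and equality of the laws\<close>

context dilatively_stable_additive
begin

lemma levy_regular_AE:
  fixes N :: "'b measure"
  assumes "two_sided_levy_process N L (law M Y)"
  shows "AE \<omega> in N. regular_path (\<lambda>u. L (time_change \<delta> u) \<omega>)"
proof -
  obtain L1 L2 where "levy_process N L1" "levy_process N L2" "L = two_sided L1 L2"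
    using assms unfolding two_sided_levy_process_def by blast
  with two_sided_regular_AE[of N L1 L2] show ?thesis
    by (auto elim!: eventually_mono intro: regular_path_compose[OF _ mono_time_change continuous_on_time_change])
qed

lemma levy_integral_measurable:
  fixes N :: "'b measure"
  assumes L: "two_sided_levy_process N L (law M Y)" and ab: "a \<le> b"
  shows "levy_integral L a b \<in> borel_measurable (completion N)"
proof -
  obtain \<psi> where \<psi>: "continuous_on UNIV \<psi>" "\<psi> 0 = 0"
    "\<And>\<theta>. (CLINT \<omega>|completion M. iexp (\<theta> * Y \<omega>)) = exp (\<psi> \<theta>)"
    using psi_exists by metis
  obtain V where V [measurable]: "\<And>t. V t \<in> borel_measurable N"
    and reg: "AE \<omega> in N. regular_path (\<lambda>u. L (time_change \<delta> u) \<omega>) \<and>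
       (\<forall>n i. L (time_change \<delta> (node n i)) \<omega> = V (time_change \<delta> (node n i)) \<omega>)"
    by (rule two_sided_version_exists[OF L \<psi>]) blast
  show ?thesis
  proof (rule borel_measurable_completion_AE_LIMSEQ)
    show "(\<lambda>\<omega>. riemann_sum \<beta> (\<lambda>u. V (time_change \<delta> u) \<omega>) n a b) \<in> borel_measurable N" for n
      unfolding riemann_sum_def by measurable
    show "AE \<omega> in N. (\<lambda>n. riemann_sum \<beta> (\<lambda>u. V (time_change \<delta> u) \<omega>) n a b) \<longlonglongrightarrow> levy_integral L a b \<omega>"
      using reg
    proof eventually_elim
      case (elim \<omega>)
      have "riemann_sum \<beta> (\<lambda>u. V (time_change \<delta> u) \<omega>) n a b = riemann_sum \<beta> (\<lambda>u. L (time_change \<delta> u) \<omega>) n a b" for n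
        using elim by (simp add: riemann_sum_def)
      then show ?case
        unfolding levy_integral_def using elim riemann_sum_tendsto[OF _ ab] by simp
    qed
  qed
qed

lemma W_at_bot_AE: "AE \<omega> in M. ((\<lambda>u. W u \<omega>) \<longlongrightarrow> 0) at_bot"
  using additive_process_AE[OF additive]
proof eventually_elim
  case (elim \<omega>)
  have "filterlim (exp :: real \<Rightarrow> real) (at_right 0) at_bot"
    by (auto simp: filterlim_at intro!: exp_at_bot always_eventually)
  with cadlag_right_limit[OF elim(1), of 0] have "((\<lambda>u. X (exp u) \<omega>) \<longlongrightarrow> X 0 \<omega>) at_bot"
    by (intro filterlim_compose[where g="\<lambda>t. X t \<omega>" and f=exp]) auto
  then show ?case using elim(2) by (simp add: W_def)
qed

lemma levy_integral_distr:
  fixes N :: "'b measure" and a b :: "nat \<Rightarrow> real"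
  assumes L: "two_sided_levy_process N L (law M Y)" and N: "prob_space N" and ab: "\<And>j. a j \<le> b j"
  shows "distr M (borel_Rvec k) (\<lambda>\<omega>. \<lambda>j\<in>{..<k}. W (b j) \<omega> - W (a j) \<omega>)
       = distr (completion N) (borel_Rvec k) (\<lambda>\<omega>. \<lambda>j\<in>{..<k}. levy_integral L (a j) (b j) \<omega>)"
proof (rule distr_borel_Rvec_eqI)
  show "(CLINT \<omega>|M. iexp (\<Sum>j<k. \<theta> j * (W (b j) \<omega> - W (a j) \<omega>)))
       = (CLINT \<omega>|completion N. iexp (\<Sum>j<k. \<theta> j * levy_integral L (a j) (b j) \<omega>))" for \<theta>
    by (rule levy_integral_char[OF L]) (use ab in simp)
qed (use prob_space_axioms prob_space.prob_space_completion[OF N] levy_integral_measurable[OF L ab] in auto)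

text \<open>The Cauchy criterion at minus infinity, restricted to rational end points, is an event
  \<open>E\<close> of one sequence of integrals. That sequence has the law of the corresponding
  increments of \<open>W\<close>, for which \<open>E\<close> follows from the limit of
  \<open>W\<close> at minus infinity.\<close>

lemma levy_integral_small_AE:
  fixes N :: "'b measure"
  assumes L: "two_sided_levy_process N L (law M Y)" and N: "prob_space N"
  shows "AE \<omega> in N. \<forall>e::nat. \<exists>n::nat. \<forall>p\<in>\<rat>. \<forall>q\<in>\<rat>. p \<le> q \<and> q \<le> - real n \<longrightarrow>
      \<bar>levy_integral L p q \<omega>\<bar> \<le> 1 / real (Suc e)"
proof -
  \<comment> \<open>Ordered pairs only, so that the comparison of laws, which needs
    \<open>a j \<le> b j\<close>, covers the entire enumeration.\<close>
  define S where "S = {(p, q). p \<in> (\<rat> :: real set) \<and> q \<in> (\<rat> :: real set) \<and> p \<le> q}"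
  have "S \<subseteq> \<rat> \<times> \<rat>" by (auto simp: S_def)
  then have cS: "countable S"
    by (rule countable_subset) (intro countable_SIGMA countable_rat)
  have "(0, 0) \<in> S" by (simp add: S_def)
  then have S: "from_nat_into S j \<in> S" for j by (intro from_nat_into) auto
  define a where "a j = fst (from_nat_into S j)" for j
  define b where "b j = snd (from_nat_into S j)" for j
  have ab: "a j \<le> b j" for j
    using S[of j] by (auto simp: a_def b_def S_def)
  define E where "E x \<longleftrightarrow> (\<forall>e::nat. \<exists>n::nat. \<forall>j. b j \<le> - real n \<longrightarrow> \<bar>x j\<bar> \<le> 1 / real (Suc e))" for x :: "nat \<Rightarrow> real"
  have E [measurable]: "{x \<in> space (\<Pi>\<^sub>M j\<in>UNIV. borel). E x} \<in> sets (\<Pi>\<^sub>M j\<in>(UNIV :: nat set). (borel :: real measure))"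
    unfolding E_def by measurable
  interpret C: prob_space "completion N" using N by (rule prob_space.prob_space_completion)
  note mL [measurable] = levy_integral_measurable[OF L ab]
  have mW: "(\<lambda>\<omega> j. W (b j) \<omega> - W (a j) \<omega>) \<in> M \<rightarrow>\<^sub>M (\<Pi>\<^sub>M j\<in>UNIV. borel)"
    using measurable_restrict[of UNIV "\<lambda>j \<omega>. W (b j) \<omega> - W (a j) \<omega>" M "\<lambda>_. borel"] by (simp add: restrict_UNIV)
  have mI: "(\<lambda>\<omega> j. levy_integral L (a j) (b j) \<omega>) \<in> completion N \<rightarrow>\<^sub>M (\<Pi>\<^sub>M j\<in>UNIV. borel)"
    using measurable_restrict[of UNIV "\<lambda>j. levy_integral L (a j) (b j)" "completion N" "\<lambda>_. borel"] mL
    by (simp add: restrict_UNIV)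
  have eq: "distr M (\<Pi>\<^sub>M j\<in>UNIV. borel) (\<lambda>\<omega> j. W (b j) \<omega> - W (a j) \<omega>)
      = distr (completion N) (\<Pi>\<^sub>M j\<in>UNIV. borel) (\<lambda>\<omega> j. levy_integral L (a j) (b j) \<omega>)"
    by (rule distr_PiM_nat_eqI[OF prob_space_axioms C.prob_space_axioms _ _ levy_integral_distr[OF L N ab]])
       (auto intro: mL)
  have "AE \<omega> in M. E (\<lambda>j. W (b j) \<omega> - W (a j) \<omega>)"
    using W_at_bot_AE
  proof eventually_elim
    case (elim \<omega>)
    show ?case
      unfolding E_def
    proof
      fix e :: nat
      have "\<forall>\<^sub>F u in at_bot. dist (W u \<omega>) 0 < 1 / (2 * real (Suc e))"
        using elim by (rule tendstoD) simp
      then obtain K where K: "\<And>u. u \<le> K \<Longrightarrow> \<bar>W u \<omega>\<bar> < 1 / (2 * real (Suc e))"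
        unfolding eventually_at_bot_linorder by auto
      obtain n :: nat where n: "- K \<le> real n" using real_arch_simple by blast
      have "\<bar>W (b j) \<omega> - W (a j) \<omega>\<bar> \<le> 1 / real (Suc e)" if "b j \<le> - real n" for j
      proof -
        have "\<bar>W (b j) \<omega>\<bar> < 1 / (2 * real (Suc e))" "\<bar>W (a j) \<omega>\<bar> < 1 / (2 * real (Suc e))"
          using that n ab[of j] by (auto intro!: K simp del: of_nat_Suc)
        moreover have "1 / (2 * real (Suc e)) + 1 / (2 * real (Suc e)) = 1 / real (Suc e)"
          by (simp add: field_simps del: of_nat_Suc)
        moreover have "\<bar>x - y\<bar> \<le> d" if "\<bar>x\<bar> < c" "\<bar>y\<bar> < c" "c + c = d" for x y c d :: real
          using that by linarith
        ultimately show ?thesis by blast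
      qed
      then show "\<exists>n::nat. \<forall>j. b j \<le> - real n \<longrightarrow> \<bar>W (b j) \<omega> - W (a j) \<omega>\<bar> \<le> 1 / real (Suc e)"
        by blast
    qed
  qed
  then have "AE x in distr M (\<Pi>\<^sub>M j\<in>UNIV. borel) (\<lambda>\<omega> j. W (b j) \<omega> - W (a j) \<omega>). E x"
    by (subst AE_distr_iff[OF mW E])
  then have "AE \<omega> in completion N. E (\<lambda>j. levy_integral L (a j) (b j) \<omega>)"
    unfolding eq by (subst (asm) AE_distr_iff[OF mI E])
  then have "AE \<omega> in N. E (\<lambda>j. levy_integral L (a j) (b j) \<omega>)"
    by (simp only: AE_completion_iff)
  then show ?thesis
  proof eventually_elim
    case (elim \<omega>)
    show ?case
    proof
      fix e :: nat
      obtain n :: nat where n: "\<And>j. b j \<le> - real n \<Longrightarrow> \<bar>levy_integral L (a j) (b j) \<omega>\<bar> \<le> 1 / real (Suc e)"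
        using elim unfolding E_def by blast
      show "\<exists>n::nat. \<forall>p\<in>\<rat>. \<forall>q\<in>\<rat>. p \<le> q \<and> q \<le> - real n \<longrightarrow> \<bar>levy_integral L p q \<omega>\<bar> \<le> 1 / real (Suc e)"
      proof (intro exI ballI impI)
        fix p q :: real assume "p \<in> \<rat>" "q \<in> \<rat>" and pq: "p \<le> q \<and> q \<le> - real n"
        then have "(p, q) \<in> S" by (simp add: S_def)
        then obtain j where "from_nat_into S j = (p, q)"
          using from_nat_into_surj[OF cS] by blast
        then have "a j = p" "b j = q" by (simp_all add: a_def b_def)
        with n[of j] pq show "\<bar>levy_integral L p q \<omega>\<bar> \<le> 1 / real (Suc e)" by simp
      qed
    qed
  qed
qed

lemma levy_integral_convergent_AE:
  fixes N :: "'b measure"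
  assumes L: "two_sided_levy_process N L (law M Y)" and N: "prob_space N"
  shows "AE \<omega> in N. \<forall>b. \<exists>l. ((\<lambda>a. levy_integral L a b \<omega>) \<longlongrightarrow> l) at_bot"
  using levy_regular_AE[OF L] levy_integral_small_AE[OF L N]
proof eventually_elim
  case (elim \<omega>)
  show ?case
    unfolding levy_integral_def
  proof (intro allI random_integral_convergent_at_bot[OF elim(1)])
    show "\<exists>n::nat. \<forall>p\<in>\<rat>. \<forall>q\<in>\<rat>. p \<le> q \<and> q \<le> - real n \<longrightarrow>
        \<bar>random_integral (\<lambda>u. exp (u * \<beta>)) (\<lambda>u. L (time_change \<delta> u) \<omega>) p q\<bar> \<le> 1 / real (Suc e)" for e
      using elim(2)[rule_format, of e] unfolding levy_integral_def .
  qed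
qed

lemma eq_fdd_levy_integral:
  fixes N :: "'b measure"
  assumes L: "two_sided_levy_process N L (law M Y)" and N: "prob_space N"
  shows "eq_fdd M X (completion N)
        (\<lambda>t \<omega>. if t = 0 then 0
           else random_integral_at_bot (\<lambda>u. exp (u * \<beta>)) (\<lambda>u. L (time_change \<delta> u) \<omega>) (ln t))"
    (is "eq_fdd M X _ ?J")
  unfolding eq_fdd_def fdd_def
proof (intro allI impI)
  fix k :: nat and t :: "nat \<Rightarrow> real" assume t: "\<forall>j<k. 0 \<le> t j"
  interpret C: prob_space "completion N" using N by (rule prob_space.prob_space_completion)
  \<comment> \<open>For \<open>t j = 0\<close> both end points are the dummy 0, so increment and
    integral vanish, in agreement with \<open>X 0 = 0\<close> almost surely and with the value 0
    assigned to the integral. Otherwise \<open>min\<close> in \<open>a\<close> keeps the end points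
    ordered.\<close>
  define b where "b j = (if t j = 0 then 0 else ln (t j))" for j
  define a where "a n j = (if t j = 0 then 0 else min (- real n) (ln (t j)))" for n :: nat and j
  have ab: "a n j \<le> b j" for n j by (simp add: a_def b_def)
  have a_lim: "filterlim (\<lambda>n. a n j) at_bot sequentially" if "t j \<noteq> 0" for j
  proof (rule filterlim_at_bot_mono)
    show "filterlim (\<lambda>n. - real n) at_bot sequentially"
      by (simp add: filterlim_uminus_at_top[symmetric] filterlim_real_sequentially)
    show "\<forall>\<^sub>F n in sequentially. a n j \<le> - real n" using that by (simp add: a_def)
  qed
  have W_lim: "AE \<omega> in M. \<forall>j<k. (\<lambda>n. W (b j) \<omega> - W (a n j) \<omega>) \<longlonglongrightarrow> X (t j) \<omega>"
    using W_at_bot_AE additive_process_AE(2)[OF additive]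
  proof eventually_elim
    case (elim \<omega>)
    show ?case
    proof (intro allI impI)
      fix j assume j: "j < k"
      show "(\<lambda>n. W (b j) \<omega> - W (a n j) \<omega>) \<longlonglongrightarrow> X (t j) \<omega>"
      proof (cases "t j = 0")
        case True
        then show ?thesis using elim(2) by (simp add: a_def b_def)
      next
        case False
        then have "W (b j) \<omega> = X (t j) \<omega>" using t j by (simp add: b_def W_def order_less_le)
        moreover have "(\<lambda>n. W (b j) \<omega> - W (a n j) \<omega>) \<longlonglongrightarrow> W (b j) \<omega> - 0"
          by (intro tendsto_diff tendsto_const filterlim_compose[OF elim(1) a_lim[OF False]])
        ultimately show ?thesis by simp
      qed
    qed
  qed
  have J_lim: "AE \<omega> in completion N. \<forall>j<k. (\<lambda>n. levy_integral L (a n j) (b j) \<omega>) \<longlonglongrightarrow> ?J (t j) \<omega>"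
    using AE_completion[OF levy_integral_convergent_AE[OF L N]]
  proof eventually_elim
    case (elim \<omega>)
    show ?case
    proof (intro allI impI)
      fix j
      show "(\<lambda>n. levy_integral L (a n j) (b j) \<omega>) \<longlonglongrightarrow> ?J (t j) \<omega>"
      proof (cases "t j = 0")
        case True
        then show ?thesis by (simp add: a_def b_def levy_integral_def)
      next
        case False
        obtain l where l: "((\<lambda>a. levy_integral L a (b j) \<omega>) \<longlongrightarrow> l) at_bot"
          using elim by blast
        then have "?J (t j) \<omega> = l"
          using False unfolding random_integral_at_bot_def levy_integral_def
          by (simp add: b_def) (rule tendsto_Lim, simp)
        with filterlim_compose[OF l a_lim[OF False]] show ?thesis by simp
      qed
    qed
  qed
  have J_meas: "?J (t j) \<in> borel_measurable (completion N)" if "j < k" for j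
  proof -
    have "?J (t j) \<in> borel_measurable (completion (completion N))"
    proof (rule borel_measurable_completion_AE_LIMSEQ)
      show "levy_integral L (a n j) (b j) \<in> borel_measurable (completion N)" for n
        by (rule levy_integral_measurable[OF L ab])
      show "AE \<omega> in completion N. (\<lambda>n. levy_integral L (a n j) (b j) \<omega>) \<longlonglongrightarrow> ?J (t j) \<omega>"
        using J_lim by eventually_elim (use that in blast)
    qed
    moreover have "borel_measurable (completion (completion N)) = (borel_measurable (completion N) :: ('b \<Rightarrow> real) set)"
      by (rule measurable_cong_sets[OF sets_completion_completion refl])
    ultimately show ?thesis by (simp only:)
  qed
  have X_meas: "X (t j) \<in> borel_measurable M" if "j < k" for j
    using t that by (intro additive_process_measurable[OF additive]) simp
  show "distr M (borel_Rvec k) (\<lambda>\<omega>. \<lambda>j\<in>{..<k}. X (t j) \<omega>)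
      = distr (completion N) (borel_Rvec k) (\<lambda>\<omega>. \<lambda>j\<in>{..<k}. ?J (t j) \<omega>)"
  proof (rule distr_borel_Rvec_eqI[OF prob_space_axioms C.prob_space_axioms X_meas J_meas])
    fix \<theta> :: "nat \<Rightarrow> real"
    have "(\<lambda>n. CLINT \<omega>|M. iexp (\<Sum>j<k. \<theta> j * (W (b j) \<omega> - W (a n j) \<omega>)))
        \<longlonglongrightarrow> (CLINT \<omega>|completion M. iexp (\<Sum>j<k. \<theta> j * X (t j) \<omega>))"
    proof (rule tendsto_iexp_integral[OF prob_space_axioms])
      show "AE \<omega> in M. (\<lambda>n. \<Sum>j<k. \<theta> j * (W (b j) \<omega> - W (a n j) \<omega>)) \<longlonglongrightarrow> (\<Sum>j<k. \<theta> j * X (t j) \<omega>)"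
        using W_lim by eventually_elim (intro tendsto_sum tendsto_mult tendsto_const, simp)
    qed measurable
    moreover have "(\<lambda>n. CLINT \<omega>|completion N. iexp (\<Sum>j<k. \<theta> j * levy_integral L (a n j) (b j) \<omega>))
        \<longlonglongrightarrow> (CLINT \<omega>|completion (completion N). iexp (\<Sum>j<k. \<theta> j * ?J (t j) \<omega>))"
    proof (rule tendsto_iexp_integral[OF C.prob_space_axioms])
      show "(\<lambda>\<omega>. \<Sum>j<k. \<theta> j * levy_integral L (a n j) (b j) \<omega>) \<in> borel_measurable (completion N)" for n
        by (intro borel_measurable_sum borel_measurable_times borel_measurable_const levy_integral_measurable[OF L ab])
      show "AE \<omega> in completion N. (\<lambda>n. \<Sum>j<k. \<theta> j * levy_integral L (a n j) (b j) \<omega>) \<longlonglongrightarrow> (\<Sum>j<k. \<theta> j * ?J (t j) \<omega>)"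
        using J_lim by eventually_elim (intro tendsto_sum tendsto_mult tendsto_const, simp)
    qed
    \<comment> \<open>For each \<open>n\<close> the intervals are bounded, so the characteristic
      functions agree exactly, and the equality passes to the limit.\<close>
    moreover have "(CLINT \<omega>|M. iexp (\<Sum>j<k. \<theta> j * (W (b j) \<omega> - W (a n j) \<omega>)))
        = (CLINT \<omega>|completion N. iexp (\<Sum>j<k. \<theta> j * levy_integral L (a n j) (b j) \<omega>))" for n
      by (rule levy_integral_char[OF L]) (use ab in simp)
    ultimately have "(CLINT \<omega>|completion M. iexp (\<Sum>j<k. \<theta> j * X (t j) \<omega>))
        = (CLINT \<omega>|completion (completion N). iexp (\<Sum>j<k. \<theta> j * ?J (t j) \<omega>))"
      by (simp only: LIMSEQ_unique)
    moreover have "(CLINT \<omega>|completion M. iexp (\<Sum>j<k. \<theta> j * X (t j) \<omega>)) = (CLINT \<omega>|M. iexp (\<Sum>j<k. \<theta> j * X (t j) \<omega>))"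
    proof (rule integral_completion)
      have [measurable]: "(\<lambda>\<omega>. \<Sum>j<k. \<theta> j * X (t j) \<omega>) \<in> borel_measurable M"
        by (intro borel_measurable_sum borel_measurable_times borel_measurable_const X_meas) simp
      show "(\<lambda>\<omega>. iexp (\<Sum>j<k. \<theta> j * X (t j) \<omega>)) \<in> borel_measurable M" by measurable
    qed
    moreover have "(CLINT \<omega>|completion (completion N). iexp (\<Sum>j<k. \<theta> j * ?J (t j) \<omega>)) = (CLINT \<omega>|completion N. iexp (\<Sum>j<k. \<theta> j * ?J (t j) \<omega>))"
    proof (rule integral_completion)
      have [measurable]: "(\<lambda>\<omega>. \<Sum>j<k. \<theta> j * ?J (t j) \<omega>) \<in> borel_measurable (completion N)"
        by (intro borel_measurable_sum borel_measurable_times borel_measurable_const J_meas) simp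
      show "(\<lambda>\<omega>. iexp (\<Sum>j<k. \<theta> j * ?J (t j) \<omega>)) \<in> borel_measurable (completion N)" by measurable
    qed
    ultimately show "(CLINT \<omega>|M. iexp (\<Sum>j<k. \<theta> j * X (t j) \<omega>)) = (CLINT \<omega>|completion N. iexp (\<Sum>j<k. \<theta> j * ?J (t j) \<omega>))"
      by simp
  qed
qed

end

theorem corollary2p5:
  fixes \<alpha> \<delta> :: real
    and M :: "'a measure" and X :: "real \<Rightarrow> 'a \<Rightarrow> real"
    and \<mu> :: "real measure"
  assumes "additive_process M X"
    and "dilatively_stable M X \<alpha> \<delta>"
    and "\<mu> = law M (\<lambda>\<omega>. random_integral (\<lambda>u. u powr (- \<alpha> + \<delta> / 2)) (\<lambda>u. X u \<omega>) 1 (exp 1))"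
  shows "infdiv \<mu> \<and>
    (\<forall>(N :: 'b measure) L. two_sided_levy_process N L \<mu> \<longrightarrow>
      (\<forall>t>0. AE \<omega> in N. \<exists>l.
         ((\<lambda>a. random_integral (\<lambda>u. exp (u * (\<alpha> - \<delta> / 2))) (\<lambda>u. L (time_change \<delta> u) \<omega>) a (ln t))
           \<longlongrightarrow> l) at_bot) \<and>
      eq_fdd M X (completion N)
        (\<lambda>t \<omega>. if t = 0 then 0
           else random_integral_at_bot (\<lambda>u. exp (u * (\<alpha> - \<delta> / 2)))
                  (\<lambda>u. L (time_change \<delta> u) \<omega>) (ln t)))"
proof -
  interpret dilatively_stable_additive M X \<alpha> \<delta>
    using assms(1,2) by unfold_locales
  have \<mu>: "\<mu> = law M Y"
    unfolding assms(3) Y_def[abs_def] ..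
  show ?thesis
    unfolding \<mu>
  proof (intro conjI allI impI infdiv_law_Y)
    fix N :: "'b measure" and L
    assume L: "two_sided_levy_process N L (law M Y)"
    then have N: "prob_space N"
      unfolding two_sided_levy_process_def using additive_process_prob_space levy_process_additive by blast
    show "AE \<omega> in N. \<exists>l. ((\<lambda>a. random_integral (\<lambda>u. exp (u * \<beta>)) (\<lambda>u. L (time_change \<delta> u) \<omega>) a (ln t)) \<longlongrightarrow> l) at_bot" for t
      using levy_integral_convergent_AE[OF L N] unfolding levy_integral_def by eventually_elim blast
    show "eq_fdd M X (completion N)
        (\<lambda>t \<omega>. if t = 0 then 0
           else random_integral_at_bot (\<lambda>u. exp (u * \<beta>)) (\<lambda>u. L (time_change \<delta> u) \<omega>) (ln t))"
      by (rule eq_fdd_levy_integral[OF L N])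
  qed
qed

end
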